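(* Let $\mu$ be a measure on the Borel subsets of $(0,\infty)$ such that $$0 < \int_0^{\infty} \frac{\lambda}{\lambda^2+1}\, d\mu(\lambda) < \infty .$$ With $f_\mu$, $G_\mu$, $L(\lambda,z)$ and $\widehat L(\lambda,t)$ as defined in the context, the following hold. (i) The real entire function $G_\mu(z)$ has exponential type at most $2\pi$. (ii) For real $x\neq 0$ the function $\lambda\mapsto e^{-\lambda|x|}-L(\lambda,x)$ is nonnegative and integrable on $(0,\infty)$ with respect to $\mu$. (iii) For all real $x$, $$0\le f_\mu(x)-G_\mu(x)=\int_0^\infty \{e^{-\lambda|x|}-L(\lambda,x)\}\,d\mu(\lambda).$$ (iv) The nonnegative function $x\mapsto f_\mu(x)-G_\mu(x)$ is integrable on $\mathbb{R}$, and $$\int_{-\infty}^\infty \{f_\mu(x)-G_\mu(x)\}\,dx=\int_0^\infty\left\{\tfrac{2}{\lambda}-\operatorname{csch}\left(\tfrac{\lambda}{2}\right)\right\}d\mu(\lambda).$$ (v) If $t\ne 0$ then $$\int_{-\infty}^\infty\{f_\mu(x)-G_\mu(x)\}e(-tx)\,dx=\int_0^\infty\frac{2\lambda}{\lambda^2+4\pi^2t^2}\,d\mu(\lambda)-\int_0^\infty\widehat L(\lambda,t)\,d\mu(\lambda).$$ (vi) If $\widetilde G(z)$ is a real entire function of exponential type at most $2\pi$ such that $\widetilde G(x)\le f_\mu(x)$ for all real $x$, then $$\int_{-\infty}^\infty\{f_\mu(x)-G_\mu(x)\}\,dx\le\int_{-\infty}^\infty\{f_\mu(x)-\widetilde G(x)\}\,dx.$$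 (vii) There is equality in the inequality of (vi) if and only if $\widetilde G(z)=G_\mu(z)$.
   Context: Conventions: a real entire function is an entire function taking real values on $\mathbb{R}$. An entire function $F$ has exponential type at most $\tau$ if for every $\varepsilon>0$ there is $C_\varepsilon$ with $|F(z)|\le C_\varepsilon e^{(\tau+\varepsilon)|z|}$ for all $z\in\mathbb{C}$. Write $e(z)=e^{2\pi i z}$, and $\operatorname{sgn}(x)=1,0,-1$ according as $x>0$, $x=0$, $x<0$. Integrals of nonnegative functions take values in $[0,\infty]$. For $\lambda>0$ define the entire function (with removable singularities removed) $$L(\lambda,z)=\left(\frac{\cos\pi z}{\pi}\right)^2\left\{\sum_{k\in\mathbb{Z}}\frac{e^{-\lambda|k+\frac12|}}{(z-k-\frac12)^2}-\lambda\sum_{l\in\mathbb{Z}}\frac{\operatorname{sgn}(l+\frac12)e^{-\lambda|l+\frac12|}}{z-l-\frac12}\right\}.$$ It is real entire of exponential type $2\pi$, bounded and integrable on $\mathbb{R}$, and $\widehat L(\lambda,t)=\int_{-\infty}^\infty L(\lambda,x)e(-tx)\,dx$, which is continuous in $t$ and supported on $[-1,1]$. Define $f_\mu:\mathbb{R}\to\mathbb{R}\cup\{\infty\}$ by $$f_\mu(x)=\int_0^\infty\{e^{-\lambda|x|}-e^{-\lambda}\}\,d\mu(\lambda),$$ where $f_\mu(0)=\int_0^\infty\{1-e^{-\lambda}\}\,d\mu(\lambda)$ may equal $\infty$. For $x\ne0$, $f_\mu$ is smooth and $f_\mu'(x)=-\operatorname{sgn}(x)\int_0^\infty\lambda e^{-\lambda|x|}\,d\mu(\lambda)$.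 Define $G_\mu:\mathbb{C}\to\mathbb{C}$ by $$G_\mu(z)=\lim_{N\to\infty}\left(\frac{\cos\pi z}{\pi}\right)^2\left\{\sum_{n=-N}^{N+1}\frac{f_\mu(n-\frac12)}{(z-n+\frac12)^2}+\sum_{n=-N}^{N+1}\frac{f_\mu'(n-\frac12)}{z-n+\frac12}\right\};$$ the limit converges uniformly on compact subsets of $\mathbb{C}$ and defines a real entire function. *)

theory Defs
  imports "HOL-Probability.Probability" "HOL-Complex_Analysis.Complex_Analysis"
begin

definition real_entire :: "(complex \<Rightarrow> complex) \<Rightarrow> bool" where
  "real_entire F \<longleftrightarrow> F holomorphic_on UNIV \<and> (\<forall>x::real. F (of_real x) \<in> \<real>)"

definition exp_type_at_most :: "real \<Rightarrow> (complex \<Rightarrow> complex) \<Rightarrow> bool" where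
  "exp_type_at_most \<tau> F \<longleftrightarrow>
     (\<forall>\<epsilon>>0. \<exists>C::real. \<forall>z. norm (F z) \<le> C * exp ((\<tau> + \<epsilon>) * norm z))"

definition e :: "complex \<Rightarrow> complex" where
  "e z = exp (2 * of_real pi * \<i> * z)"

text \<open>Lebesgue integral with values in the extended reals: the integral of the positive part
  minus the integral of the negative part (note that \<open>e2ennreal\<close> maps negative numbers to 0).
  Meaningful only if at least one of the two is finite, since \<open>\<infinity> - \<infinity> = \<infinity>\<close> for \<open>ereal\<close>.\<close>

definition ext_integral :: "'a measure \<Rightarrow> ('a \<Rightarrow> ereal) \<Rightarrow> ereal" where
  "ext_integral M g =
     enn2ereal (\<integral>\<^sup>+x. e2ennreal (g x) \<partial>M) - enn2ereal (\<integral>\<^sup>+x. e2ennreal (- g x) \<partial>M)"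

definition ext_integrable :: "'a measure \<Rightarrow> ('a \<Rightarrow> ereal) \<Rightarrow> bool" where
  "ext_integrable M g \<longleftrightarrow> g \<in> borel_measurable M \<and> (\<integral>\<^sup>+x. e2ennreal \<bar>g x\<bar> \<partial>M) < \<infinity>"

text \<open>The bracketed terms have poles at the half-integers, where division by zero would make the
  naive value 0; \<open>remove_sings\<close> replaces it by the limit.
  The parameter \<open>s\<close> is usually called lambda. \<open>L s\<close> is real on the real line, as all its
  coefficients are.\<close>

definition L :: "real \<Rightarrow> complex \<Rightarrow> complex" where
  "L s = remove_sings (\<lambda>z. (cos (of_real pi * z) / of_real pi)\<^sup>2 *
     ((\<Sum>\<^sub>\<infinity>k\<in>(UNIV :: int set).
         of_real (exp (- s * \<bar>of_int k + 1/2\<bar>)) / (z - of_int k - 1/2)\<^sup>2)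
      - of_real s * (\<Sum>\<^sub>\<infinity>l\<in>(UNIV :: int set).
         of_real (sgn (of_int l + 1/2) * exp (- s * \<bar>of_int l + 1/2\<bar>)) / (z - of_int l - 1/2))))"

definition L_hat :: "real \<Rightarrow> real \<Rightarrow> complex" where
  "L_hat s t = (\<integral>x. L s (of_real x) * e (of_real (- t * x)) \<partial>lborel)"

definition f_mu :: "real measure \<Rightarrow> real \<Rightarrow> ereal" where
  "f_mu M x = ext_integral M (\<lambda>s. ereal (exp (- s * \<bar>x\<bar>) - exp (- s)))"

text \<open>\<open>f_mu M\<close> is finite away from 0, so that the truncation of \<open>\<infinity>\<close> by \<open>real_of_ereal\<close>
  affects neither the values nor the derivatives at the half-integers.\<close>

definition G_partial :: "real measure \<Rightarrow> nat \<Rightarrow> complex \<Rightarrow> complex" where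
  "G_partial M N = remove_sings (\<lambda>z. (cos (of_real pi * z) / of_real pi)\<^sup>2 *
     ((\<Sum>n = - int N..int N + 1.
         of_real (real_of_ereal (f_mu M (of_int n - 1/2))) / (z - of_int n + 1/2)\<^sup>2)
      + (\<Sum>n = - int N..int N + 1.
         of_real (deriv (\<lambda>x. real_of_ereal (f_mu M x)) (of_int n - 1/2)) / (z - of_int n + 1/2))))"

definition G_mu :: "real measure \<Rightarrow> complex \<Rightarrow> complex" where
  "G_mu M z = lim (\<lambda>N. G_partial M N z)"

text \<open>\<open>f_mu M x - F x\<close> on the real line, for a real entire function \<open>F\<close>.\<close>

definition f_minus :: "real measure \<Rightarrow> (complex \<Rightarrow> complex) \<Rightarrow> real \<Rightarrow> ereal" where
  "f_minus M F x = f_mu M x - ereal (Re (F (of_real x)))"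

end

theory Submission
  imports Defs "HOL-Real_Asymp.Real_Asymp"
begin

text \<open>Off the half-integers, the difference \<open>exp (- s * x) - L s x\<close> for \<open>x > 0\<close> equals
  \<open>(cos (pi * x) / pi)\<^sup>2\<close> times the Laplace transform of \<open>w \<mapsto> H (s - w) - H (s + w)\<close> with
  \<open>H u = (u / 2) / sinh (u / 2)\<close>, which is even and decreasing in \<open>\<bar>u\<bar>\<close>. So the difference is
  nonnegative, vanishes at the half-integers and is at most a multiple of
  \<open>s / (1 + s\<^sup>2) * (cos (pi * x) / x)\<^sup>2\<close>. Integrating over the measure and using Fubini, one gets
  the claims about \<open>G_mu\<close>, where \<open>exp (- s)\<close> is subtracted from \<open>L s z\<close>, and from the interpolation
  sums via the partial fractions of \<open>1 / cos\<^sup>2\<close>, to make the integrals converge.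

  For extremality, the difference \<open>D\<close> of \<open>G_mu\<close> and a minorant has type \<open>2 pi\<close>, so that for
  \<open>c < 1\<close> its integral equals the quadrature sum of the values \<open>c * D (c * (k + 1/2))\<close>. As
  \<open>c \<rightarrow> 1\<close> the contribution of \<open>f_mu - G_mu\<close> at these nodes tends to 0, so the integral of \<open>D\<close>
  is at least every single value of \<open>f_mu\<close> minus the minorant at a half-integer. If it is 0, then
  \<open>D\<close> has double zeros at all half-integers and is a multiple of \<open>cos\<^sup>2\<close>, hence 0 by integrability.\<close>

text \<open>The hypothesis supplies one integrable weight, \<open>s / (1 + s\<^sup>2)\<close>, so
  each estimate to be integrated over the measure is brought into the form of a constant times this
  weight: it has to be of order \<open>s\<close> near 0 and \<open>1 / s\<close> at infinity.
  \<open>H\<close> is forced by the nodes: for \<open>x > 0\<close>,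
  \<open>1 / (x + a)\<^sup>2\<close> is the Laplace transform of \<open>w * exp (- w * a)\<close>,
  and \<open>u * exp (- u * a)\<close> summed over the positive half-integers \<open>a\<close> gives
  \<open>u / (2 * sinh (u / 2))\<close>. The summand \<open>H (s + w)\<close> collects the nodes on
  the negative axis, \<open>H (s - w)\<close> those on the positive axis together with
  \<open>exp (- s * x)\<close> itself. The quadrature is proved by residues, for a primitive, since
  integrability on the real line bounds the primitive directly. Dilated nodes slightly miss the
  zeros of \<open>f_mu - G_mu\<close>; the factor \<open>(cos (pi * x) / x)\<^sup>2\<close> keeps
  the sum of these errors of order \<open>sqrt (1 - c)\<close>.\<close>

section \<open>Entire functions of exponential type\<close>

text \<open>Edges at a right angle control growth of order below 2. In terms of \<open>z\<close> the
  damping factor is the exponential of \<open>- \<delta> * (1 - 2 * \<i>)\<close> times the power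
  3/2 of \<open>z\<close>: order 3/2 beats exponential growth, and \<delta> tends to 0 in the
  end.\<close>

lemma Phragmen_Lindelof_quadrant:
  fixes g :: "complex \<Rightarrow> complex"
  assumes holo: "g holomorphic_on UNIV"
    and growth: "\<And>z. norm (g z) \<le> C * exp (A * norm z)"
    and B: "0 < B"
    and bx: "\<And>x. 0 \<le> x \<Longrightarrow> norm (g (of_real x)) \<le> B"
    and b_im: "\<And>y. 0 \<le> y \<Longrightarrow> norm (g (\<i> * of_real y)) \<le> B"
    and z: "0 \<le> Re z" "0 \<le> Im z"
  shows "norm (g z) \<le> B"
proof -
  \<comment> \<open>The square root maps the quadrant to a sector of opening \<open>pi / 4\<close>, on which the real part of
    \<open>(1 - 2 * \<i>) * s^3\<close> dominates the growth exponent \<open>A * norm (s\<^sup>2)\<close>.\<close>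
  define s0 where "s0 = csqrt z"
  have s0sq: "s0\<^sup>2 = z" by (simp add: s0_def)
  have s0: "0 \<le> Im s0" "Im s0 \<le> Re s0"
    using z complex_Re_le_cmod[of z] by (auto simp: s0_def)
  \<comment> \<open>At \<open>s\<close> of argument \<open>t\<close> the right side is
    \<open>norm s ^ 3 * (cos (3 * t) + 2 * sin (3 * t))\<close>, positive for
    \<open>0 \<le> t \<le> pi / 4\<close>. The plain cube has negative real part once
    \<open>3 * t\<close> exceeds \<open>pi / 2\<close>.\<close>
  have cube: "(Re s)^3 \<le> Re ((1 - 2*\<i>) * s^3)" if "0 \<le> Im s" "Im s \<le> Re s" for s
  proof -
    define p q where "p = Re s" and "q = Im s"
    have pq: "0 \<le> q" "q \<le> p" using that by (auto simp: p_def q_def)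
    have "Re ((1 - 2*\<i>) * s^3) = p^3 + q * (6*p\<^sup>2 - 3*(p*q) - 2*q\<^sup>2)"
      unfolding p_def q_def by (simp add: power3_eq_cube power2_eq_square algebra_simps)
    moreover have "p*q \<le> p\<^sup>2" "q\<^sup>2 \<le> p\<^sup>2"
      using pq by (auto simp: power2_eq_square intro: mult_mono)
    hence "0 \<le> 6*p\<^sup>2 - 3*(p*q) - 2*q\<^sup>2"
      using zero_le_power2[of p] by linarith
    ultimately show ?thesis using pq by (simp add: p_def)
  qed
  have C: "0 \<le> C"
    using growth[of 0] order.trans[OF norm_ge_zero] by (simp add: order.trans[OF norm_ge_zero])
  define A' where "A' = \<bar>A\<bar> + 1"
  have A': "0 < A'" "A \<le> A'" by (auto simp: A'_def)
  have bound: "norm (g z) * exp (- \<delta> * Re ((1 - 2*\<i>) * s0^3)) \<le> B" if \<delta>: "0 < \<delta>" for \<delta>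
  proof (cases "Im s0 = 0 \<or> Im s0 = Re s0")
    case True
    have "norm (g z) \<le> B"
    proof (cases "Im s0 = 0")
      case True
      hence "z = of_real ((Re s0)\<^sup>2)" unfolding s0sq[symmetric]
        by (simp add: complex_eq_iff power2_eq_square)
      thus ?thesis using bx[of "(Re s0)\<^sup>2"] by simp
    next
      case False
      with True have "z = \<i> * of_real (2 * (Re s0)\<^sup>2)" unfolding s0sq[symmetric]
        by (simp add: complex_eq_iff power2_eq_square)
      thus ?thesis using b_im[of "2 * (Re s0)\<^sup>2"] by simp
    qed
    moreover have "exp (- \<delta> * Re ((1 - 2*\<i>) * s0^3)) \<le> 1"
    proof -
      have "0 \<le> (Re s0)^3" using s0 by simp
      also note cube[OF s0]
      finally show ?thesis using \<delta> by simp
    qed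
    ultimately show ?thesis
      using mult_mono[of "norm (g z)" B "exp (- \<delta> * Re ((1 - 2*\<i>) * s0^3))" 1] B by simp
  next
    case False
    define h where "h = (\<lambda>s. g (s\<^sup>2) * exp (- of_real \<delta> * ((1 - 2*\<i>) * s^3)))"
    have norm_h: "norm (h s) = norm (g (s\<^sup>2)) * exp (- \<delta> * Re ((1 - 2*\<i>) * s^3))" for s
      by (simp add: h_def norm_mult)
    \<comment> \<open>\<open>R^3 / 8\<close> is the lower bound for the damping exponent on the arc,
      because \<open>norm s \<le> 2 * Re s\<close> in the sector.\<close>
    have "((\<lambda>R::real. C * exp (A' * R\<^sup>2 - \<delta> * R^3 / 8)) \<longlongrightarrow> 0) at_top"
      using \<delta> A' by real_asymp
    from order_tendstoD(2)[OF this B] have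
      "\<forall>\<^sub>F R in at_top. C * exp (A' * R\<^sup>2 - \<delta> * R^3 / 8) < B \<and> norm s0 < R"
      by (intro eventually_conj eventually_gt_at_top)
    then obtain R where R: "C * exp (A' * R\<^sup>2 - \<delta> * R^3 / 8) < B" "norm s0 < R"
      by (metis (mono_tags, lifting) eventually_at_top_linorder order_refl)
    define S where "S = {s. 0 < Im s \<and> Im s < Re s} \<inter> ball 0 R"
    have opS: "open S" unfolding S_def
      by (intro open_Int open_Collect_conj open_Collect_less continuous_intros open_ball)
    have clS: "closure S \<subseteq> {s. 0 \<le> Im s \<and> Im s \<le> Re s} \<inter> cball 0 R"
      by (rule closure_minimal)
        (auto simp: S_def intro!: closed_Int closed_Collect_conj closed_Collect_le continuous_intros)
    have hol: "h holomorphic_on A" for A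
      unfolding h_def
      by (intro holomorphic_intros holomorphic_on_compose_gen[OF _ holo, of "\<lambda>s. s\<^sup>2", unfolded o_def])
        auto
    have "norm (h s0) \<le> B"
    proof (rule maximum_modulus_frontier[of h S])
      show "h holomorphic_on interior S" by (rule hol)
      show "continuous_on (closure S) h" by (intro holomorphic_on_imp_continuous_on hol)
      show "bounded S" unfolding S_def by (meson bounded_Int bounded_ball)
      show "s0 \<in> S" using False s0 R by (auto simp: S_def)
      fix s assume "s \<in> frontier S"
      hence s: "s \<in> closure S" "s \<notin> S" using opS by (auto simp: frontier_def interior_open)
      with clS have sT: "0 \<le> Im s" "Im s \<le> Re s" "norm s \<le> R" by auto
      have cu: "(Re s)^3 \<le> Re ((1 - 2*\<i>) * s^3)" by (rule cube[OF sT(1,2)])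
      have le1: "exp (- \<delta> * Re ((1 - 2*\<i>) * s^3)) \<le> 1"
      proof -
        have "0 \<le> (Re s)^3" using sT by simp
        also note cu
        finally show ?thesis using \<delta> by simp
      qed
      consider "Im s = 0" | "Im s = Re s" | "norm s = R" using s sT by (force simp: S_def)
      thus "norm (h s) \<le> B"
      proof cases
        case 1
        hence "s\<^sup>2 = of_real ((Re s)\<^sup>2)" by (simp add: complex_eq_iff power2_eq_square)
        hence "norm (g (s\<^sup>2)) \<le> B" using bx[of "(Re s)\<^sup>2"] by simp
        thus ?thesis unfolding norm_h using mult_mono[OF _ le1, of "norm (g (s\<^sup>2))" B] B by simp
      next
        case 2
        hence "s\<^sup>2 = \<i> * of_real (2 * (Re s)\<^sup>2)" by (simp add: complex_eq_iff power2_eq_square)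
        hence "norm (g (s\<^sup>2)) \<le> B" using b_im[of "2 * (Re s)\<^sup>2"] by simp
        thus ?thesis unfolding norm_h using mult_mono[OF _ le1, of "norm (g (s\<^sup>2))" B] B by simp
      next
        case 3
        have "norm s \<le> 2 * Re s" using sT cmod_le[of s] by simp
        hence "R / 2 \<le> Re s" using 3 by simp
        moreover have "0 \<le> R" using 3 by auto
        ultimately have "(R/2)^3 \<le> (Re s)^3" by (intro power_mono) auto
        with cu have "R^3/8 \<le> Re ((1 - 2*\<i>) * s^3)" by (simp add: power_divide)
        hence "\<delta> * (R^3/8) \<le> \<delta> * Re ((1 - 2*\<i>) * s^3)" using \<delta> by (intro mult_left_mono) auto
        moreover have "norm (g (s\<^sup>2)) \<le> C * exp (A' * R\<^sup>2)"
        proof -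
          have "norm (g (s\<^sup>2)) \<le> C * exp (A * norm (s\<^sup>2))" by (rule growth)
          also have "\<dots> \<le> C * exp (A' * R\<^sup>2)"
            using A' C 3 by (auto simp: norm_power intro!: mult_left_mono mult_right_mono)
          finally show ?thesis .
        qed
        ultimately have "norm (h s) \<le> C * exp (A' * R\<^sup>2) * exp (- (\<delta> * R^3/8))"
          unfolding norm_h using C by (intro mult_mono) auto
        also have "\<dots> = C * exp (A' * R\<^sup>2 - \<delta> * R^3 / 8)"
          by (simp add: mult.assoc flip: exp_add)
        finally show ?thesis using R by simp
      qed
    qed
    thus ?thesis unfolding norm_h s0sq .
  qed
  have "((\<lambda>\<delta>. norm (g z) * exp (- \<delta> * Re ((1 - 2*\<i>) * s0^3))) \<longlongrightarrow>
          norm (g z) * exp (- 0 * Re ((1 - 2*\<i>) * s0^3))) (at_right 0)"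
    by (intro tendsto_intros)
  moreover have "\<forall>\<^sub>F \<delta> in at_right 0. norm (g z) * exp (- \<delta> * Re ((1 - 2*\<i>) * s0^3)) \<le> B"
    using eventually_at_right_less[of "0::real"] by eventually_elim (rule bound)
  ultimately have "norm (g z) * exp (- 0 * Re ((1 - 2*\<i>) * s0^3)) \<le> B"
    by (rule tendsto_upperbound) simp
  thus ?thesis by simp
qed

text \<open>The two quadrants only give the bound \<open>max B B'\<close>. To get rid of
  \<open>B'\<close>, divide by \<open>1 - \<i> * \<delta> * z\<close>, which is unbounded and of
  modulus at least 1 in the half-plane: on a large half-circle the quotient falls below
  \<open>B\<close>, and then \<delta> tends to 0.\<close>

lemma Phragmen_Lindelof_halfplane:
  fixes g :: "complex \<Rightarrow> complex"
  assumes holo: "g holomorphic_on UNIV"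
    and growth: "\<And>z. norm (g z) \<le> C * exp (A * norm z)"
    and B: "0 < B"
    and bx: "\<And>x. norm (g (of_real x)) \<le> B"
    and b_im: "\<And>y. 0 \<le> y \<Longrightarrow> norm (g (\<i> * of_real y)) \<le> B'"
    and z: "0 \<le> Im z"
  shows "norm (g z) \<le> B"
proof -
  define M where "M = max B B'"
  have M: "0 < M" "B \<le> M" "B' \<le> M" using B by (auto simp: M_def)
  have q1: "norm (g w) \<le> M" if "0 \<le> Re w" "0 \<le> Im w" for w
    by (rule Phragmen_Lindelof_quadrant[OF holo growth])
      (use M that in \<open>auto intro: order.trans[OF bx] order.trans[OF b_im]\<close>)
  have q2: "norm (g (\<i> * w)) \<le> M" if "0 \<le> Re w" "0 \<le> Im w" for w
  proof (rule Phragmen_Lindelof_quadrant[where g = "\<lambda>w. g (\<i> * w)"])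
    show "(\<lambda>w. g (\<i> * w)) holomorphic_on UNIV"
      by (intro holomorphic_on_compose_gen[OF _ holo, unfolded o_def] holomorphic_intros) auto
    show "norm (g (\<i> * w)) \<le> C * exp (A * norm w)" for w
      using growth[of "\<i> * w"] by (simp add: norm_mult)
    show "norm (g (\<i> * (\<i> * of_real y))) \<le> M" for y
      using bx[of "-y"] M by (simp add: mult.assoc[symmetric])
  qed (use M that in \<open>auto intro: order.trans[OF b_im]\<close>)
  have gM: "norm (g w) \<le> M" if "0 \<le> Im w" for w
  proof (cases "0 \<le> Re w")
    case False
    thus ?thesis using q2[of "-\<i> * w"] that by (simp add: mult.assoc[symmetric])
  qed (use q1 that in auto)
  have ge1: "1 \<le> norm (1 - \<i> * of_real \<delta> * w)" if "0 < \<delta>" "0 \<le> Im w" for \<delta> w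
    using complex_Re_le_cmod[of "1 - \<i> * of_real \<delta> * w"] that by simp (smt (verit) mult_nonneg_nonneg)
  have bound: "norm (g z) \<le> B * norm (1 - \<i> * of_real \<delta> * z)" if \<delta>: "0 < \<delta>" for \<delta>
  proof (cases "Im z = 0")
    case True
    hence "z = of_real (Re z)" by (simp add: complex_eq_iff)
    hence "norm (g z) \<le> B * 1" using bx by (metis mult.right_neutral)
    also have "\<dots> \<le> B * norm (1 - \<i> * of_real \<delta> * z)" using ge1[OF \<delta> z] B by (intro mult_left_mono) auto
    finally show ?thesis .
  next
    case False
    define h where "h = (\<lambda>w. g w / (1 - \<i> * of_real \<delta> * w))"
    \<comment> \<open>Chosen so that on the arc \<open>norm (1 - \<i> * \<delta> * w) \<ge> \<delta>
      * R - 1 \<ge> M / B\<close>.\<close>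
    define R where "R = norm z + 1 + (M / B + 1) / \<delta>"
    have R: "norm z < R" "(M / B + 1) / \<delta> \<le> R" using M B \<delta> by (auto simp: R_def add_pos_pos intro: add_pos_nonneg)
    define S where "S = {w. 0 < Im w} \<inter> ball 0 R"
    have opS: "open S" unfolding S_def
      by (intro open_Int open_Collect_less continuous_intros open_ball)
    have clS: "closure S \<subseteq> {w. 0 \<le> Im w} \<inter> cball 0 R"
      by (rule closure_minimal)
        (auto simp: S_def intro!: closed_Int closed_Collect_le continuous_intros)
    have hol: "h holomorphic_on {w. 0 \<le> Im w}"
      unfolding h_def using ge1[OF \<delta>]
      by (intro holomorphic_intros holomorphic_on_subset[OF holo]) fastforce+
    have "norm (h z) \<le> B"
    proof (rule maximum_modulus_frontier[of h S])
      show "h holomorphic_on interior S" by (rule holomorphic_on_subset[OF hol]) (use interior_subset[of S] in \<open>force simp: S_def\<close>)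
      show "continuous_on (closure S) h"
        by (intro holomorphic_on_imp_continuous_on holomorphic_on_subset[OF hol]) (use clS in auto)
      show "bounded S" unfolding S_def by (meson bounded_Int bounded_ball)
      show "z \<in> S" using False z R by (auto simp: S_def)
      fix w assume "w \<in> frontier S"
      hence s: "w \<in> closure S" "w \<notin> S" using opS by (auto simp: frontier_def interior_open)
      with clS have sT: "0 \<le> Im w" "norm w \<le> R" by auto
      have n: "norm (h w) = norm (g w) / norm (1 - \<i> * of_real \<delta> * w)" by (simp add: h_def norm_divide)
      consider "Im w = 0" | "norm w = R" using s sT by (force simp: S_def)
      thus "norm (h w) \<le> B"
      proof cases
        case 1
        hence "w = of_real (Re w)" by (simp add: complex_eq_iff)
        hence "norm (g w) \<le> B" using bx by metis
        thus ?thesis unfolding n using ge1[OF \<delta> sT(1)] B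
          by (smt (verit) divide_le_eq_1_pos divide_right_mono frac_le norm_ge_zero div_by_1)
      next
        case 2
        have "(M / B + 1) \<le> \<delta> * R" using R \<delta> by (simp add: field_simps)
        also have "\<delta> * R = norm (\<i> * of_real \<delta> * w)" using 2 \<delta> by (simp add: norm_mult)
        also have "\<dots> - 1 \<le> norm (1 - \<i> * of_real \<delta> * w)"
          by (smt (verit) norm_minus_commute norm_one norm_triangle_ineq2)
        finally have "M / B \<le> norm (1 - \<i> * of_real \<delta> * w)" by simp
        hence "M \<le> B * norm (1 - \<i> * of_real \<delta> * w)" using B by (simp add: field_simps)
        hence "norm (g w) \<le> B * norm (1 - \<i> * of_real \<delta> * w)" using gM[OF sT(1)] by simp
        thus ?thesis unfolding n using ge1[OF \<delta> sT(1)] B by (auto simp: divide_le_eq)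
      qed
    qed
    moreover have "norm (g z) = norm (h z) * norm (1 - \<i> * of_real \<delta> * z)"
      using ge1[OF \<delta> z] by (auto simp: h_def norm_divide)
    ultimately show ?thesis by (simp add: mult_right_mono)
  qed
  have "((\<lambda>\<delta>. B * norm (1 - \<i> * of_real \<delta> * z)) \<longlongrightarrow> B * norm (1 - \<i> * of_real 0 * z)) (at_right 0)"
    by (intro tendsto_intros)
  moreover have "\<forall>\<^sub>F \<delta> in at_right 0. norm (g z) \<le> B * norm (1 - \<i> * of_real \<delta> * z)"
    using eventually_at_right_less[of "0::real"] by eventually_elim (rule bound)
  ultimately have "norm (g z) \<le> B * norm (1 - \<i> * of_real 0 * z)"
    by (rule tendsto_lowerbound) simp
  thus ?thesis by simp
qed

text \<open>Multiplying by \<open>exp (\<i> * (\<tau> + \<epsilon>) * z)\<close> keeps the modulus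
  on the real line and cancels the growth along the positive imaginary axis, so the half-plane
  principle applies with bound \<open>B\<close>. The lower half-plane follows by reflection.\<close>

lemma exp_type_bounded_on_reals:
  fixes F :: "complex \<Rightarrow> complex"
  assumes holo: "F holomorphic_on UNIV" and ty: "exp_type_at_most \<tau> F"
    and B: "0 < B" and bx: "\<And>x::real. norm (F (of_real x)) \<le> B"
  shows "norm (F z) \<le> B * exp (\<tau> * \<bar>Im z\<bar>)"
proof -
  have upper: "norm (F z) \<le> B * exp (\<tau> * Im z)"
    if holo: "F holomorphic_on UNIV" and ty: "exp_type_at_most \<tau> F"
    and bx: "\<And>x::real. norm (F (of_real x)) \<le> B" and z: "0 \<le> Im z" for F :: "complex \<Rightarrow> complex" and z
  proof -
    have *: "norm (F z) \<le> B * exp ((\<tau> + \<epsilon>) * Im z)" if \<epsilon>: "0 < \<epsilon>" for \<epsilon>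
    proof -
      from ty \<epsilon> obtain C where C: "\<And>z. norm (F z) \<le> C * exp ((\<tau> + \<epsilon>) * norm z)"
        unfolding exp_type_at_most_def by blast
      have C0: "0 \<le> C" using C[of 0] order.trans[OF norm_ge_zero] by fastforce
      define g where "g = (\<lambda>z. F z * exp (\<i> * of_real (\<tau> + \<epsilon>) * z))"
      have ng: "norm (g z) = norm (F z) * exp (- (\<tau> + \<epsilon>) * Im z)" for z
        by (simp add: g_def norm_mult algebra_simps)
      have "norm (g z) \<le> B"
      proof (rule Phragmen_Lindelof_halfplane[where g = g])
        show "g holomorphic_on UNIV" unfolding g_def by (intro holomorphic_intros holo)
        show "norm (g z) \<le> C * exp (2 * \<bar>\<tau> + \<epsilon>\<bar> * norm z)" for z
        proof -
          have "norm (g z) \<le> C * exp (\<bar>\<tau> + \<epsilon>\<bar> * norm z) * exp (\<bar>\<tau> + \<epsilon>\<bar> * norm z)"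
            unfolding ng
          proof (intro mult_mono)
            show "norm (F z) \<le> C * exp (\<bar>\<tau> + \<epsilon>\<bar> * norm z)"
              by (rule order.trans[OF C]) (auto intro!: mult_left_mono mult_right_mono C0)
            have "- (\<tau> + \<epsilon>) * Im z \<le> \<bar>\<tau> + \<epsilon>\<bar> * \<bar>Im z\<bar>"
              by (metis abs_ge_self abs_minus_cancel abs_mult)
            also have "\<dots> \<le> \<bar>\<tau> + \<epsilon>\<bar> * norm z" by (intro mult_left_mono abs_Im_le_cmod) auto
            finally show "exp (- (\<tau> + \<epsilon>) * Im z) \<le> exp (\<bar>\<tau> + \<epsilon>\<bar> * norm z)" by simp
          qed (use C0 in auto)
          thus ?thesis by (simp add: mult_ac flip: exp_add)
        qed
        show "norm (g (of_real x)) \<le> B" for x using bx by (simp add: ng)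
        show "norm (g (\<i> * of_real y)) \<le> C" if "0 \<le> y" for y
        proof -
          have "norm (g (\<i> * of_real y)) \<le> C * exp ((\<tau> + \<epsilon>) * y) * exp (- (\<tau> + \<epsilon>) * y)"
            unfolding ng using C[of "\<i> * of_real y"] that C0 by (intro mult_mono) (auto simp: norm_mult)
          also have "\<dots> = C" by (simp add: mult.assoc flip: exp_add) (simp add: algebra_simps)
          finally show ?thesis .
        qed
      qed (use B z in auto)
      hence "norm (F z) * exp (- (\<tau> + \<epsilon>) * Im z) * exp ((\<tau> + \<epsilon>) * Im z) \<le> B * exp ((\<tau> + \<epsilon>) * Im z)"
        unfolding ng by (intro mult_right_mono) auto
      moreover have "- (\<tau> + \<epsilon>) * Im z + (\<tau> + \<epsilon>) * Im z = 0" by (simp add: algebra_simps)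
      ultimately show ?thesis by (simp only: mult.assoc exp_add[symmetric] exp_zero mult_1_right)
    qed
    have "((\<lambda>\<epsilon>. B * exp ((\<tau> + \<epsilon>) * Im z)) \<longlongrightarrow> B * exp ((\<tau> + 0) * Im z)) (at_right 0)"
      by (intro tendsto_intros)
    moreover have "\<forall>\<^sub>F \<epsilon> in at_right 0. norm (F z) \<le> B * exp ((\<tau> + \<epsilon>) * Im z)"
      using eventually_at_right_less[of "0::real"] by eventually_elim (rule *)
    ultimately have "norm (F z) \<le> B * exp ((\<tau> + 0) * Im z)"
      by (rule tendsto_lowerbound) simp
    thus ?thesis by simp
  qed
  show ?thesis
  proof (cases "0 \<le> Im z")
    case True
    thus ?thesis using upper[OF holo ty bx] by simp
  next
    case False
    have "norm ((\<lambda>z. F (-z)) (-z)) \<le> B * exp (\<tau> * Im (-z))"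
    proof (rule upper)
      show "(\<lambda>z. F (-z)) holomorphic_on UNIV"
        by (intro holomorphic_on_compose_gen[OF _ holo, unfolded o_def] holomorphic_intros) auto
      show "exp_type_at_most \<tau> (\<lambda>z. F (-z))"
        using ty unfolding exp_type_at_most_def by (metis norm_minus_cancel)
      show "norm (F (- of_real x)) \<le> B" for x using bx[of "-x"] by simp
    qed (use False in auto)
    thus ?thesis using False by simp
  qed
qed

section \<open>Normal families and primitives of integrable functions\<close>

text \<open>By Montel's theorem a subsequence converges to a holomorphic function, which must be the
  pointwise limit.\<close>

lemma holomorphic_pointwise_limit:
  fixes F :: "nat \<Rightarrow> complex \<Rightarrow> complex"
  assumes hol: "\<And>N. F N holomorphic_on UNIV"
    and bd: "\<And>r. \<exists>B. \<forall>N z. norm z \<le> r \<longrightarrow> norm (F N z) \<le> B"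
    and lim: "\<And>z. (\<lambda>N. F N z) \<longlonglongrightarrow> G z"
  shows "G holomorphic_on UNIV"
proof -
  obtain g r where g: "g holomorphic_on UNIV" "strict_mono (r :: nat \<Rightarrow> nat)"
    "\<And>x. x \<in> UNIV \<Longrightarrow> (\<lambda>n. F (r n) x) \<longlonglongrightarrow> g x"
  proof (rule Montel[of UNIV "range F" F])
    fix K :: "complex set" assume "compact K"
    then obtain b where b: "\<forall>z\<in>K. norm z \<le> b" using compact_imp_bounded[of K] bounded_iff[of K] by blast
    from bd[of b] obtain B where "\<forall>N z. norm z \<le> b \<longrightarrow> norm (F N z) \<le> B" by blast
    with b show "\<exists>B. \<forall>h\<in>range F. \<forall>z\<in>K. norm (h z) \<le> B" by blast
  qed (use hol in auto)
  have "G z = g z" for z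
    using LIMSEQ_unique[OF LIMSEQ_subseq_LIMSEQ[OF lim g(2), unfolded o_def] g(3)] by simp
  hence "G = g" by blast
  thus ?thesis using g by simp
qed

text \<open>Convergence along horizontal translates spreads from the real line to the plane, in the
  manner of Vitali: the translates are a normal family on account of the bound, and a subsequential
  limit equals \<open>l\<close> on the reals, hence everywhere.\<close>

lemma translates_tendsto:
  fixes E :: "complex \<Rightarrow> complex" and X :: "nat \<Rightarrow> real"
  assumes hol: "E holomorphic_on UNIV"
    and bd: "\<And>z. norm (E z) \<le> B * exp (\<tau> * \<bar>Im z\<bar>)"
    and lim: "\<And>t. (\<lambda>n. E (of_real (X n + t))) \<longlonglongrightarrow> l"
  shows "(\<lambda>n. E (of_real (X n) + w)) \<longlonglongrightarrow> l"
proof (rule ccontr)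
  have B: "0 \<le> B" using bd[of 0] order.trans[OF norm_ge_zero] by fastforce
  assume "\<not> ?thesis"
  then obtain \<epsilon> where \<epsilon>: "\<epsilon> > 0" "\<forall>N. \<exists>n\<ge>N. \<epsilon> \<le> dist (E (of_real (X n) + w)) l"
    unfolding lim_sequentially by (meson not_less)
  define A where "A = {n. \<epsilon> \<le> dist (E (of_real (X n) + w)) l}"
  have "infinite A" using \<epsilon>(2) unfolding A_def infinite_nat_iff_unbounded_le by blast
  then obtain s :: "nat \<Rightarrow> nat" where s: "strict_mono s" "\<And>n. s n \<in> A"
    using infinite_enumerate by blast
  define F where "F = (\<lambda>n z. E (of_real (X (s n)) + z))"
  obtain g r where g: "g holomorphic_on UNIV" "strict_mono (r :: nat \<Rightarrow> nat)"
    "\<And>x. x \<in> UNIV \<Longrightarrow> (\<lambda>n. F (r n) x) \<longlonglongrightarrow> g x"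
  proof (rule Montel[of UNIV "range F" F])
    show "h holomorphic_on UNIV" if h': "h \<in> range F" for h
    proof -
      obtain n where h: "h = (\<lambda>z. E (of_real (X (s n)) + z))" using h' unfolding F_def by auto
      show ?thesis unfolding h
        by (rule holomorphic_on_compose_gen[OF _ hol, unfolded o_def]) (auto intro!: holomorphic_intros)
    qed
    fix K :: "complex set" assume "compact K"
    then obtain b where b: "\<forall>z\<in>K. norm z \<le> b" using compact_imp_bounded[of K] bounded_iff[of K] by blast
    have "norm (F n z) \<le> B * exp (\<bar>\<tau>\<bar> * b)" if "z \<in> K" for n z
    proof -
      have "norm (F n z) \<le> B * exp (\<tau> * \<bar>Im z\<bar>)" using bd[of "of_real (X (s n)) + z"] by (simp add: F_def)
      also have "\<tau> * \<bar>Im z\<bar> \<le> \<bar>\<tau>\<bar> * b"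
        using order.trans[OF abs_Im_le_cmod[of z] b[rule_format, OF that]] by (intro mult_mono) auto
      finally show ?thesis using B by (simp add: mult_left_mono)
    qed
    thus "\<exists>B. \<forall>h\<in>range F. \<forall>z\<in>K. norm (h z) \<le> B" by blast
  qed auto
  have gl: "g (of_real t) = l" for t
  proof -
    have "(\<lambda>n. F (r n) (of_real t)) \<longlonglongrightarrow> l"
      using LIMSEQ_subseq_LIMSEQ[OF LIMSEQ_subseq_LIMSEQ[OF lim[of t] s(1)] g(2)]
      by (simp add: F_def o_def)
    thus ?thesis using g(3)[of "of_real t"] LIMSEQ_unique by blast
  qed
  have "g w - l = 0"
  proof (rule analytic_continuation[of "\<lambda>z. g z - l" UNIV "range of_real" 0])
    show "(0::complex) islimpt range of_real"
      unfolding islimpt_approachable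
    proof (intro allI impI)
      fix e :: real assume "e > 0"
      hence "of_real (e/2) \<noteq> (0::complex) \<and> dist (of_real (e/2)) (0::complex) < e" by simp
      thus "\<exists>x'\<in>range of_real. x' \<noteq> (0::complex) \<and> dist x' 0 < e" by blast
    qed
  qed (use gl g in \<open>auto intro!: holomorphic_intros\<close>)
  hence "(\<lambda>n. F (r n) w) \<longlonglongrightarrow> l" using g(3)[of w] by simp
  hence "\<forall>\<^sub>F n in sequentially. dist (F (r n) w) l < \<epsilon>" using \<epsilon>(1) tendstoD by blast
  then obtain n where "dist (F (r n) w) l < \<epsilon>" using eventually_happens'[OF sequentially_bot] by blast
  with s(2)[of "r n"] show False by (simp add: A_def F_def)
qed

text \<open>On the reals the primitive is bounded by a constant plus the integral of
  \<open>norm F\<close>, and it has limits at both ends; Phragmen-Lindelof then bounds it in the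
  plane. The limits are what the vertical sides of the contour in \<open>quadrature\<close>
  see.\<close>

lemma exp_type_primitive:
  fixes F :: "complex \<Rightarrow> complex"
  assumes holo: "F holomorphic_on UNIV" and ty: "exp_type_at_most \<tau> F" and \<tau>: "0 \<le> \<tau>"
    and int: "integrable lborel (\<lambda>x. F (of_real x))"
  obtains E B lp lm where "\<And>z. (E has_field_derivative F z) (at z)" "0 < B"
    "\<And>z. norm (E z) \<le> B * exp (\<tau> * \<bar>Im z\<bar>)"
    "((\<lambda>x. E (of_real x)) \<longlongrightarrow> lp) at_top" "((\<lambda>x. E (of_real x)) \<longlongrightarrow> lm) at_bot"
    "lp - lm = (\<integral>x. F (of_real x) \<partial>lborel)"
proof -
  obtain E where "\<And>z. z \<in> UNIV \<Longrightarrow> (E has_field_derivative F z) (at z)"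
    by (rule holomorphic_convex_primitive'[OF convex_UNIV open_UNIV holo]) (rule that)
  hence E: "(E has_field_derivative F z) (at z)" for z by blast
  have tyE: "exp_type_at_most \<tau> E" unfolding exp_type_at_most_def
  proof (intro allI impI)
    fix \<epsilon> :: real assume \<epsilon>: "0 < \<epsilon>"
    then obtain C where C: "\<And>z. norm (F z) \<le> C * exp ((\<tau> + \<epsilon>/2) * norm z)"
      using ty unfolding exp_type_at_most_def by (meson half_gt_zero)
    have C0: "0 \<le> C" using C[of 0] order.trans[OF norm_ge_zero] by fastforce
    \<comment> \<open>Integrating \<open>F\<close> along a segment costs a factor
      \<open>norm z\<close>; half of \<epsilon> has been kept back to absorb it.\<close>
    have "norm (E z) \<le> (norm (E 0) + C * (2/\<epsilon>)) * exp ((\<tau> + \<epsilon>) * norm z)" for z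
    proof -
      have "norm (E z - E 0) \<le> (C * exp ((\<tau> + \<epsilon>/2) * norm z)) * norm (z - 0)"
      proof (rule field_differentiable_bound[of "cball 0 (norm z)"])
        fix w :: complex assume "w \<in> cball 0 (norm z)"
        hence "norm w \<le> norm z" by simp
        hence "C * exp ((\<tau> + \<epsilon>/2) * norm w) \<le> C * exp ((\<tau> + \<epsilon>/2) * norm z)"
          using C0 \<tau> \<epsilon> by (intro mult_left_mono) auto
        with C[of w] show "norm (F w) \<le> C * exp ((\<tau> + \<epsilon>/2) * norm z)" by simp
      qed (auto intro: E[THEN has_field_derivative_at_within])
      also have "\<dots> = C * (2/\<epsilon>) * exp ((\<tau> + \<epsilon>/2) * norm z) * (\<epsilon>/2 * norm z)" using \<epsilon> by simp
      also have "\<dots> \<le> C * (2/\<epsilon>) * exp ((\<tau> + \<epsilon>/2) * norm z) * exp (\<epsilon>/2 * norm z)"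
      proof (intro mult_left_mono)
        show "\<epsilon>/2 * norm z \<le> exp (\<epsilon>/2 * norm z)"
          using exp_ge_add_one_self[of "\<epsilon>/2 * norm z"] by linarith
      qed (use C0 \<epsilon> in auto)
      also have "\<dots> = C * (2/\<epsilon>) * exp ((\<tau> + \<epsilon>) * norm z)"
        by (simp add: mult.assoc algebra_simps flip: exp_add)
      finally have "norm (E z) \<le> norm (E 0) + C * (2/\<epsilon>) * exp ((\<tau> + \<epsilon>) * norm z)"
        using norm_triangle_ineq2[of "E z" "E 0"] by linarith
      also have "\<dots> \<le> norm (E 0) * exp ((\<tau> + \<epsilon>) * norm z) + C * (2/\<epsilon>) * exp ((\<tau> + \<epsilon>) * norm z)"
        using \<tau> \<epsilon> by (intro add_right_mono) (simp add: mult_le_cancel_left1)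
      finally show ?thesis by (simp add: algebra_simps)
    qed
    thus "\<exists>C. \<forall>z. norm (E z) \<le> C * exp ((\<tau> + \<epsilon>) * norm z)" by blast
  qed
  have contF: "continuous_on A (\<lambda>x. F (of_real x))" for A
    by (intro continuous_on_compose2[OF holomorphic_on_imp_continuous_on[OF holo]] continuous_intros) auto
  have FTC: "(\<integral>x. indicator {a..b} x *\<^sub>R F (of_real x) \<partial>lborel) = E (of_real b) - E (of_real a)"
    if "a \<le> b" for a b :: real
    by (rule integral_FTC_Icc[where F = "\<lambda>x. E (of_real x)" and f = "\<lambda>x. F (of_real x)", OF that]) (rule has_vector_derivative_real_field[OF E], rule contF)
  define I where "I = (\<integral>x. norm (F (of_real x)) \<partial>lborel)"
  have intn: "integrable lborel (\<lambda>x. norm (F (of_real x)))" using int by (rule integrable_norm)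
  have FTCn: "norm (E (of_real b) - E (of_real a)) \<le> I" if "a \<le> b" for a b :: real
    unfolding FTC[OF that, symmetric] I_def
  proof (rule order.trans[OF integral_norm_bound integral_mono])
    show "integrable lborel (\<lambda>x. norm (indicator {a..b} x *\<^sub>R F (of_real x)))"
      by (intro integrable_norm integrable_mult_indicator int) simp
    show "norm (indicator {a..b} x *\<^sub>R F (of_real x)) \<le> norm (F (of_real x))" for x
      by (simp split: split_indicator)
  qed (rule intn)
  define B where "B = norm (E 0) + I + 1"
  have I0: "0 \<le> I" unfolding I_def by simp
  have B: "0 < B" using I0 by (simp add: B_def add_nonneg_pos)
  have bx: "norm (E (of_real x)) \<le> B" for x
    using FTCn[of 0 x] FTCn[of x 0] norm_triangle_ineq2[of "E x" "E 0"] norm_minus_commute[of "E x" "E 0"]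
    by (cases "0 \<le> x") (auto simp: B_def)
  have bE: "norm (E z) \<le> B * exp (\<tau> * \<bar>Im z\<bar>)" for z
    by (rule exp_type_bounded_on_reals[OF _ tyE B bx])
      (use E in \<open>blast intro: holomorphic_onI[unfolded field_differentiable_def] has_field_derivative_at_within\<close>)
  define lp where "lp = E 0 + (\<integral>x. indicator {0..} x *\<^sub>R F (of_real x) \<partial>lborel)"
  define lm where "lm = E 0 - (\<integral>x. indicator {..0} x *\<^sub>R F (of_real x) \<partial>lborel)"
  have [measurable]: "(\<lambda>x. F (of_real x)) \<in> borel_measurable lborel" using int by simp
  have "((\<lambda>b. \<integral>x. indicator {0..b} x *\<^sub>R F (of_real x) \<partial>lborel) \<longlongrightarrow> (\<integral>x. indicator {0..} x *\<^sub>R F (of_real x) \<partial>lborel)) at_top"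
  proof (rule integral_dominated_convergence_at_top[where w = "\<lambda>x. norm (F (of_real x))"])
    show "AE x in lborel. ((\<lambda>b. indicator {0..b} x *\<^sub>R F (of_real x)) \<longlongrightarrow> indicator {0..} x *\<^sub>R F (of_real x)) at_top"
    proof (intro AE_I2 tendsto_eventually)
      fix x :: real
      show "\<forall>\<^sub>F b in at_top. indicator {0..b} x *\<^sub>R F (of_real x) = indicator {0..} x *\<^sub>R F (of_real x)"
        using eventually_ge_at_top[of x] by eventually_elim (auto split: split_indicator)
    qed
  qed (auto intro!: intn split: split_indicator)
  hence "((\<lambda>b. E 0 + (\<integral>x. indicator {0..b} x *\<^sub>R F (of_real x) \<partial>lborel)) \<longlongrightarrow> lp) at_top"
    unfolding lp_def by (intro tendsto_intros)
  hence lp: "((\<lambda>b. E (of_real b)) \<longlongrightarrow> lp) at_top"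
    by (rule Lim_transform_eventually)
      (use eventually_ge_at_top[of 0] in eventually_elim, auto simp: FTC)
  have "((\<lambda>b. \<integral>x. indicator {-b..0} x *\<^sub>R F (of_real x) \<partial>lborel) \<longlongrightarrow> (\<integral>x. indicator {..0} x *\<^sub>R F (of_real x) \<partial>lborel)) at_top"
  proof (rule integral_dominated_convergence_at_top[where w = "\<lambda>x. norm (F (of_real x))"])
    show "AE x in lborel. ((\<lambda>b. indicator {-b..0} x *\<^sub>R F (of_real x)) \<longlongrightarrow> indicator {..0} x *\<^sub>R F (of_real x)) at_top"
    proof (intro AE_I2 tendsto_eventually)
      fix x :: real
      show "\<forall>\<^sub>F b in at_top. indicator {-b..0} x *\<^sub>R F (of_real x) = indicator {..0} x *\<^sub>R F (of_real x)"
        using eventually_ge_at_top[of "-x"] by eventually_elim (auto split: split_indicator)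
    qed
  qed (auto intro!: intn split: split_indicator)
  hence "((\<lambda>b. E 0 - (\<integral>x. indicator {-b..0} x *\<^sub>R F (of_real x) \<partial>lborel)) \<longlongrightarrow> lm) at_top"
    unfolding lm_def by (intro tendsto_intros)
  hence "((\<lambda>b. E (of_real (-b))) \<longlongrightarrow> lm) at_top"
    by (rule Lim_transform_eventually)
      (use eventually_ge_at_top[of 0] in eventually_elim, auto simp: FTC)
  hence lm: "((\<lambda>b. E (of_real b)) \<longlongrightarrow> lm) at_bot"
    by (simp add: filterlim_at_bot_mirror)
  have "lp - lm = (\<integral>x. indicator {0..} x *\<^sub>R F (of_real x) \<partial>lborel) + (\<integral>x. indicator {..0} x *\<^sub>R F (of_real x) \<partial>lborel)"
    by (simp add: lp_def lm_def)
  also have "\<dots> = (\<integral>x. indicator {0..} x *\<^sub>R F (of_real x) + indicator {..0} x *\<^sub>R F (of_real x) \<partial>lborel)"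
    by (intro Bochner_Integration.integral_add[symmetric] integrable_mult_indicator int) auto
  also have "\<dots> = (\<integral>x. F (of_real x) \<partial>lborel)"
  proof (intro integral_cong_AE)
    show "AE x in lborel. indicator {0..} x *\<^sub>R F (of_real x) + indicator {..0} x *\<^sub>R F (of_real x) = F (of_real x)"
      using AE_lborel_singleton[of "0::real"] by eventually_elim (auto split: split_indicator)
  qed simp_all
  finally show ?thesis using that[OF E B bE lp lm] by blast
qed

section \<open>The normalized sine and division by the squared cosine\<close>

text \<open>Filling the removable singularity by hand lets the quotients of
  \<open>(cos (pi * z))\<^sup>2\<close> by its double zeros be written as explicit entire
  functions.\<close>

definition csinc :: "complex \<Rightarrow> complex" where
  "csinc u = (if u = 0 then 1 else sin (of_real pi * u) / (of_real pi * u))"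

lemma csinc_0 [simp]: "csinc 0 = 1" by (simp add: csinc_def)

lemma csinc_minus [simp]: "csinc (-u) = csinc u" by (simp add: csinc_def)

lemma holomorphic_csinc: "csinc holomorphic_on UNIV"
proof -
  have "(\<lambda>z. if z = 0 then deriv (\<lambda>z. sin (of_real pi * z)) 0
           else (sin (of_real pi * z) - sin (of_real pi * 0)) / (z - 0)) holomorphic_on UNIV"
    by (rule pole_lemma) (auto intro!: holomorphic_intros)
  moreover have "deriv (\<lambda>z. sin (of_real pi * z)) 0 = (of_real pi :: complex)"
    by (rule DERIV_imp_deriv) (auto intro!: derivative_eq_intros)
  ultimately have "(\<lambda>u. (if u = 0 then of_real pi else sin (of_real pi * u) / u) / of_real pi) holomorphic_on UNIV"
    by (intro holomorphic_intros) (simp_all cong: if_cong)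
  moreover have "csinc = (\<lambda>u. (if u = 0 then of_real pi else sin (of_real pi * u) / u) / of_real pi)"
    by (auto simp: csinc_def fun_eq_iff)
  ultimately show ?thesis by simp
qed

lemma continuous_csinc [continuous_intros]: "continuous_on A f \<Longrightarrow> continuous_on A (\<lambda>x. csinc (f x))"
  by (rule continuous_on_compose2[OF holomorphic_on_imp_continuous_on[OF holomorphic_csinc]]) auto

lemma tendsto_csinc [tendsto_intros]: "(f \<longlongrightarrow> l) G \<Longrightarrow> ((\<lambda>x. csinc (f x)) \<longlongrightarrow> csinc l) G"
  by (rule continuous_on_tendsto_compose[OF holomorphic_on_imp_continuous_on[OF holomorphic_csinc]]) auto

text \<open>An even function has derivative 0 at 0. This is why the residues in
  \<open>quadrature\<close> are values of \<open>F\<close> alone.\<close>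

lemma deriv_csinc_0: "(csinc has_field_derivative 0) (at 0)"
proof -
  obtain d where d: "(csinc has_field_derivative d) (at 0)"
    using holomorphic_csinc by (auto simp: holomorphic_on_def field_differentiable_def)
  have "((\<lambda>u. csinc (-u)) has_field_derivative d * (-1)) (at 0)"
    by (rule DERIV_chain2[of csinc]) (use d in \<open>auto intro!: derivative_eq_intros\<close>)
  hence "((csinc) has_field_derivative d * (-1)) (at 0)" by simp
  from DERIV_unique[OF this d] have "d = 0" by simp
  thus ?thesis using d by simp
qed

lemma cos_half_integer_shift:
  "(cos (of_real pi * z))\<^sup>2 = (sin (of_real pi * (z - (of_int k + 1/2))))\<^sup>2" for z :: complex
proof -
  define a :: complex where "a = of_real pi * (of_int k + 1/2)"
  have a: "a = of_int k * of_real pi + of_real pi / 2" by (simp add: a_def algebra_simps)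
  have "cos a = 0"
    unfolding cos_eq_0 a by (intro exI[of _ k]) simp
  hence s: "(sin a)\<^sup>2 = 1" using sin_cos_squared_add[of a] by simp
  have "sin (of_real pi * (z - (of_int k + 1/2))) = - cos (of_real pi * z) * sin a"
    using \<open>cos a = 0\<close> unfolding right_diff_distrib a_def[symmetric] sin_diff by simp
  thus ?thesis by (simp add: power_mult_distrib s)
qed

lemma cos_sq_eq_csinc:
  "(cos (of_real pi * z))\<^sup>2 = (of_real pi)\<^sup>2 * (z - (of_int k + 1/2))\<^sup>2 * (csinc (z - (of_int k + 1/2)))\<^sup>2"
  unfolding cos_half_integer_shift[of z k] csinc_def by (auto simp: power_mult_distrib power_divide)

lemma cos_pi_eq_0_iff: "cos (of_real pi * z) = 0 \<longleftrightarrow> (\<exists>k::int. z = of_int k + 1/2)" for z :: complex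
proof -
  have "cos (of_real pi * z) = 0 \<longleftrightarrow> (\<exists>n::int. of_real pi * z = of_real (of_int n * pi) + of_real pi / 2)"
    by (simp add: cos_eq_0)
  also have "\<dots> \<longleftrightarrow> (\<exists>n::int. of_real pi * z = of_real pi * (of_int n + 1/2))"
    by (simp add: algebra_simps)
  finally show ?thesis by simp
qed

text \<open>The squared modulus of the cosine is at least \<open>(sinh (pi * Im z))\<^sup>2\<close>,
  and \<open>pi * \<bar>Im z\<bar> \<ge> 1\<close> makes the smaller exponential harmless.\<close>

lemma norm_cos_pi_ge: "exp (pi * \<bar>Im z\<bar>) / 4 \<le> norm (cos (of_real pi * z))" if "1/2 \<le> \<bar>Im z\<bar>" for z :: complex
proof -
  define y where "y = pi * \<bar>Im z\<bar>"
  have y: "1 \<le> y"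
    using that pi_gt3 mult_mono[of 2 pi "1/2" "\<bar>Im z\<bar>"] by (simp add: y_def)
  have "(exp y - exp (-y))\<^sup>2 / 4 = (exp (pi * Im z) - inverse (exp (pi * Im z)))\<^sup>2 / 4"
    by (cases "0 \<le> Im z") (simp_all add: y_def exp_minus power2_commute)
  also have "\<dots> \<le> (norm (cos (of_real pi * z)))\<^sup>2"
    by (simp add: norm_cos_squared)
  finally have "((exp y - exp (-y)) / 2)\<^sup>2 \<le> (norm (cos (of_real pi * z)))\<^sup>2"
    by (simp add: power_divide)
  hence "(exp y - exp (-y)) / 2 \<le> norm (cos (of_real pi * z))"
    by (rule power2_le_imp_le) simp
  moreover have "2 \<le> exp y" using exp_ge_add_one_self[of y] y by linarith
  moreover have "exp (-y) \<le> 1" using y by simp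
  moreover have "a / 4 \<le> c" if "(a - b) / 2 \<le> c" "2 \<le> a" "b \<le> 1" for a b c :: real
    using that by (simp add: field_simps)
  ultimately show ?thesis unfolding y_def[symmetric] by blast
qed

text \<open>The quotient by the squared cosine is entire. It is bounded for
  \<open>\<bar>Im z\<bar> \<ge> 1/2\<close> by \<open>norm_cos_pi_ge\<close>, and near the real axis
  on the vertical lines through the integers, where the cosine has modulus at least 1. The maximum
  principle fills the boxes in between, and Liouville's theorem finishes.\<close>

lemma exp_type_double_zeros:
  fixes D :: "complex \<Rightarrow> complex"
  assumes holo: "D holomorphic_on UNIV" and B: "0 < B"
    and bd: "\<And>z. norm (D z) \<le> B * exp (2 * pi * \<bar>Im z\<bar>)"
    and z0: "\<And>k::int. D (of_int k + 1/2) = 0"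
    and z1: "\<And>k::int. deriv D (of_int k + 1/2) = 0"
  obtains C where "\<And>z. D z = C * (cos (of_real pi * z))\<^sup>2"
proof -
  define f where "f = (\<lambda>z. D z / (cos (of_real pi * z))\<^sup>2)"
  define Q where "Q = remove_sings f"
  have ana: "f analytic_on {z}" if "cos (of_real pi * z) \<noteq> 0" for z
    unfolding f_def
    by (intro analytic_intros analytic_on_subset[OF holo[folded analytic_on_open[OF open_UNIV]]])
      (use that in auto)
  have anaQ: "Q analytic_on {z}" for z
  proof (cases "cos (of_real pi * z) = 0")
    case True
    then obtain k :: int where k: "z = of_int k + 1/2" unfolding cos_pi_eq_0_iff by blast
    define U where "U = ball z 1"
    have nz: "cos (of_real pi * w) \<noteq> 0" if "w \<in> U - {z}" for w
    proof
      assume "cos (of_real pi * w) = 0"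
      then obtain j :: int where j: "w = of_int j + 1/2" unfolding cos_pi_eq_0_iff by blast
      have "norm (of_int (k - j) :: complex) < 1" using that j k by (simp add: U_def dist_norm)
      hence "k = j" by (simp only: norm_of_int)
      thus False using that j k by simp
    qed
    have holf: "f holomorphic_on U - {z}" unfolding f_def
      by (intro holomorphic_intros holomorphic_on_subset[OF holo]) (use nz in auto)
    \<comment> \<open>Riemann's criterion: one power of \<open>w - z\<close> in the denominator is
      cancelled by the extra factor, the other turns \<open>D\<close> into its difference quotient,
      which tends to \<open>deriv D z = 0\<close>.\<close>
    have "((\<lambda>w. (w - z) * f w) \<longlongrightarrow> 0) (at z)"
    proof -
      have "((\<lambda>w. (D w - D z) / (w - z)) \<longlongrightarrow> 0) (at z)"
        using holomorphic_derivI[OF holo open_UNIV, of z] z1[of k]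
        by (simp add: has_field_derivative_iff k)
      moreover have "((\<lambda>w. (csinc (w - z))\<^sup>2) \<longlongrightarrow> (csinc (z - z))\<^sup>2) (at z)"
        by (intro tendsto_intros)
      ultimately have "((\<lambda>w. ((D w - D z) / (w - z)) / ((of_real pi)\<^sup>2 * (csinc (w - z))\<^sup>2)) \<longlongrightarrow> 0 / ((of_real pi)\<^sup>2 * (csinc (z - z))\<^sup>2)) (at z)"
        by (intro tendsto_intros) auto
      moreover have "\<forall>\<^sub>F w in at z. ((D w - D z) / (w - z)) / ((of_real pi)\<^sup>2 * (csinc (w - z))\<^sup>2) = (w - z) * f w"
        using eventually_neq_at_within[of z z UNIV]
      proof eventually_elim
        case (elim w)
        have "D z = 0" using z0 k by simp
        thus ?case using elim unfolding f_def cos_sq_eq_csinc[of w k] k[symmetric]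
          by (simp add: power2_eq_square)
      qed
      ultimately have "((\<lambda>w. (w - z) * f w) \<longlongrightarrow> 0 / ((of_real pi)\<^sup>2 * (csinc (z - z))\<^sup>2)) (at z)"
        by (rule Lim_transform_eventually)
      thus ?thesis by simp
    qed
    then obtain g where g: "g holomorphic_on U" "\<And>w. w \<in> U - {z} \<Longrightarrow> g w = f w"
      using holomorphic_on_extend_lim[OF holf, of ] by (auto simp: U_def)
    have "f \<midarrow>z\<rightarrow> g z"
    proof (rule Lim_transform_eventually)
      show "g \<midarrow>z\<rightarrow> g z" using g(1) holomorphic_on_imp_continuous_on[of g U]
        by (auto simp: U_def continuous_on_eq_continuous_at isCont_def)
      show "\<forall>\<^sub>F w in at z. g w = f w"
        using eventually_at_in_open[of U z] g(2) by (auto simp: U_def elim!: eventually_mono)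
    qed
    moreover have "isolated_singularity_at f z"
      unfolding isolated_singularity_at_def using holf by (intro exI[of _ 1]) (auto simp: U_def analytic_on_open open_delete)
    ultimately show ?thesis unfolding Q_def by (intro remove_sings_analytic_at)
  next
    case False
    show ?thesis unfolding Q_def using ana[OF False] by (rule remove_sings_analytic_on)
  qed
  have holQ: "Q holomorphic_on UNIV"
    using anaQ by (meson analytic_imp_holomorphic analytic_on_analytic_at UNIV_I)
  have Qf: "Q z = f z" if "cos (of_real pi * z) \<noteq> 0" for z
    unfolding Q_def using ana[OF that] by simp
  have DQ: "D z = Q z * (cos (of_real pi * z))\<^sup>2" for z
  proof (cases "cos (of_real pi * z) = 0")
    case True
    then obtain k :: int where "z = of_int k + 1/2" unfolding cos_pi_eq_0_iff by blast
    hence "D z = 0" using z0 by simp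
    thus ?thesis using True by simp
  qed (simp add: Qf f_def)
  have Qb: "norm (Q z) * (norm (cos (of_real pi * z)))\<^sup>2 \<le> B * exp (2 * pi * \<bar>Im z\<bar>)" for z
    using bd[of z] unfolding DQ[of z] by (simp add: norm_mult norm_power)
  define M where "M = 16 * B + B * exp (2 * pi)"
  have M: "16 * B \<le> M" "B * exp (2 * pi) \<le> M" using B by (simp_all add: M_def)
  have M1: "norm (Q z) \<le> M" if "1/2 \<le> \<bar>Im z\<bar>" for z
  proof -
    have "norm (Q z) * (exp (pi * \<bar>Im z\<bar>) / 4)\<^sup>2 \<le> norm (Q z) * (norm (cos (of_real pi * z)))\<^sup>2"
      using norm_cos_pi_ge[OF that] by (intro mult_left_mono power_mono) auto
    also note Qb[of z]
    also have "(exp (pi * \<bar>Im z\<bar>) / 4)\<^sup>2 = exp (2 * pi * \<bar>Im z\<bar>) / 16"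
      by (simp add: power_divide flip: exp_double)
    finally have "norm (Q z) \<le> 16 * B" by (simp add: field_simps)
    thus ?thesis using M by linarith
  qed
  have M2: "norm (Q z) \<le> M" if "Re z = of_int n" "\<bar>Im z\<bar> \<le> 1" for z n
  proof -
    have "(cos (pi * of_int n))\<^sup>2 = 1" by (simp add: cos_squared_eq)
    hence "1 \<le> (norm (cos (of_real pi * z)))\<^sup>2"
      by (simp add: norm_cos_squared that)
    hence "norm (Q z) * 1 \<le> norm (Q z) * (norm (cos (of_real pi * z)))\<^sup>2"
      by (intro mult_left_mono) auto
    also note Qb[of z]
    also have "B * exp (2 * pi * \<bar>Im z\<bar>) \<le> B * exp (2 * pi)" using that B by (intro mult_left_mono) auto
    finally show ?thesis using M by linarith
  qed
  have "norm (Q z) \<le> M" for z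
  proof (cases "1/2 \<le> \<bar>Im z\<bar>")
    case False
    define n where "n = \<lfloor>Re z\<rfloor>"
    \<comment> \<open>Two units wide, so that \<open>z\<close> is an interior point even if its real
      part is the integer \<open>n\<close>.\<close>
    define S where "S = box (Complex (of_int n - 1) (-1)) (Complex (of_int n + 1) 1)"
    show ?thesis
    proof (rule maximum_modulus_frontier[of Q S])
      show "z \<in> S" using False unfolding S_def n_def in_box_complex_iff by (auto; linarith)
      show "Q holomorphic_on interior S" "continuous_on (closure S) Q"
        using holomorphic_on_subset[OF holQ] by (auto intro!: holomorphic_on_imp_continuous_on)
      show "bounded S" unfolding S_def by (rule bounded_box)
      fix w assume "w \<in> frontier S"
      moreover have "S \<noteq> {}" using \<open>z \<in> S\<close> by auto
      ultimately have "w \<in> cbox (Complex (of_int n - 1) (-1)) (Complex (of_int n + 1) 1)" "w \<notin> S"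
        using interior_open[OF open_box] by (auto simp: S_def frontier_def closure_box)
      hence "(Re w = of_int (n - 1) \<or> Re w = of_int (n + 1) \<or> Im w = -1 \<or> Im w = 1) \<and> \<bar>Im w\<bar> \<le> 1"
        unfolding S_def in_box_complex_iff in_cbox_complex_iff by auto
      thus "norm (Q w) \<le> M" using M1[of w] M2[of w "n - 1"] M2[of w "n + 1"] by auto
    qed
  qed (use M1 in auto)
  hence "bounded (range Q)" by (auto simp: bounded_iff)
  then obtain C where "\<And>z. Q z = C"
    using Liouville_theorem[OF holQ] by (auto simp: constant_on_def)
  thus ?thesis using that DQ by metis
qed

section \<open>A quadrature formula at the dilated half-integers\<close>

lemma one_over_cosh_sq_integral:
  "integrable lborel (\<lambda>y. 1 / (cosh (pi * y))\<^sup>2)"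
  "(\<integral>y. 1 / (cosh (pi * y))\<^sup>2 \<partial>lborel) = 2 / pi"
proof -
  have ch: "cosh (x::real) \<noteq> 0" for x using cosh_real_pos[of x] by simp
  have lim1: "((\<lambda>y. tanh (pi * y) / pi) \<longlongrightarrow> 1 / pi) at_top"
    by (intro tendsto_divide tendsto_const filterlim_compose[OF tanh_real_at_top]
          filterlim_tendsto_pos_mult_at_top[OF tendsto_const _ filterlim_ident]) auto
  have lim2: "((\<lambda>y. tanh (pi * y) / pi) \<longlongrightarrow> -1 / pi) at_bot"
    by (intro tendsto_divide tendsto_const filterlim_compose[OF tanh_real_at_bot]
          filterlim_tendsto_pos_mult_at_bot[OF tendsto_const _ filterlim_ident]) auto
  have der: "((\<lambda>y. tanh (pi * y) / pi) has_real_derivative 1 / (cosh (pi * y))\<^sup>2) (at y)" for y :: real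
  proof -
    have "1 - (tanh (pi * y))\<^sup>2 = 1 / (cosh (pi * y))\<^sup>2"
      using ch[of "pi * y"] by (simp add: tanh_def power_divide diff_divide_eq_iff) (simp add: cosh_square_eq)
    thus ?thesis by (auto intro!: derivative_eq_intros simp: ch)
  qed
  have cont: "isCont (\<lambda>y. 1 / (cosh (pi * y))\<^sup>2) y" for y :: real
    by (intro continuous_intros) (simp add: ch)
  note * = interval_integral_FTC_nonneg[of "-\<infinity>" "\<infinity>" "\<lambda>y. tanh (pi * y) / pi" "\<lambda>y. 1 / (cosh (pi * y))\<^sup>2",
      OF _ der cont _ lim2[folded ereal_tendsto_simps1] lim1[folded ereal_tendsto_simps1]]
  have 1: "set_integrable lborel (einterval (-\<infinity>) \<infinity>) (\<lambda>y. 1 / (cosh (pi * y))\<^sup>2)"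
    by (rule *(1)) auto
  have 2: "(LBINT y=-\<infinity>..\<infinity>. 1 / (cosh (pi * y))\<^sup>2) = 1 / pi - (-1 / pi)"
    by (rule *(2)) auto
  show "integrable lborel (\<lambda>y. 1 / (cosh (pi * y))\<^sup>2)"
    using 1 by (simp add: set_integrable_def)
  show "(\<integral>y. 1 / (cosh (pi * y))\<^sup>2 \<partial>lborel) = 2 / pi"
    using 2 by (simp add: interval_lebesgue_integral_def set_lebesgue_integral_def)
qed

lemma one_over_cosh_sq_le: "1 / (cosh (pi * y))\<^sup>2 \<le> 4 * exp (- 2 * pi * \<bar>y\<bar>)"
proof -
  have "exp \<bar>pi * y\<bar> / 2 \<le> cosh (pi * y)"
    by (cases "0 \<le> pi * y") (simp_all add: cosh_def)
  hence "(exp \<bar>pi * y\<bar> / 2)\<^sup>2 \<le> (cosh (pi * y))\<^sup>2" by (intro power_mono) auto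
  hence "1 / (cosh (pi * y))\<^sup>2 \<le> 1 / (exp \<bar>pi * y\<bar> / 2)\<^sup>2" by (intro divide_left_mono) auto
  also have "\<dots> = 4 * exp (- 2 * pi * \<bar>y\<bar>)"
    by (simp add: power_divide exp_minus field_simps abs_mult flip: exp_double)
  finally show ?thesis .
qed

lemma integral_FTC_atLeast_nonneg:
  fixes f F :: "real \<Rightarrow> real"
  assumes "f \<in> borel_measurable borel" "\<And>x. a \<le> x \<Longrightarrow> DERIV F x :> f x"
    "\<And>x. a \<le> x \<Longrightarrow> 0 \<le> f x" "(F \<longlongrightarrow> T) at_top"
  shows "has_bochner_integral lborel (\<lambda>x. indicator {a..} x *\<^sub>R f x) (T - F a)"
proof (rule has_bochner_integral_nn_integral)
  have F_mono: "F a \<le> F y" if "a \<le> y" for y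
    using assms that by (intro DERIV_nonneg_imp_nondecreasing[of a y F]) (auto intro: order_trans)
  show "0 \<le> T - F a"
    using tendsto_lowerbound[OF assms(4), of "F a"] F_mono
    by (auto simp: eventually_at_top_linorder)
  have "(\<integral>\<^sup>+ x. ennreal (indicator {a..} x *\<^sub>R f x) \<partial>lborel) = (\<integral>\<^sup>+x. ennreal (f x) * indicator {a ..} x \<partial>lborel)"
    by (intro nn_integral_cong) (auto split: split_indicator)
  also have "\<dots> = T - F a" by (rule nn_integral_FTC_atLeast) (use assms in auto)
  finally show "(\<integral>\<^sup>+ x. ennreal (indicator {a..} x *\<^sub>R f x) \<partial>lborel) = ennreal (T - F a)" .
qed (use assms in \<open>auto split: split_indicator\<close>)

lemma has_bochner_integral_exp_neg:
  "has_bochner_integral lborel (\<lambda>x::real. indicator {0..} x *\<^sub>R exp (- a * x)) (1 / a)" if "0 < a"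
proof -
  have "has_bochner_integral lborel (\<lambda>x::real. indicator {0..} x *\<^sub>R exp (- a * x)) (0 - (- exp (- a * 0) / a))"
  proof (rule integral_FTC_atLeast_nonneg)
    show "((\<lambda>y. - exp (- a * y) / a) \<longlongrightarrow> 0) at_top" using that by real_asymp
  qed (use that in \<open>auto intro!: derivative_eq_intros\<close>)
  thus ?thesis by simp
qed

lemma has_bochner_integral_exp_neg_abs:
  "has_bochner_integral lborel (\<lambda>x::real. exp (- a * \<bar>x\<bar>)) (2 / a)" if "0 < a"
proof -
  have "has_bochner_integral lborel (\<lambda>x::real. indicator {0..} x *\<^sub>R exp (- a * \<bar>x\<bar>)) (1 / a)"
    using has_bochner_integral_exp_neg[OF that]
    by (rule has_bochner_integral_cong[THEN iffD1, rotated -1]) (auto split: split_indicator)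
  from has_bochner_integral_even_function[OF this] show ?thesis by simp
qed

text \<open>The sum consists of the residues of \<open>E (c * z) * (pi / cos (pi * z))\<^sup>2\<close> for a primitive \<open>E\<close> of
  \<open>F\<close>. The dilation by \<open>c < 1\<close> makes the horizontal sides of the contour negligible; the vertical
  ones give the limits of \<open>E\<close> at infinity.\<close>

lemma quadrature:
  fixes F :: "complex \<Rightarrow> complex"
  assumes holo: "F holomorphic_on UNIV" and ty: "exp_type_at_most (2 * pi) F"
    and int: "integrable lborel (\<lambda>x. F (of_real x))" and c: "0 < c" "c < 1"
  shows "(\<lambda>N. \<Sum>k\<in>{- int N..<int N}. of_real c * F (of_real (c * (of_int k + 1/2))))
           \<longlonglongrightarrow> (\<integral>x. F (of_real x) \<partial>lborel)"
proof -
  obtain E B lp lm where E: "\<And>z. (E has_field_derivative F z) (at z)" and B: "0 < B"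
    and bE: "\<And>z. norm (E z) \<le> B * exp (2 * pi * \<bar>Im z\<bar>)"
    and lp: "((\<lambda>x. E (of_real x)) \<longlongrightarrow> lp) at_top" and lm: "((\<lambda>x. E (of_real x)) \<longlongrightarrow> lm) at_bot"
    and lpm: "lp - lm = (\<integral>x. F (of_real x) \<partial>lborel)"
    by (rule exp_type_primitive[OF holo ty _ int]) (simp, rule that)
  have holE: "E holomorphic_on A" for A
    using E by (meson holomorphic_onI field_differentiable_def has_field_derivative_at_within)
  define f where "f = (\<lambda>z. E (of_real c * z) * (of_real pi / cos (of_real pi * z))\<^sup>2)"
  have holf: "f holomorphic_on A" if "\<And>z. z \<in> A \<Longrightarrow> cos (of_real pi * z) \<noteq> 0" for A
  proof -
    have "(\<lambda>z. E (of_real c * z)) holomorphic_on A"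
      by (rule holomorphic_on_compose_gen[OF _ holE[of UNIV], unfolded o_def]) (auto intro!: holomorphic_intros)
    thus ?thesis unfolding f_def by (intro holomorphic_intros that)
  qed
  \<comment> \<open>Near the node \<open>p\<close> the integrand is
    \<open>h w / (w - p)\<^sup>2\<close>, so the residue is the derivative of \<open>h\<close> at
    \<open>p\<close>. The factor \<open>csinc\<close> does not contribute to it, having value 1 and
    derivative 0.\<close>
  have res: "residue f (of_int k + 1/2) = of_real c * F (of_real (c * (of_int k + 1/2)))" for k :: int
  proof -
    define p :: complex where "p = of_int k + 1/2"
    define h where "h = (\<lambda>w. E (of_real c * w) / (csinc (w - p))\<^sup>2)"
    have feq: "f = (\<lambda>w. h w / (w - p) ^ Suc 1)"
      unfolding f_def h_def power_divide cos_sq_eq_csinc[of _ k] p_def[symmetric]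
      by (auto simp: fun_eq_iff power2_eq_square)
    have "residue f p = (deriv ^^ 1) h p / fact 1"
      unfolding feq
    proof (rule residue_holomorphic_over_power[of "{w. csinc (w - p) \<noteq> 0}"])
      show "open {w. csinc (w - p) \<noteq> 0}" by (intro open_Collect_neq continuous_intros)
      have "(\<lambda>z. E (of_real c * z)) holomorphic_on {w. csinc (w - p) \<noteq> 0}"
        by (rule holomorphic_on_compose_gen[OF _ holE[of UNIV], unfolded o_def]) (auto intro!: holomorphic_intros)
      moreover have "(\<lambda>z. csinc (z - p)) holomorphic_on {w. csinc (w - p) \<noteq> 0}"
        by (rule holomorphic_on_compose_gen[OF _ holomorphic_csinc, unfolded o_def]) (auto intro!: holomorphic_intros)
      ultimately show "h holomorphic_on {w. csinc (w - p) \<noteq> 0}"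
        unfolding h_def by (intro holomorphic_intros) auto
    qed auto
    also have "(deriv ^^ 1) h p = of_real c * F (of_real c * p)"
    proof -
      have 1: "((\<lambda>w. E (of_real c * w)) has_field_derivative F (of_real c * p) * of_real c) (at p)"
        by (rule DERIV_chain2[OF E]) (auto intro!: derivative_eq_intros)
      have 2: "((\<lambda>w. csinc (w - p)) has_field_derivative 0 * 1) (at p)"
        by (rule DERIV_chain2[of csinc]) (use deriv_csinc_0 in \<open>auto intro!: derivative_eq_intros\<close>)
      have "(h has_field_derivative of_real c * F (of_real c * p)) (at p)"
        unfolding h_def using 1 2 by (auto intro!: derivative_eq_intros simp: power2_eq_square)
      thus ?thesis by (simp add: DERIV_imp_deriv)
    qed
    finally show ?thesis by (simp add: p_def)
  qed
  define hor where "hor = (\<lambda>N::nat. contour_integral (linepath (Complex (- real N) (- real N)) (Complex (real N) (- real N))) f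
      + contour_integral (linepath (Complex (real N) (real N)) (Complex (- real N) (real N))) f)"
  \<comment> \<open>The vertical side through \<open>a * N\<close>, directed upwards, for
    \<open>a = 1\<close> or \<open>a = -1\<close>. The squared cosine has become a squared
    \<open>cosh\<close> because the side passes through an integer.\<close>
  define ver where "ver = (\<lambda>(a::real) (N::nat). \<integral>y. indicator {-real N..real N} y *\<^sub>R
      (E (of_real (c * (a * real N)) + \<i> * of_real (c * y)) * of_real (pi\<^sup>2 * (1 / (cosh (pi * y))\<^sup>2))) \<partial>lborel)"
  have contour: "2 * pi * \<i> * (\<Sum>k\<in>{- int N..<int N}. of_real c * F (of_real (c * (of_int k + 1/2))))
      = hor N + \<i> * (ver 1 N - ver (-1) N)" if N: "N \<ge> 1" for N :: nat
  proof -
    define n where "n = real N"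
    have n: "1 \<le> n" using N by (simp add: n_def)
    define pts where "pts = (\<lambda>k::int. of_int k + 1/2 :: complex) ` {- int N..<int N}"
    \<comment> \<open>Wide enough for the contour, and narrow enough to contain no node beyond those
      in \<open>pts\<close>: the next ones have real part
      \<open>\<plusminus>(n + 1/2)\<close>.\<close>
    define S where "S = {z::complex. -(n+1/2) < Re z \<and> Re z < n + 1/2}"
    define a1 a2 a3 a4 where "a1 = Complex (-n) (-n)" and "a2 = Complex n (-n)" and "a3 = Complex n n" and "a4 = Complex (-n) n"
    have box: "z \<in> cbox a1 a3 \<longleftrightarrow> \<bar>Re z\<bar> \<le> n \<and> \<bar>Im z\<bar> \<le> n" for z
      by (auto simp: a1_def a3_def in_cbox_complex_iff)
    have nz: "cos (of_real pi * z) \<noteq> 0" if z: "z \<in> S - pts" for z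
    proof
      assume "cos (of_real pi * z) = 0"
      then obtain k :: int where k: "z = of_int k + 1/2" unfolding cos_pi_eq_0_iff by blast
      have "-(n+1/2) < of_int k + 1/2" "of_int k + 1/2 < n + 1/2"
        using z k by (auto simp: S_def)
      hence "k \<in> {- int N..<int N}" unfolding n_def by auto
      thus False using z k by (auto simp: pts_def)
    qed
    have path: "path_image (rectpath a1 a3) \<subseteq> S - pts"
    proof
      fix z assume "z \<in> path_image (rectpath a1 a3)"
      hence z: "z \<in> cbox a1 a3" "\<bar>Re z\<bar> = n \<or> \<bar>Im z\<bar> = n"
        using n by (auto simp: path_image_rectpath a1_def a3_def in_cbox_complex_iff)
      have "z \<notin> pts"
      proof
        assume "z \<in> pts"
        then obtain k :: int where "z = of_int k + 1/2" by (auto simp: pts_def)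
        with z(2) n have "\<bar>of_int k + 1/2\<bar> = n" by auto
        hence "of_int (2 * k + 1) = (of_int (2 * int N) :: real) \<or> of_int (2 * k + 1) = (of_int (- 2 * int N) :: real)"
          unfolding n_def by auto
        hence "2 * k + 1 = 2 * int N \<or> 2 * k + 1 = - 2 * int N" by (metis of_int_eq_iff)
        thus False by presburger
      qed
      thus "z \<in> S - pts" using z(1) by (auto simp: box S_def)
    qed
    have seg: "closed_segment u v \<subseteq> S - pts"
      if "closed_segment u v \<subseteq> path_image (rectpath a1 a3)" for u v
      using that path by blast
    have pim: "path_image (rectpath a1 a3) = closed_segment a1 a2 \<union> closed_segment a2 a3 \<union> closed_segment a3 a4 \<union> closed_segment a4 a1"
      by (simp add: rectpath_def Let_def path_image_join Un_assoc a1_def a2_def a3_def a4_def)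
    have cont: "continuous_on (closed_segment u v) f"
      if "closed_segment u v \<subseteq> path_image (rectpath a1 a3)" for u v
      by (intro holomorphic_on_imp_continuous_on holf nz) (use seg[OF that] in blast)
    have ci: "f contour_integrable_on linepath u v"
      if "closed_segment u v \<subseteq> path_image (rectpath a1 a3)" for u v
      using cont[OF that] by (rule contour_integrable_continuous_linepath)
    have c12: "f contour_integrable_on linepath a1 a2" and c23: "f contour_integrable_on linepath a2 a3"
      and c34: "f contour_integrable_on linepath a3 a4" and c41: "f contour_integrable_on linepath a4 a1"
      by (intro ci; use pim in blast)+
    have "contour_integral (rectpath a1 a3) f = 2 * pi * \<i> * (\<Sum>p\<in>pts. winding_number (rectpath a1 a3) p * residue f p)"
    proof (rule Residue_theorem[of S])
      show "open S" unfolding S_def by (intro open_Collect_conj open_Collect_less continuous_intros)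
      have "convex S" unfolding S_def
        using convex_Int[OF convex_halfspace_Re_gt[of "-(n+1/2)"] convex_halfspace_Re_lt[of "n+1/2"]]
        by (simp add: Collect_conj_eq[symmetric])
      thus "connected S" by (rule convex_connected)
      show "finite pts" by (simp add: pts_def)
      show "f holomorphic_on S - pts" by (rule holf[OF nz])
      show "path_image (rectpath a1 a3) \<subseteq> S - pts" by (rule path)
      show "\<forall>z. z \<notin> S \<longrightarrow> winding_number (rectpath a1 a3) z = 0"
      proof (intro allI impI winding_number_rectpath_outside)
        fix z assume "z \<notin> S"
        thus "z \<notin> cbox a1 a3" unfolding box by (auto simp: S_def)
      qed (use n in \<open>auto simp: a1_def a3_def\<close>)
    qed auto
    also have "(\<Sum>p\<in>pts. winding_number (rectpath a1 a3) p * residue f p)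
        = (\<Sum>k\<in>{- int N..<int N}. winding_number (rectpath a1 a3) (of_int k + 1/2) * residue f (of_int k + 1/2))"
      unfolding pts_def by (subst sum.reindex) (auto simp: inj_on_def)
    also have "\<dots> = (\<Sum>k\<in>{- int N..<int N}. of_real c * F (of_real (c * (of_int k + 1/2))))"
    proof (intro sum.cong refl)
      fix k assume k: "k \<in> {- int N..<int N}"
      have "- n \<le> of_int k" "of_int (k + 1) \<le> n" using k unfolding n_def by auto
      hence "(of_int k + 1/2 :: complex) \<in> box a1 a3"
        using n by (auto simp: in_box_complex_iff a1_def a3_def)
      thus "winding_number (rectpath a1 a3) (of_int k + 1/2) * residue f (of_int k + 1/2) = of_real c * F (of_real (c * (of_int k + 1/2)))"
        by (simp add: winding_number_rectpath res)
    qed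
    also have "contour_integral (rectpath a1 a3) f = contour_integral (linepath a1 a2) f +
       (contour_integral (linepath a2 a3) f + (contour_integral (linepath a3 a4) f + contour_integral (linepath a4 a1) f))"
    proof -
      have "rectpath a1 a3 = linepath a1 a2 +++ linepath a2 a3 +++ linepath a3 a4 +++ linepath a4 a1"
        by (simp add: rectpath_def Let_def a1_def a2_def a3_def a4_def)
      thus ?thesis using c12 c23 c34 c41 by simp
    qed
    finally have total: "2 * pi * \<i> * (\<Sum>k\<in>{- int N..<int N}. of_real c * F (of_real (c * (of_int k + 1/2)))) =
       hor N + (contour_integral (linepath a2 a3) f + contour_integral (linepath a4 a1) f)"
      unfolding hor_def n_def[symmetric] a1_def[symmetric] a2_def[symmetric] a3_def[symmetric] a4_def[symmetric]
      by (metis (no_types) add.assoc add.left_commute)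
    have vert: "contour_integral (linepath (Complex (a * n) (-n)) (Complex (a * n) n)) f = \<i> * ver a N"
      if a: "a = 1 \<or> a = -1" for a :: real
    proof -
      have fv: "f (Complex (a * n) y) = E (of_real (c * (a * n)) + \<i> * of_real (c * y)) * of_real (pi\<^sup>2 * (1 / (cosh (pi * y))\<^sup>2))" for y
      proof -
        have Cx: "Complex (a * n) y = of_real (a * n) + \<i> * of_real y" by (simp add: Complex_eq)
        have s: "sin (pi * (a * n)) = 0" using a sin_npi2[of N] by (auto simp: n_def)
        hence c2: "(cos (pi * (a * n)))\<^sup>2 = 1" by (simp add: cos_squared_eq)
        have "cos (of_real pi * Complex (a * n) y) = of_real (cos (pi * (a * n))) * cosh (of_real (pi * y))"
        proof -
          have "of_real pi * Complex (a * n) y = of_real (pi * (a * n)) + \<i> * of_real (pi * y)"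
            by (simp add: Cx algebra_simps)
          thus ?thesis using s
            by (simp only: cos_add cosh_conv_cos[symmetric] cos_of_real sin_of_real s) simp
        qed
        hence "(cos (of_real pi * Complex (a * n) y))\<^sup>2 = of_real ((cos (pi * (a * n)))\<^sup>2) * of_real ((cosh (pi * y))\<^sup>2)"
        proof -
          have "cosh (of_real x) = (of_real (cosh x) :: complex)" for x
            by (simp add: cosh_field_def exp_minus exp_of_real)
          thus ?thesis using \<open>cos (of_real pi * _) = _\<close> by (simp only: power_mult_distrib of_real_power)
        qed
        hence "(cos (of_real pi * Complex (a * n) y))\<^sup>2 = of_real ((cosh (pi * y))\<^sup>2)" unfolding c2 by simp
        thus ?thesis unfolding f_def power_divide by (simp add: Cx algebra_simps)
      qed
      have "contour_integral (linepath (Complex (a * n) (-n)) (Complex (a * n) n)) f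
         = \<i> * integral {-n..n} (\<lambda>y. f (Complex (a * n) y))"
        by (rule contour_integral_linepath_same_Re) (use n in auto)
      also have "integral {-n..n} (\<lambda>y. f (Complex (a * n) y)) = ver a N"
      proof -
        have "continuous_on {-n..n} (\<lambda>y. E (of_real (c * (a * n)) + \<i> * of_real (c * y)) * of_real (pi\<^sup>2 * (1 / (cosh (pi * y))\<^sup>2)))"
          by (intro continuous_intros continuous_on_compose2[OF holomorphic_on_imp_continuous_on[OF holE[of UNIV]]])
             (auto simp: less_imp_neq[OF cosh_real_pos, symmetric])
        hence "set_integrable lborel {-n..n} (\<lambda>y. E (of_real (c * (a * n)) + \<i> * of_real (c * y)) * of_real (pi\<^sup>2 * (1 / (cosh (pi * y))\<^sup>2)))"
          unfolding set_integrable_def by (intro borel_integrable_compact) auto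
        from set_borel_integral_eq_integral(2)[OF this, symmetric] show ?thesis
          unfolding fv ver_def set_lebesgue_integral_def by (simp only: n_def)
      qed
      finally show ?thesis .
    qed
    have "contour_integral (linepath a4 a1) f = - contour_integral (linepath a1 a4) f"
      by (rule contour_integral_reverse_linepath) (rule cont, use pim in blast)
    hence "contour_integral (linepath a4 a1) f = - (\<i> * ver (-1) N)"
      using vert[of "-1"] by (simp add: a1_def a4_def)
    moreover have "contour_integral (linepath a2 a3) f = \<i> * ver 1 N"
      using vert[of 1] by (simp add: a2_def a3_def)
    ultimately show ?thesis using total by (simp add: algebra_simps)
  qed
  have hor: "hor \<longlonglongrightarrow> 0"
  proof (rule Lim_null_comparison)
    show "\<forall>\<^sub>F N in sequentially. norm (hor N) \<le> 64 * pi\<^sup>2 * B * exp (- 2 * pi * (1 - c) * real N) * real N"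
      using eventually_ge_at_top[of "1::nat"]
    proof eventually_elim
      case (elim N)
      define n where "n = real N"
      have n: "1 \<le> n" using elim by (simp add: n_def)
      define K where "K = 16 * pi\<^sup>2 * B * exp (- 2 * pi * (1 - c) * n)"
      have K: "0 \<le> K" using B by (simp add: K_def)
      \<comment> \<open>\<open>E\<close> contributes at most
        \<open>B * exp (2 * pi * c * n)\<close>, while the squared cosine is at least
        \<open>exp (2 * pi * n) / 16\<close> by \<open>norm_cos_pi_ge\<close>.\<close>
      have le: "norm (f z) \<le> K" and nz: "cos (of_real pi * z) \<noteq> 0" if z: "\<bar>Im z\<bar> = n" for z
      proof -
        have cc: "exp (pi * n) / 4 \<le> norm (cos (of_real pi * z))"
          using norm_cos_pi_ge[of z] z n by simp
        thus "cos (of_real pi * z) \<noteq> 0" by (auto simp: not_le[symmetric])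
        have "norm (f z) \<le> (B * exp (2 * pi * (c * n))) * (pi / (exp (pi * n) / 4))\<^sup>2"
          unfolding f_def norm_mult norm_power norm_divide
        proof (intro mult_mono power_mono divide_mono)
          show "norm (E (of_real c * z)) \<le> B * exp (2 * pi * (c * n))"
            using bE[of "of_real c * z"] z c by (simp add: abs_mult)
        qed (use cc B in auto)
        also have "\<dots> = 16 * pi\<^sup>2 * B * (exp (2 * pi * (c * n)) * exp (- (2 * (pi * n))))"
          unfolding exp_minus exp_double by (simp add: power_divide field_simps)
        also have "exp (2 * pi * (c * n)) * exp (- (2 * (pi * n))) = exp (- 2 * pi * (1 - c) * n)"
          unfolding exp_add[symmetric] by (simp add: algebra_simps)
        finally show "norm (f z) \<le> K" by (simp add: K_def)
      qed
      have hbound: "norm (contour_integral (linepath u v) f) \<le> K * (2 * n)"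
        if uv: "Im u = Im v" "\<bar>Im u\<bar> = n" "norm (v - u) = 2 * n" for u v
      proof -
        have im: "\<bar>Im z\<bar> = n" if "z \<in> closed_segment u v" for z
          using that uv by (auto simp: closed_segment_same_Im)
        have "continuous_on (closed_segment u v) f"
          by (intro holomorphic_on_imp_continuous_on holf nz im)
        hence "f contour_integrable_on linepath u v" by (rule contour_integrable_continuous_linepath)
        from contour_integral_bound_linepath[OF this K] le[OF im] uv show ?thesis by simp
      qed
      have "norm (hor N) \<le> K * (2 * n) + K * (2 * n)"
        unfolding hor_def n_def[symmetric]
      proof (rule order.trans[OF norm_triangle_ineq add_mono]; rule hbound)
        have "Complex n (-n) - Complex (-n) (-n) = of_real (2 * n)" "Complex (-n) n - Complex n n = of_real (- 2 * n)"
          by (simp_all add: complex_eq_iff)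
        thus "norm (Complex n (-n) - Complex (-n) (-n)) = 2 * n" "norm (Complex (-n) n - Complex n n) = 2 * n"
          using n by (simp_all only: norm_of_real)
      qed (use n in auto)
      thus "norm (hor N) \<le> 64 * pi\<^sup>2 * B * exp (- 2 * pi * (1 - c) * real N) * real N"
        by (simp add: K_def n_def algebra_simps)
    qed
    show "(\<lambda>N. 64 * pi\<^sup>2 * B * exp (- 2 * pi * (1 - c) * real N) * real N) \<longlonglongrightarrow> 0"
    proof -
      define d where "d = 2 * pi * (1 - c)"
      have "0 < d" using c by (simp add: d_def)
      hence "(\<lambda>N. 64 * pi\<^sup>2 * B * exp (- d * real N) * real N) \<longlonglongrightarrow> 0" by real_asymp
      thus ?thesis by (simp add: d_def)
    qed
  qed
  \<comment> \<open>On a side receding to infinity \<open>E\<close> tends to \<open>l\<close> off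
    the real axis as well, by \<open>translates_tendsto\<close>, and the weight
    \<open>(pi / cosh (pi * y))\<^sup>2\<close> has integral \<open>2 * pi\<close>. The majorant is
    integrable because \<open>c < 1\<close>.\<close>
  have ver: "ver a \<longlonglongrightarrow> 2 * pi * l"
    if lim: "\<And>t. (\<lambda>N::nat. E (of_real (c * (a * real N) + t))) \<longlonglongrightarrow> l" for a :: real and l :: complex
  proof -
    have "ver a \<longlonglongrightarrow> (\<integral>y. l * of_real (pi\<^sup>2 * (1 / (cosh (pi * y))\<^sup>2)) \<partial>lborel)"
      unfolding ver_def
    proof (rule integral_dominated_convergence[where w = "\<lambda>y. 4 * pi\<^sup>2 * B * exp (- (2 * pi * (1 - c)) * \<bar>y\<bar>)"])
      show "integrable lborel (\<lambda>y. 4 * pi\<^sup>2 * B * exp (- (2 * pi * (1 - c)) * \<bar>y\<bar>))"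
        using has_bochner_integral_exp_neg_abs[of "2 * pi * (1 - c)"] c
        by (intro integrable_mult_right) (auto simp: has_bochner_integral_iff)
      have contE: "continuous_on UNIV E" by (intro holomorphic_on_imp_continuous_on holE)
      have [measurable]: "E \<in> borel_measurable borel" by (rule borel_measurable_continuous_onI[OF contE])
      show "(\<lambda>y. l * of_real (pi\<^sup>2 * (1 / (cosh (pi * y))\<^sup>2))) \<in> borel_measurable lborel"
        unfolding cosh_def by measurable
      show "(\<lambda>y. indicator {-real N..real N} y *\<^sub>R (E (of_real (c * (a * real N)) + \<i> * of_real (c * y)) * of_real (pi\<^sup>2 * (1 / (cosh (pi * y))\<^sup>2)))) \<in> borel_measurable lborel" for N
        unfolding cosh_def by measurable
      show "AE y in lborel. (\<lambda>N. indicator {-real N..real N} y *\<^sub>R (E (of_real (c * (a * real N)) + \<i> * of_real (c * y)) * of_real (pi\<^sup>2 * (1 / (cosh (pi * y))\<^sup>2))))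
          \<longlonglongrightarrow> l * of_real (pi\<^sup>2 * (1 / (cosh (pi * y))\<^sup>2))"
      proof (rule AE_I2)
        fix y :: real
        have "(\<lambda>N. E (of_real (c * (a * real N)) + \<i> * of_real (c * y))) \<longlonglongrightarrow> l"
          by (rule translates_tendsto[OF holE bE lim])
        hence lim1: "(\<lambda>N. E (of_real (c * (a * real N)) + \<i> * of_real (c * y)) * of_real (pi\<^sup>2 * (1 / (cosh (pi * y))\<^sup>2))) \<longlonglongrightarrow> l * of_real (pi\<^sup>2 * (1 / (cosh (pi * y))\<^sup>2))"
          by (intro tendsto_mult tendsto_const)
        obtain m :: nat where m: "\<bar>y\<bar> \<le> real m" using real_arch_simple by blast
        show "(\<lambda>N. indicator {-real N..real N} y *\<^sub>R (E (of_real (c * (a * real N)) + \<i> * of_real (c * y)) * of_real (pi\<^sup>2 * (1 / (cosh (pi * y))\<^sup>2))))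
          \<longlonglongrightarrow> l * of_real (pi\<^sup>2 * (1 / (cosh (pi * y))\<^sup>2))"
        proof (rule Lim_transform_eventually[OF lim1])
          show "\<forall>\<^sub>F N in sequentially. E (of_real (c * (a * real N)) + \<i> * of_real (c * y)) * of_real (pi\<^sup>2 * (1 / (cosh (pi * y))\<^sup>2)) =
             indicator {-real N..real N} y *\<^sub>R (E (of_real (c * (a * real N)) + \<i> * of_real (c * y)) * of_real (pi\<^sup>2 * (1 / (cosh (pi * y))\<^sup>2)))"
            using eventually_ge_at_top[of m]
          proof eventually_elim
            case (elim N)
            hence "real m \<le> real N" by simp
            with m have "y \<in> {-real N..real N}" by auto
            thus ?case by simp
          qed
        qed
      qed
      show "AE y in lborel. norm (indicator {-real N..real N} y *\<^sub>R (E (of_real (c * (a * real N)) + \<i> * of_real (c * y)) * of_real (pi\<^sup>2 * (1 / (cosh (pi * y))\<^sup>2))))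
          \<le> 4 * pi\<^sup>2 * B * exp (- (2 * pi * (1 - c)) * \<bar>y\<bar>)" for N
      proof (rule AE_I2)
        fix y :: real
        have "norm (indicator {-real N..real N} y *\<^sub>R (E (of_real (c * (a * real N)) + \<i> * of_real (c * y)) * of_real (pi\<^sup>2 * (1 / (cosh (pi * y))\<^sup>2))))
          \<le> norm (E (of_real (c * (a * real N)) + \<i> * of_real (c * y))) * (pi\<^sup>2 * (1 / (cosh (pi * y))\<^sup>2))"
          by (auto simp: norm_mult norm_divide norm_power abs_mult split: split_indicator)
        also have "\<dots> \<le> (B * exp (2 * pi * (c * \<bar>y\<bar>))) * (pi\<^sup>2 * (4 * exp (- 2 * pi * \<bar>y\<bar>)))"
        proof (intro mult_mono)
          show "norm (E (of_real (c * (a * real N)) + \<i> * of_real (c * y))) \<le> B * exp (2 * pi * (c * \<bar>y\<bar>))"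
            using bE[of "of_real (c * (a * real N)) + \<i> * of_real (c * y)"] c by (simp add: abs_mult)
        qed (use one_over_cosh_sq_le[of y] B in auto)
        also have "\<dots> = 4 * pi\<^sup>2 * B * (exp (2 * pi * (c * \<bar>y\<bar>)) * exp (- 2 * pi * \<bar>y\<bar>))" by simp
        also have "exp (2 * pi * (c * \<bar>y\<bar>)) * exp (- 2 * pi * \<bar>y\<bar>) = exp (- (2 * pi * (1 - c)) * \<bar>y\<bar>)"
          unfolding exp_add[symmetric] by (simp add: algebra_simps)
        finally show "norm (indicator {-real N..real N} y *\<^sub>R (E (of_real (c * (a * real N)) + \<i> * of_real (c * y)) * of_real (pi\<^sup>2 * (1 / (cosh (pi * y))\<^sup>2))))
          \<le> 4 * pi\<^sup>2 * B * exp (- (2 * pi * (1 - c)) * \<bar>y\<bar>)" .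
      qed
    qed
    also have "(\<integral>y. l * of_real (pi\<^sup>2 * (1 / (cosh (pi * y))\<^sup>2)) \<partial>lborel) = l * of_real (pi\<^sup>2 * (2 / pi))"
      by (simp only: integral_mult_right_zero integral_complex_of_real one_over_cosh_sq_integral(2))
    also have "\<dots> = 2 * pi * l" by (simp add: power2_eq_square)
    finally show ?thesis .
  qed
  have limp: "(\<lambda>N::nat. E (of_real (c * (1 * real N) + t))) \<longlonglongrightarrow> lp" for t
  proof (rule filterlim_compose[OF lp])
    show "LIM N sequentially. c * (1 * real N) + t :> at_top" using c by real_asymp
  qed
  have limm: "(\<lambda>N::nat. E (of_real (c * (-1 * real N) + t))) \<longlonglongrightarrow> lm" for t
  proof (rule filterlim_compose[OF lm])
    show "LIM N sequentially. c * (-1 * real N) + t :> at_bot" using c by real_asymp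
  qed
  have "(\<lambda>N. (hor N + \<i> * (ver 1 N - ver (-1) N)) / (2 * pi * \<i>)) \<longlonglongrightarrow> (0 + \<i> * (2 * pi * lp - 2 * pi * lm)) / (2 * pi * \<i>)"
    by (intro tendsto_intros hor ver limp limm) auto
  also have "(0 + \<i> * (2 * pi * lp - 2 * pi * lm)) / (2 * pi * \<i>) = lp - lm"
    by (simp add: field_simps)
  finally have lim: "(\<lambda>N. (hor N + \<i> * (ver 1 N - ver (-1) N)) / (2 * pi * \<i>)) \<longlonglongrightarrow> lp - lm" .
  have "(\<lambda>N. \<Sum>k\<in>{- int N..<int N}. of_real c * F (of_real (c * (of_int k + 1/2)))) \<longlonglongrightarrow> lp - lm"
  proof (rule Lim_transform_eventually[OF lim])
    show "\<forall>\<^sub>F N in sequentially. (hor N + \<i> * (ver 1 N - ver (-1) N)) / (2 * pi * \<i>)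
       = (\<Sum>k\<in>{- int N..<int N}. of_real c * F (of_real (c * (of_int k + 1/2))))"
      using eventually_ge_at_top[of "1::nat"]
    proof eventually_elim
      case (elim N)
      from contour[OF elim] show ?case by (simp add: field_simps)
    qed
  qed
  thus ?thesis unfolding lpm .
qed

section \<open>The minorants of the exponential\<close>

lemma eventually_cos_pi_nonzero: "\<forall>\<^sub>F w in at z. cos (of_real pi * w) \<noteq> 0" for z :: complex
proof (cases "cos (of_real pi * z) = 0")
  case False
  have "((\<lambda>w. cos (of_real pi * w)) \<longlongrightarrow> cos (of_real pi * z)) (at z)"
    by (intro tendsto_intros)
  from tendsto_imp_eventually_ne[OF this False] show ?thesis .
next
  case True
  then obtain k :: int where k: "z = of_int k + 1/2" unfolding cos_pi_eq_0_iff by blast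
  have "\<forall>\<^sub>F w in at z. w \<in> ball z 1 - {z}" by (rule eventually_at_in_open) auto
  thus ?thesis
  proof eventually_elim
    case (elim w)
    show ?case
    proof
      assume "cos (of_real pi * w) = 0"
      then obtain j :: int where j: "w = of_int j + 1/2" unfolding cos_pi_eq_0_iff by blast
      have "norm (of_int (k - j) :: complex) < 1" using elim j k by (simp add: dist_norm)
      hence "k = j" by (simp only: norm_of_int)
      thus False using elim j k by simp
    qed
  qed
qed

text \<open>The zeros of the cosine are isolated, so an entire candidate \<open>g\<close> can be
  checked by algebra at points where nothing is divided by 0.\<close>

lemma remove_sings_half_integers:
  assumes eq: "\<And>w. cos (of_real pi * w) \<noteq> 0 \<Longrightarrow> f w = g w" and hol: "g holomorphic_on UNIV"
  shows "remove_sings f = g"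
proof
  fix z
  show "remove_sings f z = g z"
  proof (rule remove_sings_eqI, rule Lim_transform_eventually)
    show "g \<midarrow>z\<rightarrow> g z"
      using holomorphic_on_imp_continuous_on[OF hol] by (auto simp: continuous_on_eq_continuous_at isCont_def)
    show "\<forall>\<^sub>F w in at z. g w = f w"
      using eventually_cos_pi_nonzero by eventually_elim (simp add: eq)
  qed
qed

text \<open>The index range starts at \<open>- N - 1\<close> because the mirror image of the node of
  index \<open>k\<close> has index \<open>- k - 1\<close>.\<close>

lemma sum_half_integers:
  fixes g :: "real \<Rightarrow> complex"
  shows "(\<Sum>k\<in>{- int N - 1..int N}. g (of_int k + 1/2)) = (\<Sum>j\<le>N. g (real j + 1/2) + g (- (real j + 1/2)))"
proof (induction N)
  case 0
  have "{- int 0 - 1..int 0} = {-1, 0}" by auto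
  thus ?case by simp
next
  case (Suc N)
  have "{- int (Suc N) - 1..int (Suc N)} = insert (int (Suc N)) (insert (- int (Suc N) - 1) {- int N - 1..int N})"
    by auto
  hence "(\<Sum>k\<in>{- int (Suc N) - 1..int (Suc N)}. g (of_int k + 1/2)) =
     g (of_int (int (Suc N)) + 1/2) + (g (of_int (- int (Suc N) - 1) + 1/2) + (\<Sum>k\<in>{- int N - 1..int N}. g (of_int k + 1/2)))"
    by simp
  also have "of_int (- int (Suc N) - 1) + 1/2 = - (real (Suc N) + 1/2)" by simp
  finally show ?case unfolding Suc.IH by (simp add: add_ac)
qed

lemma infsum_half_integers:
  fixes g :: "real \<Rightarrow> complex"
  assumes "summable (\<lambda>j::nat. norm (g (real j + 1/2)))" "summable (\<lambda>j::nat. norm (g (- (real j + 1/2))))"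
  shows "(\<Sum>\<^sub>\<infinity>k\<in>(UNIV :: int set). g (of_int k + 1/2)) = (\<Sum>j. g (real j + 1/2)) + (\<Sum>j. g (- (real j + 1/2)))"
proof -
  define n where "n = (\<lambda>j::nat. - int j - 1)"
  have "((\<lambda>j. g (real j + 1/2)) has_sum (\<Sum>j. g (real j + 1/2))) UNIV"
    using assms(1) by (rule norm_summable_imp_has_sum) (use summable_norm_cancel[OF assms(1)] in \<open>rule summable_sums\<close>)
  hence 1: "((\<lambda>k. g (of_int k + 1/2)) has_sum (\<Sum>j. g (real j + 1/2))) (range int)"
    by (subst has_sum_reindex) (auto simp: o_def inj_on_def)
  have "((\<lambda>j. g (- (real j + 1/2))) has_sum (\<Sum>j. g (- (real j + 1/2)))) UNIV"
    using assms(2) by (rule norm_summable_imp_has_sum) (use summable_norm_cancel[OF assms(2)] in \<open>rule summable_sums\<close>)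
  moreover have "of_int (n j) + 1/2 = - (real j + 1/2)" for j by (simp add: n_def)
  hence "(\<lambda>k. g (of_int k + 1/2)) \<circ> n = (\<lambda>j. g (- (real j + 1/2)))"
    unfolding o_def by (simp only:)
  moreover have "inj n" by (auto simp: inj_on_def n_def)
  ultimately have 2: "((\<lambda>k. g (of_int k + 1/2)) has_sum (\<Sum>j. g (- (real j + 1/2)))) (range n)"
    by (simp only: has_sum_reindex)
  have "range int \<union> range n = UNIV"
  proof -
    have "k \<in> range int \<union> range n" for k
    proof (cases "0 \<le> k")
      case True
      thus ?thesis by (metis UnI1 nonneg_int_cases rangeI)
    next
      case False
      hence "k = n (nat (- k - 1))" by (simp add: n_def)
      thus ?thesis by blast
    qed
    thus ?thesis by blast
  qed
  moreover have "range int \<inter> range n = {}" by (auto simp: n_def)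
  ultimately have "((\<lambda>k. g (of_int k + 1/2)) has_sum ((\<Sum>j. g (real j + 1/2)) + (\<Sum>j. g (- (real j + 1/2))))) UNIV"
    using has_sum_Un_disjoint[OF 1 2] by simp
  thus ?thesis by (rule infsumI)
qed

section \<open>Interpolation kernels and the series of \<open>L\<close>\<close>

text \<open>\<open>k2 a z\<close> and \<open>k1 a z\<close> are \<open>(cos (pi * z) / pi)\<^sup>2\<close> divided by \<open>(z - a)\<^sup>2\<close> and by \<open>z - a\<close> if \<open>a\<close> is
  a half-integer.\<close>

definition k2 :: "real \<Rightarrow> complex \<Rightarrow> complex" where "k2 a z = (csinc (z - of_real a))\<^sup>2"
definition k1 :: "real \<Rightarrow> complex \<Rightarrow> complex" where "k1 a z = (z - of_real a) * k2 a z"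

text \<open>Reflection trades the node \<open>- a\<close> for \<open>a\<close>, so that all series
  can run over the positive half-integers.\<close>

lemma k2_neg: "k2 (-a) z = k2 a (-z)" and k1_neg: "k1 (-a) z = - k1 a (-z)"
proof -
  have "z - of_real (-a) = - (-z - of_real a)" by simp
  thus "k2 (-a) z = k2 a (-z)" by (simp only: k2_def csinc_minus)
  thus "k1 (-a) z = - k1 a (-z)" by (simp add: k1_def algebra_simps)
qed

lemma holomorphic_k2 [holomorphic_intros]: "k2 a holomorphic_on A"
  and holomorphic_k1 [holomorphic_intros]: "k1 a holomorphic_on A"
proof -
  have "(\<lambda>z. csinc (z - of_real a)) holomorphic_on A"
    by (rule holomorphic_on_compose_gen[OF _ holomorphic_csinc, unfolded o_def]) (auto intro!: holomorphic_intros)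
  thus *: "k2 a holomorphic_on A" unfolding k2_def by (intro holomorphic_intros)
  show "k1 a holomorphic_on A" unfolding k1_def by (intro holomorphic_intros *)
qed

lemma holomorphic_reflect: "f holomorphic_on UNIV \<Longrightarrow> (\<lambda>z::complex. f (-z)) holomorphic_on A"
  by (rule holomorphic_on_compose_gen[of uminus, unfolded o_def]) (auto intro!: holomorphic_intros)

lemma cos_sq_k2:
  fixes z :: complex
  shows "(cos (of_real pi * z) / of_real pi)\<^sup>2 = (z - of_real (of_int k + 1/2))\<^sup>2 * k2 (of_int k + 1/2) z"
  unfolding power_divide cos_sq_eq_csinc[of z k] k2_def by simp

lemma norm_sin_le_exp: "norm (sin (z::complex)) \<le> exp \<bar>Im z\<bar>"
  using cmod_sin_le_exp[of 1 z] by simp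

lemma norm_cos_le_exp: "norm (cos (z::complex)) \<le> exp \<bar>Im z\<bar>"
  using cmod_cos_le_exp[of 1 z] by simp

text \<open>The mean value inequality for \<open>sin\<close> in the strip
  \<open>\<bar>Im v\<bar> \<le> \<bar>Im w\<bar>\<close>, where its derivative is at most
  \<open>exp \<bar>Im w\<bar>\<close>.\<close>

lemma norm_csinc_le: "norm (csinc u) \<le> exp (pi * \<bar>Im u\<bar>)"
proof (cases "u = 0")
  case False
  define w where "w = of_real pi * u"
  have w: "w \<noteq> 0" "\<bar>Im w\<bar> = pi * \<bar>Im u\<bar>" using False by (auto simp: w_def abs_mult)
  have "norm (sin w - sin 0) \<le> exp \<bar>Im w\<bar> * norm (w - 0)"
  proof (rule field_differentiable_bound[of "{v. -\<bar>Im w\<bar> \<le> Im v} \<inter> {v. Im v \<le> \<bar>Im w\<bar>}" sin cos])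
    show "convex ({v. -\<bar>Im w\<bar> \<le> Im v} \<inter> {v. Im v \<le> \<bar>Im w\<bar>})"
      by (intro convex_Int convex_halfspace_Im_le convex_halfspace_Im_ge)
    fix v assume "v \<in> {v. -\<bar>Im w\<bar> \<le> Im v} \<inter> {v. Im v \<le> \<bar>Im w\<bar>}"
    hence "\<bar>Im v\<bar> \<le> \<bar>Im w\<bar>" by auto
    thus "norm (cos v) \<le> exp \<bar>Im w\<bar>" using norm_cos_le_exp[of v] by (meson exp_le_cancel_iff order_trans)
  qed (auto intro!: derivative_eq_intros)
  hence "norm (sin w) / norm w \<le> exp \<bar>Im w\<bar>" using w by (simp add: divide_le_eq)
  thus ?thesis using False w unfolding csinc_def w_def[symmetric] by (simp add: norm_divide)
qed simp

lemma norm_mult_csinc_le: "norm u * norm (csinc u) \<le> exp (pi * \<bar>Im u\<bar>)"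
proof (cases "u = 0")
  case False
  have "norm u * norm (csinc u) = norm (sin (of_real pi * u)) / pi"
    using False by (simp add: csinc_def norm_divide norm_mult)
  also have "\<dots> \<le> norm (sin (of_real pi * u)) / 1" using pi_gt3 by (intro divide_left_mono) auto
  also have "\<dots> \<le> exp (pi * \<bar>Im u\<bar>)" using norm_sin_le_exp[of "of_real pi * u"] by (simp add: abs_mult)
  finally show ?thesis .
qed simp

text \<open>The two factors \<open>csinc\<close> are combined with no, one or two powers of
  \<open>z - a\<close>, each factor taking at most one of them.\<close>

lemma
  shows norm_k2_le: "norm (k2 a z) \<le> exp (2 * pi * \<bar>Im z\<bar>)"
    and norm_k1_le: "norm (k1 a z) \<le> exp (2 * pi * \<bar>Im z\<bar>)"
    and norm_k2_sq_le: "norm (k2 a z) * (norm (z - of_real a))\<^sup>2 \<le> exp (2 * pi * \<bar>Im z\<bar>)"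
proof -
  define u where "u = z - of_real a"
  have e2: "exp (pi * \<bar>Im z\<bar>) * exp (pi * \<bar>Im z\<bar>) = exp (2 * pi * \<bar>Im z\<bar>)"
    by (simp flip: exp_add)
  have 1: "norm (csinc u) \<le> exp (pi * \<bar>Im z\<bar>)" and 2: "norm u * norm (csinc u) \<le> exp (pi * \<bar>Im z\<bar>)"
    using norm_csinc_le[of u] norm_mult_csinc_le[of u] by (simp_all add: u_def)
  show "norm (k2 a z) \<le> exp (2 * pi * \<bar>Im z\<bar>)"
    using mult_mono[OF 1 1] unfolding e2 unfolding k2_def norm_power u_def[symmetric] power2_eq_square norm_mult by simp
  show "norm (k1 a z) \<le> exp (2 * pi * \<bar>Im z\<bar>)"
    using mult_mono[OF 2 1] unfolding e2 unfolding k1_def k2_def norm_mult norm_power u_def[symmetric] power2_eq_square by (simp add: mult.assoc)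
  show "norm (k2 a z) * (norm (z - of_real a))\<^sup>2 \<le> exp (2 * pi * \<bar>Im z\<bar>)"
    using mult_mono[OF 2 2] unfolding e2 unfolding k2_def norm_power u_def[symmetric] power2_eq_square norm_mult by (simp add: mult_ac)
qed

text \<open>By the triangle inequality \<open>1 + a\<^sup>2 \<le> 2 * (1 + (norm z)\<^sup>2) * (1 +
  (norm (z - a))\<^sup>2)\<close>, which turns decay in the distance from \<open>z\<close> into
  decay in \<open>a\<close>.\<close>

lemma norm_k2_le_decay: "norm (k2 a z) \<le> 4 * (1 + (norm z)\<^sup>2) * exp (2 * pi * \<bar>Im z\<bar>) / (1 + a\<^sup>2)"
proof -
  define d where "d = norm (z - of_real a)"
  have "\<bar>a\<bar> \<le> norm z + d"
    using norm_triangle_ineq4[of z "z - of_real a"] by (simp add: d_def)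
  hence "\<bar>a\<bar>\<^sup>2 \<le> (norm z + d)\<^sup>2" by (intro power_mono) auto
  also have "\<dots> \<le> 2 * (norm z)\<^sup>2 + 2 * d\<^sup>2"
    using sum_squares_bound[of "norm z" d] by (simp add: power2_sum)
  moreover have "2 * (1 + (norm z)\<^sup>2) * (1 + d\<^sup>2) = 2 + 2 * (norm z)\<^sup>2 + 2 * d\<^sup>2 + 2 * ((norm z)\<^sup>2 * d\<^sup>2)"
    by (simp add: algebra_simps)
  moreover have "0 \<le> (norm z)\<^sup>2 * d\<^sup>2" by simp
  ultimately have "1 + a\<^sup>2 \<le> 2 * (1 + (norm z)\<^sup>2) * (1 + d\<^sup>2)"
    unfolding power2_abs by linarith
  hence "norm (k2 a z) * (1 + a\<^sup>2) \<le> norm (k2 a z) * (2 * (1 + (norm z)\<^sup>2) * (1 + d\<^sup>2))"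
    by (intro mult_left_mono) auto
  also have "\<dots> = 2 * (1 + (norm z)\<^sup>2) * (norm (k2 a z) + norm (k2 a z) * d\<^sup>2)" by (simp add: algebra_simps)
  also have "\<dots> \<le> 2 * (1 + (norm z)\<^sup>2) * (exp (2 * pi * \<bar>Im z\<bar>) + exp (2 * pi * \<bar>Im z\<bar>))"
    using norm_k2_le[of a z] norm_k2_sq_le[of a z] unfolding d_def by (intro mult_left_mono add_mono) auto
  finally show ?thesis by (simp add: le_divide_eq add_pos_nonneg algebra_simps)
qed

text \<open>The Hermite interpolation term of \<open>exp (- s * x)\<close> at a positive node
  \<open>a\<close>: it takes over value and derivative there. At \<open>- z\<close> it is the term
  of \<open>exp (- s * \<bar>x\<bar>)\<close> for the node \<open>- a\<close>.\<close>

definition L_term :: "real \<Rightarrow> real \<Rightarrow> complex \<Rightarrow> complex" where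
  "L_term s a z = of_real (exp (- s * a)) * (k2 a z - of_real s * k1 a z)"

definition L_sum :: "nat \<Rightarrow> real \<Rightarrow> complex \<Rightarrow> complex" where
  "L_sum N s z = (\<Sum>j\<le>N. L_term s (real j + 1/2) z + L_term s (real j + 1/2) (- z))"

text \<open>The same interpolation for the constant function 1, so that subtracting
  \<open>exp (- s)\<close> from the interpolated function subtracts
  \<open>exp (- s) * K_sum N z\<close>.\<close>

definition K_sum :: "nat \<Rightarrow> complex \<Rightarrow> complex" where
  "K_sum N z = (\<Sum>j\<le>N. k2 (real j + 1/2) z + k2 (real j + 1/2) (- z))"

lemma holomorphic_L_term: "L_term s a holomorphic_on A"
  unfolding L_term_def by (intro holomorphic_intros)

lemma holomorphic_L_sum: "L_sum N s holomorphic_on A"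
  unfolding L_sum_def by (intro holomorphic_intros holomorphic_L_term holomorphic_reflect)

lemma norm_L_term_le: "0 < s \<Longrightarrow> norm (L_term s a z) \<le> exp (- s * a) * ((1 + s) * exp (2 * pi * \<bar>Im z\<bar>))"
proof -
  assume s: "0 < s"
  have "norm (k2 a z - of_real s * k1 a z) \<le> norm (k2 a z) + s * norm (k1 a z)"
    using norm_triangle_ineq4[of "k2 a z" "of_real s * k1 a z"] s by (simp add: norm_mult)
  also have "\<dots> \<le> exp (2 * pi * \<bar>Im z\<bar>) + s * exp (2 * pi * \<bar>Im z\<bar>)"
    using norm_k2_le[of a z] norm_k1_le[of a z] s by (intro add_mono mult_left_mono) auto
  finally show ?thesis unfolding L_term_def norm_mult by (intro mult_mono) (auto simp: algebra_simps)
qed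

lemma exp_half_integer: "exp (- s * (real j + 1/2)) = exp (- s / 2) * exp (- s) ^ j"
  by (simp add: algebra_simps flip: exp_add exp_of_nat_mult)

lemma sums_exp_half_integer:
  "0 < s \<Longrightarrow> (\<lambda>j. exp (- s * (real j + 1/2))) sums (exp (- s / 2) / (1 - exp (- s)))"
  unfolding exp_half_integer using sums_mult[OF geometric_sums[of "exp (- s)"], of "exp (- s / 2)"] by simp

lemma sum_exp_half_integer_le: "0 < s \<Longrightarrow> (\<Sum>j\<le>N. exp (- s * (real j + 1/2))) \<le> exp (- s / 2) / (1 - exp (- s))"
  using sum_le_suminf[of "\<lambda>j. exp (- s * (real j + 1/2))" "{..N}"] sums_exp_half_integer[of s]
  by (auto simp: sums_iff)

lemma summable_L_term:
  assumes s: "0 < s"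
  shows "summable (\<lambda>j. norm (L_term s (real j + 1/2) z))"
proof (rule summable_comparison_test')
  show "summable (\<lambda>j. exp (- s * (real j + 1/2)) * ((1 + s) * exp (2 * pi * \<bar>Im z\<bar>)))"
    by (intro summable_mult2 sums_summable[OF sums_exp_half_integer[OF s]])
  show "norm (norm (L_term s (real j + 1/2) z)) \<le> exp (- s * (real j + 1/2)) * ((1 + s) * exp (2 * pi * \<bar>Im z\<bar>))"
    if "0 \<le> j" for j
    using norm_L_term_le[OF s, of "real j + 1/2" z] by simp
qed

lemma norm_L_sum_le:
  assumes s: "0 < s"
  shows "norm (L_sum N s z) \<le> 2 * ((1 + s) * (exp (- s / 2) / (1 - exp (- s)))) * exp (2 * pi * \<bar>Im z\<bar>)"
proof -
  have "norm (L_sum N s z) \<le> (\<Sum>j\<le>N. 2 * (exp (- s * (real j + 1/2)) * ((1 + s) * exp (2 * pi * \<bar>Im z\<bar>))))"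
    unfolding L_sum_def
  proof (rule order.trans[OF norm_sum sum_mono])
    fix j
    show "norm (L_term s (real j + 1/2) z + L_term s (real j + 1/2) (- z)) \<le> 2 * (exp (- s * (real j + 1/2)) * ((1 + s) * exp (2 * pi * \<bar>Im z\<bar>)))"
      using norm_L_term_le[OF s, of "real j + 1/2" z] norm_L_term_le[OF s, of "real j + 1/2" "-z"]
        norm_triangle_ineq[of "L_term s (real j + 1/2) z" "L_term s (real j + 1/2) (- z)"] by simp
  qed
  also have "\<dots> = 2 * ((1 + s) * (\<Sum>j\<le>N. exp (- s * (real j + 1/2)))) * exp (2 * pi * \<bar>Im z\<bar>)"
    by (simp add: sum_distrib_left sum_distrib_right mult_ac)
  also have "\<dots> \<le> 2 * ((1 + s) * (exp (- s / 2) / (1 - exp (- s)))) * exp (2 * pi * \<bar>Im z\<bar>)"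
    using sum_exp_half_integer_le[OF s, of N] s by (intro mult_right_mono mult_left_mono) auto
  finally show ?thesis .
qed

lemma L_sum_tendsto_suminf:
  assumes s: "0 < s"
  shows "(\<lambda>N. L_sum N s z) \<longlonglongrightarrow> (\<Sum>j. L_term s (real j + 1/2) z + L_term s (real j + 1/2) (- z))"
  unfolding L_sum_def
  by (intro summable_LIMSEQ' summable_add summable_norm_cancel[OF summable_L_term] s)

text \<open>The working form of \<open>L\<close>: the series is entire as a locally bounded limit of
  \<open>L_sum\<close>, and off the half-integers it arises from the defining sums by moving the
  squared cosine into each fraction.\<close>

lemma L_eq_suminf:
  assumes s: "0 < s"
  shows "L s = (\<lambda>z. \<Sum>j. L_term s (real j + 1/2) z + L_term s (real j + 1/2) (- z))" (is "_ = ?g")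
  unfolding L_def
proof (rule remove_sings_half_integers)
  show "?g holomorphic_on UNIV"
  proof (rule holomorphic_pointwise_limit)
    show "\<exists>B. \<forall>N z. norm z \<le> r \<longrightarrow> norm (L_sum N s z) \<le> B" for r
    proof (intro exI allI impI)
      fix N and z :: complex assume z: "norm z \<le> r"
      have pos: "0 \<le> 2 * ((1 + s) * (exp (- s / 2) / (1 - exp (- s))))" using s by simp
      show "norm (L_sum N s z) \<le> 2 * ((1 + s) * (exp (- s / 2) / (1 - exp (- s)))) * exp (2 * pi * r)"
        using z abs_Im_le_cmod[of z]
        by (intro order.trans[OF norm_L_sum_le[OF s]] mult_left_mono[OF _ pos]) auto
    qed
  qed (rule holomorphic_L_sum L_sum_tendsto_suminf[OF s])+
  fix w :: complex assume w: "cos (of_real pi * w) \<noteq> 0"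
  define K where "K = (cos (of_real pi * w) / of_real pi)\<^sup>2"
  have K: "K \<noteq> 0" using w by (simp add: K_def)
  define A where "A = (\<lambda>h. of_real (exp (- s * \<bar>h\<bar>)) / (w - of_real h)\<^sup>2)"
  define B where "B = (\<lambda>h. of_real (sgn h * exp (- s * \<bar>h\<bar>)) / (w - of_real h))"
  have wh: "w - of_real h \<noteq> 0" "K = (w - of_real h)\<^sup>2 * k2 h w" if hj: "h = real j + 1/2 \<or> h = - (real j + 1/2)" for h j
  proof -
    obtain k :: int where k: "h = of_int k + 1/2"
    proof (cases "h = real j + 1/2")
      case True
      thus ?thesis by (intro that[of "int j"]) simp
    next
      case False
      thus ?thesis using hj by (intro that[of "- int j - 1"]) simp
    qed
    show "K = (w - of_real h)\<^sup>2 * k2 h w" unfolding K_def cos_sq_k2[of w k] k by simp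
    with K show "w - of_real h \<noteq> 0" by auto
  qed
  have KA: "K * A h = of_real (exp (- s * \<bar>h\<bar>)) * k2 h w" and KB: "K * B h = of_real (sgn h * exp (- s * \<bar>h\<bar>)) * k1 h w"
    if "h = real j + 1/2 \<or> h = - (real j + 1/2)" for h j
    using wh[OF that] by (simp_all add: A_def B_def k1_def power2_eq_square)
  have nA: "norm (A h) \<le> exp (- s * (real j + 1/2)) * (exp (2 * pi * \<bar>Im w\<bar>) / norm K)"
    and nB: "norm (B h) \<le> exp (- s * (real j + 1/2)) * (exp (2 * pi * \<bar>Im w\<bar>) / norm K)"
    if h: "h = real j + 1/2 \<or> h = - (real j + 1/2)" for h j
  proof -
    have ah: "\<bar>h\<bar> = real j + 1/2" "\<bar>sgn h\<bar> = 1" using h by (auto simp: sgn_real_def)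
    have "norm K * norm (A h) \<le> exp (- s * (real j + 1/2)) * exp (2 * pi * \<bar>Im w\<bar>)"
      using norm_k2_le[of h w] unfolding norm_mult[symmetric] KA[OF h] by (simp add: norm_mult ah)
    thus "norm (A h) \<le> exp (- s * (real j + 1/2)) * (exp (2 * pi * \<bar>Im w\<bar>) / norm K)"
      using K by (simp add: field_simps)
    have "norm K * norm (B h) \<le> exp (- s * (real j + 1/2)) * exp (2 * pi * \<bar>Im w\<bar>)"
      using norm_k1_le[of h w] unfolding norm_mult[symmetric] KB[OF h]
      by (simp add: norm_mult abs_mult ah)
    thus "norm (B h) \<le> exp (- s * (real j + 1/2)) * (exp (2 * pi * \<bar>Im w\<bar>) / norm K)"
      using K by (simp add: field_simps)
  qed
  have sm: "summable (\<lambda>j. exp (- s * (real j + 1/2)) * (exp (2 * pi * \<bar>Im w\<bar>) / norm K))"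
    by (intro summable_mult2 sums_summable[OF sums_exp_half_integer[OF s]])
  have sA: "summable (\<lambda>j. norm (A (real j + 1/2)))" and sA': "summable (\<lambda>j. norm (A (- (real j + 1/2))))"
    and sB: "summable (\<lambda>j. norm (B (real j + 1/2)))" and sB': "summable (\<lambda>j. norm (B (- (real j + 1/2))))"
    by (rule summable_comparison_test'[OF sm, of 0]; use nA nB in simp)+
  have "(\<Sum>\<^sub>\<infinity>k\<in>(UNIV :: int set). of_real (exp (- s * \<bar>of_int k + 1/2\<bar>)) / (w - of_int k - 1/2)\<^sup>2)
      = (\<Sum>\<^sub>\<infinity>k\<in>(UNIV :: int set). A (of_int k + 1/2))"
    by (simp add: A_def diff_diff_add)
  also have "\<dots> = (\<Sum>j. A (real j + 1/2)) + (\<Sum>j. A (- (real j + 1/2)))"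
    by (rule infsum_half_integers[OF sA sA'])
  finally have 1: "(\<Sum>\<^sub>\<infinity>k\<in>(UNIV :: int set). of_real (exp (- s * \<bar>of_int k + 1/2\<bar>)) / (w - of_int k - 1/2)\<^sup>2)
      = (\<Sum>j. A (real j + 1/2)) + (\<Sum>j. A (- (real j + 1/2)))" .
  have "(\<Sum>\<^sub>\<infinity>l\<in>(UNIV :: int set). of_real (sgn (of_int l + 1/2) * exp (- s * \<bar>of_int l + 1/2\<bar>)) / (w - of_int l - 1/2))
      = (\<Sum>\<^sub>\<infinity>k\<in>(UNIV :: int set). B (of_int k + 1/2))"
    by (simp add: B_def diff_diff_add)
  also have "\<dots> = (\<Sum>j. B (real j + 1/2)) + (\<Sum>j. B (- (real j + 1/2)))"
    by (rule infsum_half_integers[OF sB sB'])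
  finally have 2: "(\<Sum>\<^sub>\<infinity>l\<in>(UNIV :: int set). of_real (sgn (of_int l + 1/2) * exp (- s * \<bar>of_int l + 1/2\<bar>)) / (w - of_int l - 1/2))
      = (\<Sum>j. B (real j + 1/2)) + (\<Sum>j. B (- (real j + 1/2)))" .
  have "(\<lambda>j. K * (A (real j + 1/2) + A (- (real j + 1/2)) - of_real s * (B (real j + 1/2) + B (- (real j + 1/2)))))
     sums (K * ((\<Sum>j. A (real j + 1/2)) + (\<Sum>j. A (- (real j + 1/2))) - of_real s * ((\<Sum>j. B (real j + 1/2)) + (\<Sum>j. B (- (real j + 1/2))))))"
    by (intro sums_mult sums_add sums_diff summable_sums summable_norm_cancel[OF sA]
        summable_norm_cancel[OF sA'] summable_norm_cancel[OF sB] summable_norm_cancel[OF sB'])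
  moreover have "K * (A (real j + 1/2) + A (- (real j + 1/2)) - of_real s * (B (real j + 1/2) + B (- (real j + 1/2))))
     = L_term s (real j + 1/2) w + L_term s (real j + 1/2) (- w)" for j
  proof -
    define a where "a = real j + 1/2"
    have a: "0 < a" by (simp add: a_def)
    have "K * (A a + A (- a) - of_real s * (B a + B (- a))) = K * A a + K * A (-a) - of_real s * (K * B a + K * B (-a))"
      by (simp add: algebra_simps)
    also have "\<dots> = L_term s a w + L_term s a (- w)"
      using KA[of a j] KA[of "-a" j] KB[of a j] KB[of "-a" j] a
      by (simp add: a_def[symmetric] L_term_def k2_neg k1_neg algebra_simps)
    finally show ?thesis by (simp add: a_def)
  qed
  ultimately show "(cos (of_real pi * w) / of_real pi)\<^sup>2 *
     ((\<Sum>\<^sub>\<infinity>k\<in>(UNIV :: int set). of_real (exp (- s * \<bar>of_int k + 1/2\<bar>)) / (w - of_int k - 1/2)\<^sup>2)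
      - of_real s * (\<Sum>\<^sub>\<infinity>l\<in>(UNIV :: int set). of_real (sgn (of_int l + 1/2) * exp (- s * \<bar>of_int l + 1/2\<bar>)) / (w - of_int l - 1/2))) = ?g w"
    unfolding 1 2 K_def[symmetric] by (simp add: sums_iff)
qed

lemma L_sum_tendsto: "0 < s \<Longrightarrow> (\<lambda>N. L_sum N s z) \<longlonglongrightarrow> L s z"
  unfolding L_eq_suminf by (rule L_sum_tendsto_suminf)

lemma norm_L_le:
  assumes s: "0 < s"
  shows "norm (L s z) \<le> 2 * ((1 + s) * (exp (- s / 2) / (1 - exp (- s)))) * exp (2 * pi * \<bar>Im z\<bar>)"
  by (rule tendsto_upperbound[OF tendsto_norm[OF L_sum_tendsto[OF s]]]) (intro always_eventually allI norm_L_sum_le s, simp)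

lemma holomorphic_L: "0 < s \<Longrightarrow> L s holomorphic_on UNIV"
proof -
  assume s: "0 < s"
  show ?thesis
  proof (rule holomorphic_pointwise_limit[OF holomorphic_L_sum _ L_sum_tendsto[OF s]])
    show "\<exists>B. \<forall>N z. norm z \<le> r \<longrightarrow> norm (L_sum N s z) \<le> B" for r
    proof (intro exI allI impI)
      fix N and z :: complex assume z: "norm z \<le> r"
      have pos: "0 \<le> 2 * ((1 + s) * (exp (- s / 2) / (1 - exp (- s))))" using s by simp
      show "norm (L_sum N s z) \<le> 2 * ((1 + s) * (exp (- s / 2) / (1 - exp (- s)))) * exp (2 * pi * r)"
        using z abs_Im_le_cmod[of z]
        by (intro order.trans[OF norm_L_sum_le[OF s]] mult_left_mono[OF _ pos]) auto
    qed
  qed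
qed

section \<open>Partial fractions of the inverse squared cosine\<close>

text \<open>Two logarithmic derivatives of the reflection formula for \<open>Gamma\<close>. The form
  with \<open>Polygamma 1\<close> is chosen because its series consists of the fractions
  \<open>1 / (w + k)\<^sup>2\<close>.\<close>

lemma Trigamma_reflection:
  fixes w :: complex
  assumes w: "w \<notin> \<int>"
  shows "Polygamma 1 w + Polygamma 1 (1 - w) = (of_real pi)\<^sup>2 / (sin (of_real pi * w))\<^sup>2"
proof -
  define S where "S = (- \<int> :: complex set)"
  have S: "open S" "w \<in> S" using w by (auto simp: S_def closed_Ints)
  have nz: "sin (of_real pi * v) \<noteq> 0" "v \<notin> \<int>\<^sub>\<le>\<^sub>0" "1 - v \<notin> \<int>\<^sub>\<le>\<^sub>0" if "v \<in> S" for v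
  proof -
    show "v \<notin> \<int>\<^sub>\<le>\<^sub>0" using that nonpos_Ints_subset_Ints by (auto simp: S_def)
    show "1 - v \<notin> \<int>\<^sub>\<le>\<^sub>0"
      using that nonpos_Ints_subset_Ints Ints_diff[of 1 "1 - v"] by (auto simp: S_def)
    show "sin (of_real pi * v) \<noteq> 0"
    proof
      assume "sin (of_real pi * v) = 0"
      then obtain n :: int where "of_real pi * v = of_real (of_int n * pi)" unfolding sin_eq_0 by auto
      hence "v = of_int n" by simp
      thus False using that by (auto simp: S_def)
    qed
  qed
  have dig: "Digamma v - Digamma (1 - v) = - (of_real pi * cos (of_real pi * v) / sin (of_real pi * v))"
    if v: "v \<in> S" for v
  proof -
    define s where "s = sin (of_real pi * v)"
    have s: "s \<noteq> 0" using nz[OF v] by (simp add: s_def)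
    have 1: "((\<lambda>v. Gamma v * Gamma (1 - v)) has_field_derivative
        Gamma v * Digamma v * Gamma (1 - v) - Gamma v * (Gamma (1 - v) * Digamma (1 - v))) (at v)"
      using nz[OF v] by (auto intro!: derivative_eq_intros)
    have 2: "((\<lambda>v. of_real pi / sin (of_real pi * v)) has_field_derivative
        - (of_real pi * (of_real pi * cos (of_real pi * v)) / s\<^sup>2)) (at v)"
      unfolding s_def using nz[OF v] by (auto intro!: derivative_eq_intros simp: power2_eq_square)
    have "(\<lambda>v. Gamma v * Gamma (1 - v)) = (\<lambda>v::complex. of_real pi / sin (of_real pi * v))"
      using Gamma_reflection_complex by auto
    from DERIV_unique[OF 1[unfolded this] 2]
    have "Gamma v * Gamma (1 - v) * (Digamma v - Digamma (1 - v)) = - (of_real pi * (of_real pi * cos (of_real pi * v)) / s\<^sup>2)"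
      by (simp add: algebra_simps)
    hence "of_real pi / s * (Digamma v - Digamma (1 - v)) = of_real pi / s * (- (of_real pi * cos (of_real pi * v) / s))"
      unfolding Gamma_reflection_complex s_def by (simp add: power2_eq_square)
    moreover have "of_real pi / s \<noteq> 0" using s by simp
    ultimately show ?thesis unfolding s_def by (simp only: mult_cancel_left) simp
  qed
  have 1: "((\<lambda>v. Digamma v - Digamma (1 - v)) has_field_derivative Polygamma 1 w + Polygamma 1 (1 - w)) (at w)"
    using nz[OF S(2)] by (auto intro!: derivative_eq_intros)
  have "((\<lambda>v. - (of_real pi * cos (of_real pi * v) / sin (of_real pi * v))) has_field_derivative
      of_real pi * (of_real pi * (sin (of_real pi * w) * sin (of_real pi * w) + cos (of_real pi * w) * cos (of_real pi * w)))
        / (sin (of_real pi * w) * sin (of_real pi * w))) (at w)"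
    using nz[OF S(2)] by (auto intro!: derivative_eq_intros simp: divide_simps)
      (simp add: algebra_simps, simp only: distrib_left[symmetric] sin_cos_squared_add3 mult_1_right)
  hence 2: "((\<lambda>v. - (of_real pi * cos (of_real pi * v) / sin (of_real pi * v))) has_field_derivative
      (of_real pi)\<^sup>2 / (sin (of_real pi * w))\<^sup>2) (at w)"
    by (simp add: power2_eq_square[symmetric])
  have "((\<lambda>v. Digamma v - Digamma (1 - v)) has_field_derivative (of_real pi)\<^sup>2 / (sin (of_real pi * w))\<^sup>2) (at w)"
    by (rule has_field_derivative_transform_within_open[OF 2 S]) (simp add: dig)
  from DERIV_unique[OF 1 this] show ?thesis .
qed

text \<open>These are the partial fractions of \<open>(pi / cos (pi * z))\<^sup>2\<close>, read off
  from the trigamma function at \<open>z + 1/2\<close> and \<open>1/2 - z\<close>. At a node the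
  series collapses to the one kernel centred there.\<close>

lemma K_sum_tendsto: "(\<lambda>N. K_sum N z) \<longlonglongrightarrow> 1"
proof (cases "cos (of_real pi * z) = 0")
  case True
  then obtain k :: int where k: "z = of_int k + 1/2" unfolding cos_pi_eq_0_iff by blast
  have k2: "k2 (of_int i + 1/2) z = (if i = k then 1 else 0)" for i
  proof (cases "i = k")
    case False
    have "sin (of_real pi * (of_int (k - i) :: complex)) = 0"
      unfolding sin_eq_0 by (intro exI[of _ "k - i"]) simp
    hence "csinc (of_int (k - i)) = 0" using False by (simp add: csinc_def)
    thus ?thesis using False by (simp add: k2_def k)
  qed (simp add: k2_def k)
  have "K_sum N z = (\<Sum>i\<in>{- int N - 1..int N}. k2 (of_int i + 1/2) z)" for N
    unfolding K_sum_def sum_half_integers[of "\<lambda>a. k2 a z"] k2_neg ..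
  hence eq: "K_sum N z = (if k \<in> {- int N - 1..int N} then 1 else 0)" for N
    by (simp add: k2)
  show ?thesis
  proof (rule tendsto_eventually)
    show "\<forall>\<^sub>F N in sequentially. K_sum N z = 1"
      using eventually_ge_at_top[of "nat \<bar>k\<bar>"] by eventually_elim (auto simp: eq)
  qed
next
  case False
  define K where "K = (cos (of_real pi * z) / of_real pi)\<^sup>2"
  have zI: "z + 1/2 \<notin> \<int>"
  proof
    assume "z + 1/2 \<in> \<int>"
    then obtain n :: int where "z + 1/2 = of_int n" by (auto elim: Ints_cases)
    hence "z = of_int (n - 1) + 1/2" by (simp add: algebra_simps)
    with False show False unfolding cos_pi_eq_0_iff by blast
  qed
  have zI': "1 - (z + 1/2) \<notin> \<int>" using zI Ints_diff[of 1 "1 - (z + 1/2)"] by (auto simp: add.commute)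
  have z0: "z + 1/2 \<noteq> 0" "1 - (z + 1/2) \<noteq> 0" using zI zI' Ints_0 by metis+
  have "(\<lambda>k. inverse ((z + 1/2 + of_nat k)\<^sup>2)) sums Polygamma 1 (z + 1/2)"
    using Polygamma_LIMSEQ[of "z + 1/2" 1] z0 by (simp add: numeral_2_eq_2)
  moreover have "(\<lambda>k. inverse ((1 - (z + 1/2) + of_nat k)\<^sup>2)) sums Polygamma 1 (1 - (z + 1/2))"
    using Polygamma_LIMSEQ[of "1 - (z + 1/2)" 1] z0 by (simp add: numeral_2_eq_2)
  ultimately have "(\<lambda>k. K * (inverse ((z + 1/2 + of_nat k)\<^sup>2) + inverse ((1 - (z + 1/2) + of_nat k)\<^sup>2)))
      sums (K * ((of_real pi)\<^sup>2 / (sin (of_real pi * (z + 1/2)))\<^sup>2))"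
    unfolding Trigamma_reflection[OF zI, symmetric] by (intro sums_mult sums_add)
  also have "(sin (of_real pi * (z + 1/2)))\<^sup>2 = (cos (of_real pi * z))\<^sup>2"
    using cos_half_integer_shift[of z "-1"] by simp
  also have "K * ((of_real pi)\<^sup>2 / (cos (of_real pi * z))\<^sup>2) = 1"
    using False by (simp add: K_def power_divide)
  also have "(\<lambda>k. K * (inverse ((z + 1/2 + of_nat k)\<^sup>2) + inverse ((1 - (z + 1/2) + of_nat k)\<^sup>2)))
     = (\<lambda>j. k2 (real j + 1/2) z + k2 (real j + 1/2) (- z))"
  proof
    fix j :: nat
    have K1: "K = (z - of_real (real j + 1/2))\<^sup>2 * k2 (real j + 1/2) z"
      using cos_sq_k2[of z "int j"] by (simp add: K_def)
    have K2: "K = (- z - of_real (real j + 1/2))\<^sup>2 * k2 (real j + 1/2) (- z)"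
      using cos_sq_k2[of "-z" "int j"] by (simp add: K_def)
    have K0: "K \<noteq> 0" using False by (simp add: K_def)
    have a1: "1 - (z + 1/2) + of_nat j = - (z - of_real (real j + 1/2))" by simp
    have a2: "z + 1/2 + of_nat j = - (- z - of_real (real j + 1/2))" by simp
    have "K * inverse ((z - of_real (real j + 1/2))\<^sup>2) = k2 (real j + 1/2) z"
      using K0 K1 by (auto simp: field_simps)
    moreover have "K * inverse ((- z - of_real (real j + 1/2))\<^sup>2) = k2 (real j + 1/2) (- z)"
      using K0 K2 by (auto simp: field_simps)
    ultimately show "K * (inverse ((z + 1/2 + of_nat j)\<^sup>2) + inverse ((1 - (z + 1/2) + of_nat j)\<^sup>2))
      = k2 (real j + 1/2) z + k2 (real j + 1/2) (- z)"
      unfolding a1 a2 power2_minus distrib_left by (simp only: add.commute)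
  qed
  finally show ?thesis unfolding K_sum_def by (simp add: sums_def_le)
qed

lemma K_sum_bound:
  obtains C where "0 < C" "\<And>z N. norm (K_sum N z) \<le> C * (1 + (norm z)\<^sup>2) * exp (2 * pi * \<bar>Im z\<bar>)"
    "\<And>z N. (\<Sum>j\<le>N. norm (k2 (real j + 1/2) z)) \<le> C * (1 + (norm z)\<^sup>2) * exp (2 * pi * \<bar>Im z\<bar>)"
proof -
  have sm: "summable (\<lambda>j. 1 / (1 + (real j + 1/2)\<^sup>2))"
  proof (rule summable_comparison_test')
    have "summable (\<lambda>j. 4 * (1 / (real j + 1)\<^sup>2))"
      using inverse_squares_sums by (intro summable_mult) (simp add: sums_iff add.commute)
    thus "summable (\<lambda>j. 4 / (real (Suc j))\<^sup>2)" by (simp add: add.commute)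
    fix j :: nat
    have "(real (Suc j))\<^sup>2 \<le> 4 * (1 + (real j + 1/2)\<^sup>2)" by (simp add: power2_eq_square algebra_simps)
    hence "4 / (4 * (1 + (real j + 1/2)\<^sup>2)) \<le> 4 / (real (Suc j))\<^sup>2"
      by (intro divide_left_mono mult_pos_pos) (auto simp: add_pos_nonneg)
    moreover have "4 / (4 * (1 + (real j + 1/2)\<^sup>2)) = 1 / (1 + (real j + 1/2)\<^sup>2)"
    proof -
      have "4 / (4 * x) = 1 / x" for x :: real by simp
      thus ?thesis .
    qed
    ultimately have "1 / (1 + (real j + 1/2)\<^sup>2) \<le> 4 / (real (Suc j))\<^sup>2" by (simp only:)
    moreover have "0 \<le> 1 / (1 + (real j + 1/2)\<^sup>2)" by simp
    ultimately show "norm (1 / (1 + (real j + 1/2)\<^sup>2)) \<le> 4 / (real (Suc j))\<^sup>2"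
      by (simp only: real_norm_def abs_of_nonneg)
  qed
  define C0 where "C0 = 4 * (\<Sum>j. 1 / (1 + (real j + 1/2)\<^sup>2))"
  have C0: "0 < C0" unfolding C0_def using suminf_pos[OF sm] by (simp add: add_pos_nonneg)
  have b: "(\<Sum>j\<le>N. norm (k2 (real j + 1/2) z)) \<le> C0 * ((1 + (norm z)\<^sup>2) * exp (2 * pi * \<bar>Im z\<bar>))" for z N
  proof -
    have "(\<Sum>j\<le>N. norm (k2 (real j + 1/2) z)) \<le> (\<Sum>j\<le>N. 4 * ((1 + (norm z)\<^sup>2) * exp (2 * pi * \<bar>Im z\<bar>)) * (1 / (1 + (real j + 1/2)\<^sup>2)))"
      by (rule sum_mono, rule order.trans[OF norm_k2_le_decay])
        (simp only: mult.assoc times_divide_eq_right mult_1_right order.refl)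
    also have "\<dots> = 4 * ((1 + (norm z)\<^sup>2) * exp (2 * pi * \<bar>Im z\<bar>)) * (\<Sum>j\<le>N. 1 / (1 + (real j + 1/2)\<^sup>2))"
      by (simp add: sum_distrib_left)
    also have "\<dots> \<le> 4 * ((1 + (norm z)\<^sup>2) * exp (2 * pi * \<bar>Im z\<bar>)) * (\<Sum>j. 1 / (1 + (real j + 1/2)\<^sup>2))"
      by (intro mult_left_mono sum_le_suminf sm) (auto simp: add_pos_nonneg)
    finally show ?thesis by (simp add: C0_def mult_ac)
  qed
  have "norm (K_sum N z) \<le> (2 * C0) * (1 + (norm z)\<^sup>2) * exp (2 * pi * \<bar>Im z\<bar>)" for z N
  proof -
    have "norm (K_sum N z) \<le> (\<Sum>j\<le>N. norm (k2 (real j + 1/2) z) + norm (k2 (real j + 1/2) (- z)))"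
      unfolding K_sum_def by (rule order.trans[OF norm_sum sum_mono]) (rule norm_triangle_ineq)
    also have "\<dots> \<le> (2 * C0) * (1 + (norm z)\<^sup>2) * exp (2 * pi * \<bar>Im z\<bar>)"
      using b[of z N] b[of "-z" N] by (simp add: sum.distrib mult.assoc)
    finally show ?thesis .
  qed
  moreover have "(\<Sum>j\<le>N. norm (k2 (real j + 1/2) z)) \<le> (2 * C0) * (1 + (norm z)\<^sup>2) * exp (2 * pi * \<bar>Im z\<bar>)" for z N
  proof -
    have "0 \<le> C0 * ((1 + (norm z)\<^sup>2) * exp (2 * pi * \<bar>Im z\<bar>))" using C0 by simp
    with b[of z N] have "(\<Sum>j\<le>N. norm (k2 (real j + 1/2) z)) \<le> C0 * ((1 + (norm z)\<^sup>2) * exp (2 * pi * \<bar>Im z\<bar>)) + C0 * ((1 + (norm z)\<^sup>2) * exp (2 * pi * \<bar>Im z\<bar>))"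
      by linarith
    thus ?thesis by (simp add: mult.assoc)
  qed
  ultimately show ?thesis using that[of "2 * C0"] C0 by simp
qed

section \<open>Growth of \<open>L s z - exp (- s)\<close>, with explicit dependence on
  \<open>s\<close>\<close>

text \<open>The integral of \<open>u * exp (- u * a)\<close> over \<open>0 \<le> u \<le> v\<close>.\<close>

definition rho :: "real \<Rightarrow> real \<Rightarrow> real" where "rho a v = (1 - exp (- v * a) * (1 + v * a)) / a\<^sup>2"

lemma rho_deriv: "0 < a \<Longrightarrow> (rho a has_real_derivative v * exp (- v * a)) (at v within A)"
  unfolding rho_def by (auto intro!: derivative_eq_intros simp: power2_eq_square field_simps)

text \<open>The derivative of each term in \<open>v\<close> is \<open>v * exp (- v * a)\<close>, and
  over all nodes these add up to \<open>(v / 2) / sinh (v / 2) \<le> 1\<close>. So the sum grows no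
  faster than \<open>s\<close>.\<close>

lemma rho_sum_le:
  assumes s: "0 < s"
  shows "(\<Sum>j\<le>N. rho (real j + 1/2) s) \<le> s"
proof -
  define P where "P = (\<lambda>v. v - (\<Sum>j\<le>N. rho (real j + 1/2) v))"
  have "P 0 \<le> P s"
  proof (rule DERIV_nonneg_imp_nondecreasing[of 0 s P])
    fix v :: real assume v: "0 \<le> v" "v \<le> s"
    have d: "(P has_real_derivative 1 - (\<Sum>j\<le>N. v * exp (- v * (real j + 1/2)))) (at v)"
      unfolding P_def by (intro derivative_intros rho_deriv) auto
    have "(\<Sum>j\<le>N. v * exp (- v * (real j + 1/2))) \<le> 1"
    proof (cases "v = 0")
      case False
      hence v0: "0 < v" using v by simp
      have "(\<Sum>j\<le>N. v * exp (- v * (real j + 1/2))) = v * (\<Sum>j\<le>N. exp (- v * (real j + 1/2)))"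
        by (simp add: sum_distrib_left)
      also have "\<dots> \<le> v * (exp (- v / 2) / (1 - exp (- v)))"
        using sum_exp_half_integer_le[OF v0, of N] v0 by (intro mult_left_mono) auto
      also have "v * (exp (- v / 2) / (1 - exp (- v))) \<le> 1"
      proof -
        have "v \<le> exp (v / 2) - exp (- v / 2)"
          using real_le_x_sinh[of "v / 2"] v0 by (simp add: exp_minus)
        hence "v * exp (- v / 2) \<le> (exp (v / 2) - exp (- v / 2)) * exp (- v / 2)" by (intro mult_right_mono) auto
        also have "\<dots> = 1 - exp (- v)" by (simp add: algebra_simps flip: exp_add)
        finally show ?thesis using v0 by (simp add: divide_le_eq)
      qed
      finally show ?thesis by simp
    qed simp
    with d show "\<exists>y. (P has_real_derivative y) (at v) \<and> 0 \<le> y" by (intro exI[of _ "1 - (\<Sum>j\<le>N. v * exp (- v * (real j + 1/2)))"]) simp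
  qed (use s in simp)
  thus ?thesis by (simp add: P_def rho_def)
qed

text \<open>With \<open>u = z - a\<close> the difference is
  \<open>- k2 a z * exp (- s * z) * p s\<close>, where \<open>p\<close> has derivative
  \<open>v * u\<^sup>2 * exp (v * u)\<close>. The factor \<open>u\<^sup>2\<close> is absorbed by
  \<open>k2\<close>, and what remains is \<open>rho a s\<close>, whose sum over the nodes is at most
  \<open>s\<close>.\<close>

lemma L_term_approx:
  assumes s: "0 < s" and a: "0 < a"
  shows "norm (L_term s a z - k2 a z * exp (- of_real s * z)) \<le> exp (2 * pi * \<bar>Im z\<bar>) * (exp (2 * s * norm z) * rho a s)"
proof -
  define u where "u = z - of_real a"
  define p :: "real \<Rightarrow> complex" where "p = (\<lambda>v. 1 - exp (of_real v * u) * (1 - of_real v * u))"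
  have "norm (p s - p 0) \<le> (norm u)\<^sup>2 * exp (s * norm z) * rho a s - (norm u)\<^sup>2 * exp (s * norm z) * rho a 0"
  proof (rule differentiable_bound_general[OF s, of p "\<lambda>v. (norm u)\<^sup>2 * exp (s * norm z) * rho a v"
        "\<lambda>v. of_real v * u\<^sup>2 * exp (of_real v * u)" "\<lambda>v. (norm u)\<^sup>2 * exp (s * norm z) * (v * exp (- v * a))"])
    show "continuous_on {0..s} (\<lambda>v. (norm u)\<^sup>2 * exp (s * norm z) * rho a v)"
      unfolding rho_def by (intro continuous_intros) (use a in auto)
    show "continuous_on {0..s} p" unfolding p_def by (intro continuous_intros)
    fix v assume v: "0 < v" "v < s"
    show "((\<lambda>v. (norm u)\<^sup>2 * exp (s * norm z) * rho a v) has_vector_derivative (norm u)\<^sup>2 * exp (s * norm z) * (v * exp (- v * a))) (at v)"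
      unfolding has_real_derivative_iff_has_vector_derivative[symmetric]
      by (intro DERIV_cmult rho_deriv a)
    have "((\<lambda>w. 1 - exp (w * u) * (1 - w * u)) has_field_derivative of_real v * u\<^sup>2 * exp (of_real v * u)) (at (of_real v))"
      by (auto intro!: derivative_eq_intros simp: power2_eq_square algebra_simps)
    thus "(p has_vector_derivative of_real v * u\<^sup>2 * exp (of_real v * u)) (at v)"
      unfolding p_def by (rule has_vector_derivative_real_field)
    have "v * Re u \<le> s * norm z + - v * a"
    proof -
      have "v * Re z \<le> v * norm z" using v complex_Re_le_cmod by (intro mult_left_mono) auto
      also have "\<dots> \<le> s * norm z" using v by (intro mult_right_mono) auto
      finally show ?thesis by (simp add: u_def algebra_simps)
    qed
    hence "exp (v * Re u) \<le> exp (s * norm z) * exp (- v * a)" by (simp flip: exp_add)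
    hence "v * (norm u)\<^sup>2 * exp (v * Re u) \<le> v * (norm u)\<^sup>2 * (exp (s * norm z) * exp (- v * a))"
      using v by (intro mult_left_mono) auto
    thus "norm (of_real v * u\<^sup>2 * exp (of_real v * u)) \<le> (norm u)\<^sup>2 * exp (s * norm z) * (v * exp (- v * a))"
      using v by (simp add: norm_mult norm_power mult_ac)
  qed
  hence ps: "norm (p s) \<le> (norm u)\<^sup>2 * (exp (s * norm z) * rho a s)" by (simp add: p_def rho_def)
  have "exp (- of_real s * z) * exp (of_real s * u) = of_real (exp (- s * a))"
    by (simp add: u_def algebra_simps exp_of_real[symmetric] flip: exp_add)
  hence "L_term s a z - k2 a z * exp (- of_real s * z) = - (k2 a z * exp (- of_real s * z) * p s)"
    unfolding L_term_def k1_def u_def[symmetric] p_def by (simp add: algebra_simps)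
  hence "norm (L_term s a z - k2 a z * exp (- of_real s * z)) = norm (k2 a z) * norm (exp (- of_real s * z)) * norm (p s)"
    by (simp add: norm_mult)
  also have "\<dots> \<le> norm (k2 a z) * exp (s * norm z) * ((norm u)\<^sup>2 * (exp (s * norm z) * rho a s))"
  proof (intro mult_mono ps)
    have "- Re z \<le> norm z" using abs_Re_le_cmod[of z] by linarith
    hence "s * (- Re z) \<le> s * norm z" using s by (intro mult_left_mono) auto
    thus "norm (exp (- of_real s * z)) \<le> exp (s * norm z)" by simp
  qed auto
  also have "\<dots> = (norm (k2 a z) * (norm u)\<^sup>2) * (exp (2 * s * norm z) * rho a s)"
    by (simp add: mult_ac flip: exp_add)
  also have "\<dots> \<le> exp (2 * pi * \<bar>Im z\<bar>) * (exp (2 * s * norm z) * rho a s)"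
  proof (rule mult_right_mono)
    show "norm (k2 a z) * (norm u)\<^sup>2 \<le> exp (2 * pi * \<bar>Im z\<bar>)" unfolding u_def by (rule norm_k2_sq_le)
    have "exp (- s * a) * (1 + s * a) \<le> exp (- s * a) * exp (s * a)" by (intro mult_left_mono exp_ge_add_one_self) auto
    hence "0 \<le> rho a s" by (simp add: rho_def flip: exp_add)
    thus "0 \<le> exp (2 * s * norm z) * rho a s" by simp
  qed
  finally show ?thesis .
qed

lemma one_plus_power_le_exp:
  assumes "0 < (\<epsilon>::real)" "0 \<le> x"
  shows "(1 + x) ^ 3 \<le> (1 + 3 / \<epsilon>) ^ 3 * exp (\<epsilon> * x)"
proof -
  have "1 + x \<le> (1 + 3 / \<epsilon>) * (1 + \<epsilon> * x / 3)" using assms by (simp add: field_simps)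
  also have "\<dots> \<le> (1 + 3 / \<epsilon>) * exp (\<epsilon> * x / 3)"
    using assms by (intro mult_left_mono exp_ge_add_one_self) auto
  finally have "(1 + x) ^ 3 \<le> ((1 + 3 / \<epsilon>) * exp (\<epsilon> * x / 3)) ^ 3" using assms by (intro power_mono) auto
  also have "\<dots> = (1 + 3 / \<epsilon>) ^ 3 * exp (\<epsilon> * x)"
    by (simp add: power_mult_distrib flip: exp_of_nat_mult)
  finally show ?thesis .
qed

lemma norm_exp_diff_le:
  assumes "norm u \<le> r" "norm v \<le> r"
  shows "norm (exp u - exp (v::complex)) \<le> exp r * norm (u - v)"
proof (rule field_differentiable_bound[of "cball 0 r" exp exp])
  fix w :: complex assume "w \<in> cball 0 r"
  hence "Re w \<le> r" using complex_Re_le_cmod[of w] by simp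
  thus "norm (exp w) \<le> exp r" by simp
qed (use assms in \<open>auto intro!: derivative_eq_intros\<close>)

text \<open>For small \<open>s\<close> a term of \<open>L_sum\<close> is close to
  \<open>k2 a z * exp (- s * z)\<close>, which is within a multiple of \<open>s\<close> of
  \<open>k2 a z * exp (- s)\<close>; for large \<open>s\<close> both sums are exponentially small.
  Comparing with \<open>K_sum\<close> and not with its limit 1 gives a majorant that serves for all
  \<open>N\<close> at once.\<close>

lemma L_sum_minus_K_sum_le:
  assumes "0 < \<epsilon>"
  obtains C where "0 < C" "\<And>N s z. 0 < s \<Longrightarrow>
    norm (L_sum N s z - of_real (exp (- s)) * K_sum N z) \<le> C * (s / (1 + s\<^sup>2)) * exp ((2 * pi + \<epsilon>) * norm z)"
proof -
  obtain C0 where C0: "0 < C0" and Kb: "\<And>z N. norm (K_sum N z) \<le> C0 * (1 + (norm z)\<^sup>2) * exp (2 * pi * \<bar>Im z\<bar>)"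
    and kb: "\<And>z N. (\<Sum>j\<le>N. norm (k2 (real j + 1/2) z)) \<le> C0 * (1 + (norm z)\<^sup>2) * exp (2 * pi * \<bar>Im z\<bar>)"
    by (rule K_sum_bound) (rule that)
  \<comment> \<open>The threshold between small and large \<open>s\<close>. For
    \<open>s \<le> d\<close> the factor \<open>exp (2 * s * norm z)\<close> fits into the \<epsilon>
    that the exponent allows.\<close>
  define d where "d = min \<epsilon> 1 / 2"
  have d: "0 < d" "d \<le> 1" "2 * d \<le> \<epsilon>" using assms by (auto simp: d_def)
  define M where "M = (1 + 3 / d) ^ 3"
  have M: "1 \<le> M" using d by (simp add: M_def)
  have cube: "(1 + norm z) ^ 3 \<le> M * exp (d * norm z)" for z :: complex
    unfolding M_def using d by (intro one_plus_power_le_exp) auto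
  have cube': "1 + (norm z)\<^sup>2 \<le> M * exp (d * norm z)" "(1 + (norm z)\<^sup>2) * (1 + norm z) \<le> M * exp (d * norm z)" for z :: complex
  proof -
    have "1 + (norm z)\<^sup>2 \<le> (1 + (norm z)\<^sup>2) * (1 + norm z)" by (simp add: algebra_simps)
    moreover have "(1 + (norm z)\<^sup>2) * (1 + norm z) \<le> (1 + norm z)\<^sup>2 * (1 + norm z)"
      by (intro mult_right_mono) (auto simp: power2_sum)
    hence "(1 + (norm z)\<^sup>2) * (1 + norm z) \<le> (1 + norm z) ^ 3" by (simp add: power3_eq_cube power2_eq_square)
    ultimately show "1 + (norm z)\<^sup>2 \<le> M * exp (d * norm z)" "(1 + (norm z)\<^sup>2) * (1 + norm z) \<le> M * exp (d * norm z)"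
      using cube[of z] by linarith+
  qed
  define C1 where "C1 = 4 * (1 + C0 * 3 * M)"
  define C2 where "C2 = (343 / d) * (2 / (1 - exp (- d)) + C0 * M)"
  have C1: "0 < C1" unfolding C1_def using C0 M by (intro mult_pos_pos add_pos_nonneg) auto
  have C2: "0 < C2" unfolding C2_def using C0 M d by (intro mult_pos_pos add_pos_nonneg divide_pos_pos) auto
  have Y: "exp (2 * pi * \<bar>Im z\<bar>) * exp (2 * d * norm z) \<le> exp ((2 * pi + \<epsilon>) * norm z)" for z
  proof -
    have "2 * pi * \<bar>Im z\<bar> + 2 * d * norm z \<le> 2 * pi * norm z + \<epsilon> * norm z"
      using d abs_Im_le_cmod[of z] by (intro add_mono mult_left_mono mult_right_mono) auto
    thus ?thesis by (simp add: algebra_simps flip: exp_add)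
  qed
  have small: "norm (L_sum N s z - of_real (exp (- s)) * K_sum N z) \<le> C1 * (s / (1 + s\<^sup>2)) * exp ((2 * pi + \<epsilon>) * norm z)"
    if s: "0 < s" "s \<le> d" for N s z
  proof -
    \<comment> \<open>Positive nodes only; taken at \<open>- z\<close> as well, it covers the
      negative ones.\<close>
    have half: "(\<Sum>j\<le>N. norm (L_term s (real j + 1/2) z - of_real (exp (- s)) * k2 (real j + 1/2) z))
       \<le> s * (1 + C0 * 3 * M) * (exp (2 * pi * \<bar>Im z\<bar>) * exp (2 * d * norm z))" for z
    proof -
      have ez: "norm (exp (- of_real s * z) - of_real (exp (- s))) \<le> 3 * exp (d * norm z) * (s * (1 + norm z))"
      proof -
        have "norm (exp (- of_real s * z) - exp (- of_real s)) \<le> exp (s * (1 + norm z)) * norm (- of_real s * z - (- of_real s))"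
          by (rule norm_exp_diff_le) (use s in \<open>auto simp: norm_mult algebra_simps\<close>)
        also have "norm (- of_real s * z - (- of_real s)) \<le> norm (of_real s * z) + norm (of_real s :: complex)"
          using norm_triangle_ineq4[of "of_real s" "of_real s * z"] by (simp add: algebra_simps)
        hence "exp (s * (1 + norm z)) * norm (- of_real s * z - (- of_real s)) \<le> exp (s * (1 + norm z)) * (s * (1 + norm z))"
          using s by (intro mult_left_mono) (auto simp: norm_mult algebra_simps)
        also have "\<dots> \<le> (3 * exp (d * norm z)) * (s * (1 + norm z))"
        proof (rule mult_right_mono)
          have "exp (s * (1 + norm z)) = exp s * exp (s * norm z)" by (simp add: algebra_simps exp_add)
          also have "\<dots> \<le> 3 * exp (d * norm z)"
          proof (intro mult_mono)
            have "exp s \<le> exp 1" using s d by simp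
            thus "exp s \<le> 3" using exp_le by linarith
          qed (use s in \<open>auto intro: mult_right_mono\<close>)
          finally show "exp (s * (1 + norm z)) \<le> 3 * exp (d * norm z)" .
        qed (use s in auto)
        finally show ?thesis by (simp add: exp_of_real[symmetric])
      qed
      have "norm (L_term s a z - of_real (exp (- s)) * k2 a z) \<le>
          exp (2 * pi * \<bar>Im z\<bar>) * exp (2 * d * norm z) * rho a s + norm (k2 a z) * (3 * exp (d * norm z) * (s * (1 + norm z)))"
        if a: "0 < a" for a
      proof -
        have "exp (- s * a) * (1 + s * a) \<le> exp (- s * a) * exp (s * a)" by (intro mult_left_mono exp_ge_add_one_self) auto
        hence r0: "0 \<le> rho a s" by (simp add: rho_def flip: exp_add)
        have "L_term s a z - of_real (exp (- s)) * k2 a z = (L_term s a z - k2 a z * exp (- of_real s * z)) + k2 a z * (exp (- of_real s * z) - of_real (exp (- s)))"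
          by (simp add: algebra_simps)
        also have "norm \<dots> \<le> norm (L_term s a z - k2 a z * exp (- of_real s * z)) + norm (k2 a z) * norm (exp (- of_real s * z) - of_real (exp (- s)))"
          by (rule order.trans[OF norm_triangle_ineq]) (simp add: norm_mult)
        also have "\<dots> \<le> exp (2 * pi * \<bar>Im z\<bar>) * (exp (2 * s * norm z) * rho a s) + norm (k2 a z) * (3 * exp (d * norm z) * (s * (1 + norm z)))"
          by (intro add_mono mult_left_mono L_term_approx s a ez) auto
        also have "exp (2 * pi * \<bar>Im z\<bar>) * (exp (2 * s * norm z) * rho a s) \<le> exp (2 * pi * \<bar>Im z\<bar>) * (exp (2 * d * norm z) * rho a s)"
          using s r0 by (intro mult_left_mono mult_right_mono) (auto intro!: mult_right_mono)
        finally show ?thesis by (simp add: mult.assoc)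
      qed
      hence "(\<Sum>j\<le>N. norm (L_term s (real j + 1/2) z - of_real (exp (- s)) * k2 (real j + 1/2) z)) \<le>
        (\<Sum>j\<le>N. exp (2 * pi * \<bar>Im z\<bar>) * exp (2 * d * norm z) * rho (real j + 1/2) s + norm (k2 (real j + 1/2) z) * (3 * exp (d * norm z) * (s * (1 + norm z))))"
        by (intro sum_mono) auto
      also have "\<dots> = exp (2 * pi * \<bar>Im z\<bar>) * exp (2 * d * norm z) * (\<Sum>j\<le>N. rho (real j + 1/2) s)
          + (\<Sum>j\<le>N. norm (k2 (real j + 1/2) z)) * (3 * exp (d * norm z) * (s * (1 + norm z)))"
        by (simp add: sum.distrib sum_distrib_left sum_distrib_right)
      also have "\<dots> \<le> exp (2 * pi * \<bar>Im z\<bar>) * exp (2 * d * norm z) * s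
          + (C0 * (1 + (norm z)\<^sup>2) * exp (2 * pi * \<bar>Im z\<bar>)) * (3 * exp (d * norm z) * (s * (1 + norm z)))"
        using s by (intro add_mono mult_left_mono mult_right_mono rho_sum_le kb) auto
      also have "(C0 * (1 + (norm z)\<^sup>2) * exp (2 * pi * \<bar>Im z\<bar>)) * (3 * exp (d * norm z) * (s * (1 + norm z)))
         = (3 * s * C0 * exp (2 * pi * \<bar>Im z\<bar>) * exp (d * norm z)) * ((1 + (norm z)\<^sup>2) * (1 + norm z))"
        by (simp add: mult_ac)
      also have "\<dots> \<le> (3 * s * C0 * exp (2 * pi * \<bar>Im z\<bar>) * exp (d * norm z)) * (M * exp (d * norm z))"
        using s C0 by (intro mult_left_mono cube') auto
      also have "\<dots> = s * (C0 * 3 * M) * (exp (2 * pi * \<bar>Im z\<bar>) * (exp (d * norm z) * exp (d * norm z)))"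
        by (simp add: mult_ac)
      also have "exp (d * norm z) * exp (d * norm z) = exp (2 * d * norm z)" by (simp flip: exp_add)
      finally show ?thesis by (simp add: algebra_simps)
    qed
    define D where "D = (\<lambda>j z. L_term s (real j + 1/2) z - of_real (exp (- s)) * k2 (real j + 1/2) z)"
    have "L_sum N s z - of_real (exp (- s)) * K_sum N z = (\<Sum>j\<le>N. D j z + D j (- z))"
      unfolding L_sum_def K_sum_def sum_distrib_left D_def
      by (subst sum_subtractf[symmetric]) (simp add: algebra_simps)
    hence "norm (L_sum N s z - of_real (exp (- s)) * K_sum N z) \<le> (\<Sum>j\<le>N. norm (D j z) + norm (D j (- z)))"
      by (simp only:) (rule order.trans[OF norm_sum sum_mono[OF norm_triangle_ineq]])
    also have "\<dots> = (\<Sum>j\<le>N. norm (D j z)) + (\<Sum>j\<le>N. norm (D j (- z)))" by (rule sum.distrib)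
    also have "\<dots> \<le> s * (1 + C0 * 3 * M) * (exp (2 * pi * \<bar>Im z\<bar>) * exp (2 * d * norm z)) + s * (1 + C0 * 3 * M) * (exp (2 * pi * \<bar>Im z\<bar>) * exp (2 * d * norm z))"
      using half[of z] half[of "-z"] unfolding D_def by (intro add_mono) (simp_all only: norm_minus_cancel abs_minus_cancel uminus_complex.sel)
    also have "\<dots> = 2 * s * (1 + C0 * 3 * M) * (exp (2 * pi * \<bar>Im z\<bar>) * exp (2 * d * norm z))" by simp
    also have "\<dots> \<le> 2 * (2 * (s / (1 + s\<^sup>2))) * (1 + C0 * 3 * M) * exp ((2 * pi + \<epsilon>) * norm z)"
    proof (rule mult_mono[OF mult_mono[OF _ order.refl] Y])
      have "s * s \<le> 1 * 1" using s d by (intro mult_mono) auto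
      hence "s * (1 + s\<^sup>2) \<le> s * 2" using s by (intro mult_left_mono) (auto simp: power2_eq_square)
      thus "2 * s \<le> 2 * (2 * (s / (1 + s\<^sup>2)))" by (simp add: field_simps add_pos_nonneg)
    qed (use s C0 M in auto)
    finally show ?thesis by (simp add: C1_def mult_ac)
  qed
  have large: "norm (L_sum N s z - of_real (exp (- s)) * K_sum N z) \<le> C2 * (s / (1 + s\<^sup>2)) * exp ((2 * pi + \<epsilon>) * norm z)"
    if s: "d \<le> s" for N s z
  proof -
    have s0: "0 < s" using s d by simp
    define E where "E = (1 + s) * exp (- s / 2)"
    \<comment> \<open>\<open>343\<close> is \<open>(1 + 3 / (1/2)) ^ 3\<close> from
      \<open>one_plus_power_le_exp\<close>. The division by \<open>d\<close> pays for the factor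
      \<open>s / d \<ge> 1\<close> that produces the numerator of the weight.\<close>
    have E: "E \<le> (343 / d) * (s / (1 + s\<^sup>2))"
    proof -
      have "(1 + s) ^ 3 \<le> 343 * exp (s / 2)" using one_plus_power_le_exp[of "1/2" s] s0 by simp
      hence "(1 + s) ^ 3 * exp (- s / 2) \<le> 343 * exp (s / 2) * exp (- s / 2)" by (intro mult_right_mono) auto
      moreover have "343 * exp (s / 2) * exp (- s / 2) = 343" by (simp add: mult.assoc flip: exp_add)
      moreover have "E * (1 + s)\<^sup>2 = (1 + s) ^ 3 * exp (- s / 2)"
        by (simp only: E_def power3_eq_cube power2_eq_square mult_ac)
      ultimately have "E * (1 + s)\<^sup>2 \<le> 343" by (simp only:)
      moreover have "E * (1 + s\<^sup>2) \<le> E * (1 + s)\<^sup>2"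
        using s0 by (intro mult_left_mono) (auto simp: E_def power2_sum)
      ultimately have "E * (1 + s\<^sup>2) \<le> 343" by simp
      also have "343 \<le> 343 * (s / d)" using s d by (simp add: le_divide_eq)
      finally have "E \<le> 343 * (s / d) / (1 + s\<^sup>2)" by (simp only: pos_le_divide_eq add_pos_nonneg zero_less_one zero_le_power2)
      also have "\<dots> = (343 / d) * (s / (1 + s\<^sup>2))" by simp
      finally show ?thesis .
    qed
    have E0: "0 \<le> E" using s0 by (simp add: E_def)
    have "norm (L_sum N s z) \<le> 2 * ((1 + s) * (exp (- s / 2) / (1 - exp (- s)))) * exp (2 * pi * \<bar>Im z\<bar>)"
      by (rule norm_L_sum_le[OF s0])
    also have "\<dots> = E * (2 / (1 - exp (- s))) * exp (2 * pi * \<bar>Im z\<bar>)" by (simp add: E_def)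
    also have "\<dots> \<le> E * (2 / (1 - exp (- d))) * exp (2 * pi * \<bar>Im z\<bar>)"
      using s d s0 E0 by (intro mult_right_mono mult_left_mono divide_left_mono mult_pos_pos) auto
    also have "\<dots> \<le> E * (2 / (1 - exp (- d))) * (exp (2 * pi * \<bar>Im z\<bar>) * exp (2 * d * norm z))"
      using d E0 by (intro mult_left_mono) (auto simp: mult_le_cancel_left1)
    finally have 1: "norm (L_sum N s z) \<le> E * (2 / (1 - exp (- d))) * (exp (2 * pi * \<bar>Im z\<bar>) * exp (2 * d * norm z))" .
    have "norm (of_real (exp (- s)) * K_sum N z) = exp (- s) * norm (K_sum N z)" by (simp add: norm_mult)
    also have "\<dots> \<le> E * (C0 * (1 + (norm z)\<^sup>2) * exp (2 * pi * \<bar>Im z\<bar>))"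
    proof (intro mult_mono Kb)
      have "1 * exp (- s) \<le> (1 + s) * exp (- s / 2)" using s0 by (intro mult_mono) auto
      thus "exp (- s) \<le> E" by (simp add: E_def)
    qed (use E0 in auto)
    also have "\<dots> \<le> E * (C0 * (M * exp (2 * d * norm z)) * exp (2 * pi * \<bar>Im z\<bar>))"
    proof (intro mult_left_mono mult_right_mono)
      have "M * exp (d * norm z) \<le> M * exp (2 * d * norm z)" using M d by (intro mult_left_mono) (auto intro!: mult_right_mono)
      with cube'(1)[of z] show "1 + (norm z)\<^sup>2 \<le> M * exp (2 * d * norm z)" by linarith
    qed (use E0 C0 in auto)
    also have "\<dots> = E * (C0 * M) * (exp (2 * pi * \<bar>Im z\<bar>) * exp (2 * d * norm z))" by (simp add: mult_ac)
    finally have 2: "norm (of_real (exp (- s)) * K_sum N z) \<le> \<dots>" .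
    have "norm (L_sum N s z - of_real (exp (- s)) * K_sum N z) \<le>
       E * (2 / (1 - exp (- d)) + C0 * M) * (exp (2 * pi * \<bar>Im z\<bar>) * exp (2 * d * norm z))"
      using order.trans[OF norm_triangle_ineq4 add_mono[OF 1 2]] by (simp only: distrib_left distrib_right)
    also have "\<dots> \<le> ((343 / d) * (s / (1 + s\<^sup>2))) * (2 / (1 - exp (- d)) + C0 * M) * exp ((2 * pi + \<epsilon>) * norm z)"
      by (intro mult_mono E Y) (use s0 d C0 M in auto)
    finally show ?thesis by (simp only: C2_def mult_ac)
  qed
  have "norm (L_sum N s z - of_real (exp (- s)) * K_sum N z) \<le> (C1 + C2) * (s / (1 + s\<^sup>2)) * exp ((2 * pi + \<epsilon>) * norm z)"
    if s: "0 < s" for N s z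
  proof -
    have "C1 * (s / (1 + s\<^sup>2)) * exp ((2 * pi + \<epsilon>) * norm z) \<le> (C1 + C2) * (s / (1 + s\<^sup>2)) * exp ((2 * pi + \<epsilon>) * norm z)"
      "C2 * (s / (1 + s\<^sup>2)) * exp ((2 * pi + \<epsilon>) * norm z) \<le> (C1 + C2) * (s / (1 + s\<^sup>2)) * exp ((2 * pi + \<epsilon>) * norm z)"
      by (intro mult_right_mono; use C1 C2 s in simp)+
    thus ?thesis using small[OF s, of N z] large[of s N z] by linarith
  qed
  thus ?thesis using that[of "C1 + C2"] C1 C2 by simp
qed

text \<open>Since \<open>K_sum\<close> tends to 1, the estimate for the partial sums survives the
  limit. It makes the integral defining \<open>G\<close> converge and gives its exponential
  type.\<close>

lemma L_minus_exp_le: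
  assumes "0 < \<epsilon>"
  obtains C where "0 < C" "\<And>s z. 0 < s \<Longrightarrow>
    norm (L s z - of_real (exp (- s))) \<le> C * (s / (1 + s\<^sup>2)) * exp ((2 * pi + \<epsilon>) * norm z)"
proof -
  obtain C where C: "0 < C" "\<And>N s z. 0 < s \<Longrightarrow>
    norm (L_sum N s z - of_real (exp (- s)) * K_sum N z) \<le> C * (s / (1 + s\<^sup>2)) * exp ((2 * pi + \<epsilon>) * norm z)"
    by (rule L_sum_minus_K_sum_le[OF assms]) (rule that)
  have "norm (L s z - of_real (exp (- s))) \<le> C * (s / (1 + s\<^sup>2)) * exp ((2 * pi + \<epsilon>) * norm z)" if s: "0 < s" for s z
  proof -
    have "(\<lambda>N. norm (L_sum N s z - of_real (exp (- s)) * K_sum N z)) \<longlonglongrightarrow> norm (L s z - of_real (exp (- s)) * 1)"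
      by (intro tendsto_intros L_sum_tendsto K_sum_tendsto s)
    from tendsto_upperbound[OF this, of "C * (s / (1 + s\<^sup>2)) * exp ((2 * pi + \<epsilon>) * norm z)"] show ?thesis
      using C(2)[OF s] by simp
  qed
  thus ?thesis using that C by blast
qed

lemma csinc_of_real: "csinc (of_real x) \<in> \<real>"
proof -
  have "csinc (of_real x) = of_real (if x = 0 then 1 else sin (pi * x) / (pi * x))"
    by (simp add: csinc_def flip: sin_of_real)
  thus ?thesis by (simp only: Reals_of_real)
qed

lemma k2_of_real: "k2 a (of_real x) \<in> \<real>" and k1_of_real: "k1 a (of_real x) \<in> \<real>"
  using csinc_of_real[of "x - a"] by (simp_all add: k1_def k2_def Reals_mult Reals_power)

lemma L_sum_of_real: "L_sum N s (of_real x) \<in> \<real>"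
  unfolding L_sum_def L_term_def of_real_minus[symmetric]
  by (intro sum_in_Reals Reals_add Reals_mult Reals_diff Reals_of_real k2_of_real k1_of_real)

lemma L_of_real: "0 < s \<Longrightarrow> L s (of_real x) \<in> \<real>"
  by (rule closed_sequentially[OF closed_complex_Reals _ L_sum_tendsto]) (auto intro: L_sum_of_real)

section \<open>The function \<open>H\<close> and the difference between the exponential and
  \<open>L\<close>\<close>

text \<open>Beware that \<open>H 0 = 0\<close>, although the limit of \<open>H\<close> at 0 is 1.\<close>

definition H :: "real \<Rightarrow> real" where "H u = u / (2 * sinh (u / 2))"

lemma H_minus [simp]: "H (- u) = H u" by (simp add: H_def)

lemma H_abs: "H \<bar>u\<bar> = H u" by (cases "0 \<le> u") auto

text \<open>A geometric series in \<open>exp (- \<bar>u\<bar>)\<close>. At \<open>u = 0\<close> all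
  its terms vanish, so the value \<open>H 0 = 0\<close> lets the expansion hold without
  exception.\<close>

lemma sums_H:
  "(\<lambda>j. \<bar>u\<bar> * exp (- \<bar>u\<bar> * (real j + 1/2))) sums H u"
proof (cases "u = 0")
  case True
  thus ?thesis by (simp add: H_def)
next
  case False
  define v where "v = \<bar>u\<bar>"
  have v: "0 < v" using False by (simp add: v_def)
  have "(\<lambda>j. v * exp (- v * (real j + 1/2))) sums (v * (exp (- v / 2) / (1 - exp (- v))))"
    by (intro sums_mult sums_exp_half_integer v)
  also have "v * (exp (- v / 2) / (1 - exp (- v))) = H v"
  proof -
    have "1 - exp (- v) = exp (- v / 2) * (exp (v / 2) - exp (- v / 2))"
      by (simp add: algebra_simps flip: exp_add)
    moreover have "2 * sinh (v / 2) = exp (v / 2) - exp (- v / 2)" by (simp add: sinh_field_def)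
    ultimately show ?thesis by (simp add: H_def)
  qed
  finally show ?thesis by (simp only: v_def H_abs)
qed

lemma deriv_nonneg_imp_ge_0:
  fixes f g :: "real \<Rightarrow> real"
  assumes "0 \<le> y" "f 0 = 0" "\<And>x. 0 \<le> x \<Longrightarrow> (f has_real_derivative g x) (at x)" "\<And>x. 0 \<le> x \<Longrightarrow> 0 \<le> g x"
  shows "0 \<le> f y"
  using DERIV_nonneg_imp_nondecreasing[of 0 y f] assms by auto

lemma sinh_ge_cubic: "y + y ^ 3 / 6 \<le> sinh y" if "0 \<le> (y::real)"
proof -
  have 1: "0 \<le> sinh x - x" if "0 \<le> x" for x :: real
    by (rule deriv_nonneg_imp_ge_0[where f = "\<lambda>x. sinh x - x" and g = "\<lambda>x. cosh x - 1", OF that])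
      (auto intro!: derivative_eq_intros simp: cosh_real_ge_1)
  have 2: "0 \<le> cosh x - 1 - x\<^sup>2 / 2" if "0 \<le> x" for x :: real
    by (rule deriv_nonneg_imp_ge_0[where f = "\<lambda>x. cosh x - 1 - x\<^sup>2 / 2" and g = "\<lambda>x. sinh x - x", OF that])
      (use 1 in \<open>auto intro!: derivative_eq_intros\<close>)
  have "0 \<le> sinh y - y - y ^ 3 / 6"
    by (rule deriv_nonneg_imp_ge_0[where f = "\<lambda>x. sinh x - x - x ^ 3 / 6" and g = "\<lambda>x. cosh x - 1 - x\<^sup>2 / 2", OF that])
      (use 2 in \<open>auto intro!: derivative_eq_intros\<close>)
  thus ?thesis by simp
qed

text \<open>The combination \<open>y * cosh y - sinh y\<close> is the numerator in the derivative of
  \<open>H\<close>.\<close>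

lemma mult_cosh_bounds:
  assumes "0 \<le> (y::real)"
  shows "0 \<le> y * cosh y - sinh y" "y * cosh y - sinh y \<le> y\<^sup>2 * sinh y"
proof -
  show "0 \<le> y * cosh y - sinh y"
    by (rule deriv_nonneg_imp_ge_0[where f = "\<lambda>x. x * cosh x - sinh x" and g = "\<lambda>x. x * sinh x", OF assms])
      (auto intro!: derivative_eq_intros)
  have "0 \<le> y\<^sup>2 * sinh y - (y * cosh y - sinh y)"
    by (rule deriv_nonneg_imp_ge_0[where f = "\<lambda>x. x\<^sup>2 * sinh x - (x * cosh x - sinh x)" and g = "\<lambda>x. x * sinh x + x\<^sup>2 * cosh x", OF assms])
      (auto intro!: derivative_eq_intros)
  thus "y * cosh y - sinh y \<le> y\<^sup>2 * sinh y" by simp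
qed

definition H' :: "real \<Rightarrow> real" where
  "H' u = - (u / 2 * cosh (u / 2) - sinh (u / 2)) / (2 * (sinh (u / 2))\<^sup>2)"

lemma H_deriv: "(H has_real_derivative H' u) (at u)" if "0 < u"
proof -
  have "sinh (u / 2) \<noteq> 0" using that by simp
  thus ?thesis unfolding H_def H'_def
    by (auto intro!: derivative_eq_intros simp: field_simps power2_eq_square)
qed

text \<open>The cubic term of \<open>sinh\<close> provides the decay: in terms of
  \<open>u = 2 * y\<close> the last quotient is \<open>6 * u / (24 + u\<^sup>2)\<close>, whence the
  6.\<close>

lemma H'_bounds:
  assumes "0 < u"
  shows "H' u \<le> 0" "- H' u \<le> 6 * (u / (1 + u\<^sup>2))"
proof -
  define y where "y = u / 2"
  have y: "0 < y" "u = 2 * y" using assms by (auto simp: y_def)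
  have s: "0 < sinh y" using y by simp
  show "H' u \<le> 0" unfolding H'_def y_def[symmetric]
    using mult_cosh_bounds(1)[of y] y by (intro divide_nonpos_nonneg) auto
  have "- H' u = (y * cosh y - sinh y) / (2 * (sinh y)\<^sup>2)"
    by (simp only: H'_def y_def[symmetric] minus_divide_left minus_minus)
  also have "\<dots> \<le> y\<^sup>2 * sinh y / (2 * (sinh y)\<^sup>2)"
    using mult_cosh_bounds(2)[of y] y by (intro divide_right_mono) auto
  also have "\<dots> = y\<^sup>2 / (2 * sinh y)" using s by (simp add: power2_eq_square)
  also have "\<dots> \<le> y\<^sup>2 / (2 * (y + y ^ 3 / 6))"
    using sinh_ge_cubic[of y] y s by (intro divide_left_mono mult_left_mono mult_pos_pos add_pos_pos) auto
  also have "\<dots> \<le> 6 * (u / (1 + u\<^sup>2))"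
    unfolding y(2) using y by (simp add: divide_simps power2_eq_square power3_eq_cube add_pos_pos) (simp add: algebra_simps)
  finally show "- H' u \<le> 6 * (u / (1 + u\<^sup>2))" .
qed

lemma H_le_1: "H u \<le> 1" and H_nonneg: "0 \<le> H u"
proof -
  have "H v \<le> 1 \<and> 0 \<le> H v" if "0 \<le> v" for v
  proof (cases "v = 0")
    case False
    hence v: "0 < v" using that by simp
    have "0 \<le> (v / 2) ^ 3 / 6" using v by simp
    hence "v \<le> 2 * sinh (v / 2)" using sinh_ge_cubic[of "v / 2"] v by linarith
    thus ?thesis using v by (simp add: H_def)
  qed (simp add: H_def)
  from this[of "\<bar>u\<bar>"] show "H u \<le> 1" "0 \<le> H u" by (auto simp: H_abs)
qed

text \<open>\<open>H\<close> decreases in \<open>\<bar>u\<bar>\<close>, and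
  \<open>(s + w)\<^sup>2 - (s - w)\<^sup>2 = 4 * s * w\<close>, so comparing \<open>H\<close> with a
  multiple of \<open>u\<^sup>2\<close> gives a bound proportional to both \<open>s\<close> and
  \<open>w\<close>. At \<open>w = s\<close> the value \<open>H 0 = 0\<close> would break the
  monotonicity.\<close>

lemma H_diff_bounds:
  assumes s: "0 < s" and w: "0 < w" and ne: "w \<noteq> s"
  shows "0 \<le> H (s - w) - H (s + w)" "H (s - w) - H (s + w) \<le> 100 * (s / (1 + s\<^sup>2)) * w"
proof -
  define v where "v = \<bar>s - w\<bar>"
  have v: "0 < v" "v < s + w" using assms by (auto simp: v_def)
  have HE: "H (s - w) - H (s + w) = H v - H (s + w)" by (simp add: v_def H_abs)
  have sq: "(s + w)\<^sup>2 - v\<^sup>2 = 4 * s * w" by (simp add: v_def power2_eq_square algebra_simps)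
  show "0 \<le> H (s - w) - H (s + w)"
  proof -
    have "- H v \<le> - H (s + w)"
    proof (rule DERIV_nonneg_imp_nondecreasing[of v "s + w" "\<lambda>u. - H u"])
      fix u assume "v \<le> u"
      hence "0 < u" using v by simp
      thus "\<exists>y. ((\<lambda>u. - H u) has_real_derivative y) (at u) \<and> 0 \<le> y"
        using DERIV_minus[OF H_deriv] H'_bounds(1) by (intro exI[of _ "- H' u"]) auto
    qed (use v in simp)
    thus ?thesis unfolding HE by simp
  qed
  \<comment> \<open>Where \<open>1 / (1 + u\<^sup>2) \<le> B\<close>, the function
    \<open>H u + 3 * B * u\<^sup>2\<close> is nondecreasing, because
    \<open>- H' u \<le> 6 * u * B\<close>.\<close>
  have main: "H v - H (s + w) \<le> 6 * B * (2 * s * w)"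
    if B: "\<And>u. v \<le> u \<Longrightarrow> 1 / (1 + u\<^sup>2) \<le> B" for B
  proof -
    have "H v + 3 * B * v\<^sup>2 \<le> H (s + w) + 3 * B * (s + w)\<^sup>2"
    proof (rule DERIV_nonneg_imp_nondecreasing[of v "s + w" "\<lambda>u. H u + 3 * B * u\<^sup>2"])
      fix u assume u: "v \<le> u" "u \<le> s + w"
      have u0: "0 < u" using u v by simp
      have "- H' u \<le> 6 * u * (1 / (1 + u\<^sup>2))" using H'_bounds(2)[OF u0] by simp
      also have "\<dots> \<le> 6 * u * B" using B[OF u(1)] u0 by (intro mult_left_mono) auto
      finally have "0 \<le> H' u + 6 * B * u" by (simp add: mult_ac)
      moreover have "((\<lambda>u. H u + 3 * B * u\<^sup>2) has_real_derivative H' u + 6 * B * u) (at u)"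
        by (auto intro!: derivative_eq_intros H_deriv u0)
      ultimately show "\<exists>y. ((\<lambda>u. H u + 3 * B * u\<^sup>2) has_real_derivative y) (at u) \<and> 0 \<le> y" by blast
    qed (use v in simp)
    hence "H v - H (s + w) \<le> 3 * B * ((s + w)\<^sup>2 - v\<^sup>2)" by (simp add: algebra_simps)
    thus ?thesis unfolding sq by (simp add: mult_ac)
  qed
  have fr: "0 < s / (1 + s\<^sup>2)" using s by (simp add: add_pos_nonneg)
  \<comment> \<open>For \<open>s \<le> 1\<close> take \<open>B = 1\<close>. If
    \<open>w \<ge> s / 2\<close>, the claimed bound is at least 1, which exceeds \<open>H\<close>.
    If \<open>w < s / 2\<close>, all arguments are at least \<open>s / 2\<close>, which allows
    \<open>B = 4 / (1 + s\<^sup>2)\<close>.\<close>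
  consider "s \<le> 1" | "1 < s" "s / 2 \<le> w" | "1 < s" "w < s / 2" by linarith
  thus "H (s - w) - H (s + w) \<le> 100 * (s / (1 + s\<^sup>2)) * w"
  proof cases
    case 1
    have "H v - H (s + w) \<le> 6 * 1 * (2 * s * w)" by (rule main) (simp add: add_pos_nonneg divide_le_eq)
    also have "\<dots> = 12 * s * w" by simp
    also have "s \<le> 2 * (s / (1 + s\<^sup>2))"
    proof -
      have "s * s \<le> 1 * 1" using s 1 by (intro mult_mono) auto
      hence "s * (1 + s\<^sup>2) \<le> s * 2" using s by (intro mult_left_mono) (auto simp: power2_eq_square)
      thus ?thesis by (simp add: field_simps add_pos_nonneg)
    qed
    hence "12 * s * w \<le> 12 * (2 * (s / (1 + s\<^sup>2))) * w" using w by (intro mult_right_mono mult_left_mono) auto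
    also have "12 * (2 * (s / (1 + s\<^sup>2))) * w = 24 * ((s / (1 + s\<^sup>2)) * w)" by (simp only: mult.assoc)
    also have "\<dots> \<le> 100 * ((s / (1 + s\<^sup>2)) * w)" using mult_pos_pos[OF fr w] by linarith
    also have "\<dots> = 100 * (s / (1 + s\<^sup>2)) * w" by (simp only: mult.assoc)
    finally show ?thesis unfolding HE .
  next
    case 2
    have "1 \<le> s * s" using 2 mult_mono[of 1 s 1 s] by simp
    hence "1 + s\<^sup>2 \<le> 2 * (s * s)" by (simp add: power2_eq_square)
    also have "2 * (s * s) \<le> 2 * (s * (2 * w))" using 2 s by (intro mult_left_mono) auto
    finally have "1 \<le> 4 * (s / (1 + s\<^sup>2)) * w" by (simp add: field_simps add_pos_nonneg)
    hence "1 \<le> 100 * (s / (1 + s\<^sup>2)) * w" using fr w by (smt (verit) mult_right_mono)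
    thus ?thesis using H_le_1[of "s - w"] H_nonneg[of "s + w"] by linarith
  next
    case 3
    have "H v - H (s + w) \<le> 6 * (4 / (1 + s\<^sup>2)) * (2 * s * w)"
    proof (rule main)
      fix u assume u: "v \<le> u"
      have "s / 2 \<le> v" using 3 by (simp add: v_def)
      hence "(s / 2)\<^sup>2 \<le> u\<^sup>2" using u s by (intro power_mono) auto
      hence "1 + s\<^sup>2 \<le> 4 * (1 + u\<^sup>2)" by (simp add: power_divide)
      thus "1 / (1 + u\<^sup>2) \<le> 4 / (1 + s\<^sup>2)" by (simp add: field_simps add_pos_nonneg)
    qed
    also have "\<dots> = 48 * (s / (1 + s\<^sup>2)) * w" by simp
    also have "\<dots> \<le> 100 * (s / (1 + s\<^sup>2)) * w" using fr w by (intro mult_right_mono) auto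
    finally show ?thesis unfolding HE .
  qed
qed

lemma has_bochner_integral_exp_linear:
  assumes "0 < b" "c \<le> d"
  shows "has_bochner_integral lborel (\<lambda>w::real. indicator {d..} w *\<^sub>R ((w - c) * exp (- b * w)))
           (exp (- b * d) * ((d - c) / b + 1 / b\<^sup>2))"
proof -
  define F where "F = (\<lambda>w. - (exp (- b * w) * ((w - c) / b + 1 / b\<^sup>2)))"
  have "has_bochner_integral lborel (\<lambda>w::real. indicator {d..} w *\<^sub>R ((w - c) * exp (- b * w))) (0 - F d)"
  proof (rule integral_FTC_atLeast_nonneg)
    show "(F has_real_derivative (w - c) * exp (- b * w)) (at w)" for w
      unfolding F_def using assms by (auto intro!: derivative_eq_intros simp: field_simps power2_eq_square)
    show "(F \<longlongrightarrow> 0) at_top" unfolding F_def using assms by real_asymp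
  qed (use assms in auto)
  thus ?thesis by (simp add: F_def)
qed

lemma has_bochner_integral_exp_linear_Icc:
  assumes "b \<noteq> 0" "0 \<le> s"
  shows "has_bochner_integral lborel (\<lambda>w::real. indicator {0..s} w *\<^sub>R ((s - w) * exp (b * w)))
           (exp (b * s) / b\<^sup>2 - s / b - 1 / b\<^sup>2)"
proof -
  define F where "F = (\<lambda>w. exp (b * w) * ((s - w) / b + 1 / b\<^sup>2))"
  have "has_bochner_integral lborel (\<lambda>w. indicator {0..s} w *\<^sub>R ((s - w) * exp (b * w))) (F s - F 0)"
  proof (rule has_bochner_integral_FTC_Icc[OF assms(2)])
    have "(F has_real_derivative (s - w) * exp (b * w)) (at w within A)" for w A
      unfolding F_def using assms by (auto intro!: derivative_eq_intros simp: field_simps power2_eq_square)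
    thus "(F has_vector_derivative (s - w) * exp (b * w)) (at w within {0..s})" for w
      by (simp add: has_real_derivative_iff_has_vector_derivative)
  qed (intro continuous_intros)
  thus ?thesis by (simp add: F_def diff_diff_eq)
qed

lemma summable_k2: "summable (\<lambda>j. norm (k2 (real j + 1/2) z))"
proof -
  obtain C where "\<And>z N. (\<Sum>j\<le>N. norm (k2 (real j + 1/2) z)) \<le> C * (1 + (norm z)\<^sup>2) * exp (2 * pi * \<bar>Im z\<bar>)"
    by (rule K_sum_bound) (rule that)
  hence "(\<Sum>j<N. norm (k2 (real j + 1/2) z)) \<le> C * (1 + (norm z)\<^sup>2) * exp (2 * pi * \<bar>Im z\<bar>)" for N
    using sum_mono2[of "{..N}" "{..<N}" "\<lambda>j. norm (k2 (real j + 1/2) z)"] by (meson finite_atMost lessThan_subset_iff norm_ge_zero order.trans subsetI atMost_iff lessThan_iff less_imp_le)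
  thus ?thesis by (intro summableI_nonneg_bounded) auto
qed

text \<open>Termwise integration of the exponential series of \<open>H\<close>.\<close>

lemma exp_minus_L_integral:
  assumes s: "0 < s" and x: "0 < x" and cx: "cos (pi * x) \<noteq> 0"
  defines "K \<equiv> (cos (pi * x) / pi)\<^sup>2"
  shows "integrable lborel (\<lambda>w. indicator {0..} w *\<^sub>R ((H (s - w) - H (s + w)) * exp (- w * x)))"
    and "exp (- s * x) - Re (L s (of_real x)) =
           K * (\<integral>w. indicator {0..} w *\<^sub>R ((H (s - w) - H (s + w)) * exp (- w * x)) \<partial>lborel)"
proof -
  define a where "a = (\<lambda>j. real j + 1/2)"
  have a: "0 < a j" for j by (simp add: a_def)
  have K: "0 < K" using cx by (simp add: K_def)
  have kk: "K = (x - a j)\<^sup>2 * Re (k2 (a j) (of_real x))" "K = (x + a j)\<^sup>2 * Re (k2 (a j) (- of_real x))"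
    and xa: "x - a j \<noteq> 0" "x + a j \<noteq> 0" for j
  proof -
    have "of_real K = (of_real x - of_real (a j))\<^sup>2 * k2 (a j) (of_real x)"
      using cos_sq_k2[of "of_real x" "int j"] by (simp add: K_def a_def flip: cos_of_real)
    also have "\<dots> = of_real ((x - a j)\<^sup>2 * Re (k2 (a j) (of_real x)))"
      using k2_of_real[of "a j" x] by (simp add: complex_is_Real_iff complex_eq_iff)
    finally show 1: "K = (x - a j)\<^sup>2 * Re (k2 (a j) (of_real x))" by (simp only: of_real_eq_iff)
    have "of_real K = (- of_real x - of_real (a j))\<^sup>2 * k2 (a j) (- of_real x)"
      using cos_sq_k2[of "- of_real x" "int j"] by (simp add: K_def a_def flip: cos_of_real)
    also have "\<dots> = of_real ((- x - a j)\<^sup>2 * Re (k2 (a j) (- of_real x)))"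
      using k2_of_real[of "a j" "-x"] by (simp add: complex_is_Real_iff complex_eq_iff)
    finally have "K = (- x - a j)\<^sup>2 * Re (k2 (a j) (- of_real x))" by (simp only: of_real_eq_iff)
    moreover have "(- x - a j)\<^sup>2 = (x + a j)\<^sup>2" by (simp add: power2_eq_square algebra_simps)
    ultimately show 2: "K = (x + a j)\<^sup>2 * Re (k2 (a j) (- of_real x))" by simp
    show "x - a j \<noteq> 0" "x + a j \<noteq> 0" using 1 2 K by auto
  qed
  \<comment> \<open>\<open>I1\<close> and \<open>I2\<close> are the integrals of the terms
    \<open>f1\<close> of \<open>H (s - w)\<close> and \<open>f2\<close> of \<open>H (s + w)\<close>.
    The part of \<open>I1\<close> over \<open>w < s\<close> has denominators \<open>x - a j\<close>,
    nonzero since the cosine does not vanish at \<open>x\<close>.\<close>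
  define I1 where "I1 = (\<lambda>j. exp (- s * x) / (x + a j)\<^sup>2 + exp (- s * x) / (x - a j)\<^sup>2 - exp (- s * a j) * (1 / (x - a j)\<^sup>2 - s / (x - a j)))"
  define I2 where "I2 = (\<lambda>j. exp (- s * a j) * (s / (x + a j) + 1 / (x + a j)\<^sup>2))"
  define f1 where "f1 = (\<lambda>j w. indicator {0..} w *\<^sub>R ((\<bar>s - w\<bar> * exp (- \<bar>s - w\<bar> * a j)) * exp (- w * x)))"
  define f2 where "f2 = (\<lambda>j w. indicator {0..} w *\<^sub>R ((\<bar>s + w\<bar> * exp (- \<bar>s + w\<bar> * a j)) * exp (- w * x)))"
  have h1: "has_bochner_integral lborel (f1 j) (I1 j)" for j
  proof -
    define b where "b = a j - x"
    have b: "b \<noteq> 0" using xa(1)[of j] by (auto simp: b_def)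
    have "has_bochner_integral lborel (\<lambda>w. exp (- s * a j) * (indicator {0..s} w *\<^sub>R ((s - w) * exp (b * w)))
        + exp (s * a j) * (indicator {s..} w *\<^sub>R ((w - s) * exp (- (x + a j) * w))))
       (exp (- s * a j) * (exp (b * s) / b\<^sup>2 - s / b - 1 / b\<^sup>2) + exp (s * a j) * (exp (- (x + a j) * s) * ((s - s) / (x + a j) + 1 / (x + a j)\<^sup>2)))"
      using b s x a[of j] by (intro has_bochner_integral_add has_bochner_integral_mult_right
          has_bochner_integral_exp_linear_Icc has_bochner_integral_exp_linear) auto
    also have "(\<lambda>w. exp (- s * a j) * (indicator {0..s} w *\<^sub>R ((s - w) * exp (b * w)))
        + exp (s * a j) * (indicator {s..} w *\<^sub>R ((w - s) * exp (- (x + a j) * w)))) = f1 j"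
    proof
      fix w
      consider "w < 0" | "0 \<le> w" "w < s" | "w = s" | "s < w" by linarith
      thus "exp (- s * a j) * (indicator {0..s} w *\<^sub>R ((s - w) * exp (b * w)))
        + exp (s * a j) * (indicator {s..} w *\<^sub>R ((w - s) * exp (- (x + a j) * w))) = f1 j w"
      proof cases
        case 2
        have "exp (- s * a j) * exp (b * w) = exp (- (s - w) * a j) * exp (- w * x)"
          by (simp add: b_def algebra_simps flip: exp_add)
        moreover have "f1 j w = (s - w) * (exp (- (s - w) * a j) * exp (- w * x))"
        proof -
          have ab: "\<bar>s - w\<bar> = s - w" using 2 by simp
          show ?thesis unfolding f1_def ab using 2 by (simp add: mult.assoc)
        qed
        ultimately have "(s - w) * (exp (- s * a j) * exp (b * w)) = f1 j w" by (simp only:)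
        thus ?thesis using 2 by (simp add: mult.left_commute)
      next
        case 4
        have "exp (s * a j) * exp (- (x + a j) * w) = exp (- (w - s) * a j) * exp (- w * x)"
          by (simp add: algebra_simps flip: exp_add)
        moreover have "f1 j w = (w - s) * (exp (- (w - s) * a j) * exp (- w * x))"
        proof -
          have ab: "\<bar>s - w\<bar> = w - s" using 4 by simp
          show ?thesis unfolding f1_def ab using 4 s by (simp add: mult.assoc)
        qed
        ultimately have "(w - s) * (exp (s * a j) * exp (- (x + a j) * w)) = f1 j w" by (simp only:)
        thus ?thesis using 4 s by (simp add: mult.left_commute)
      qed (use s in \<open>auto simp: f1_def\<close>)
    qed
    also have "exp (- s * a j) * (exp (b * s) / b\<^sup>2 - s / b - 1 / b\<^sup>2) + exp (s * a j) * (exp (- (x + a j) * s) * ((s - s) / (x + a j) + 1 / (x + a j)\<^sup>2)) = I1 j"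
    proof -
      have e1: "exp (- s * a j) * exp (b * s) = exp (- s * x)" and e2: "exp (s * a j) * exp (- (x + a j) * s) = exp (- s * x)"
        by (simp_all add: b_def algebra_simps flip: exp_add)
      have b': "b\<^sup>2 = (x - a j)\<^sup>2" "s / b = - (s / (x - a j))"
        by (simp_all add: b_def power2_commute) (metis minus_diff_eq minus_divide_right)
      have "exp (- s * a j) * (exp (b * s) / b\<^sup>2 - s / b - 1 / b\<^sup>2) + exp (s * a j) * (exp (- (x + a j) * s) * ((s - s) / (x + a j) + 1 / (x + a j)\<^sup>2))
        = (exp (- s * a j) * exp (b * s)) / b\<^sup>2 - exp (- s * a j) * (s / b + 1 / b\<^sup>2) + (exp (s * a j) * exp (- (x + a j) * s)) / (x + a j)\<^sup>2"
        by (simp add: algebra_simps)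
      also have "\<dots> = I1 j" unfolding e1 e2 b' I1_def by (simp add: algebra_simps)
      finally show ?thesis .
    qed
    finally show ?thesis .
  qed
  have h2: "has_bochner_integral lborel (f2 j) (I2 j)" for j
  proof -
    have "has_bochner_integral lborel (\<lambda>w. exp (- s * a j) * (indicator {0..} w *\<^sub>R ((w - (- s)) * exp (- (x + a j) * w))))
       (exp (- s * a j) * (exp (- (x + a j) * 0) * ((0 - (- s)) / (x + a j) + 1 / (x + a j)\<^sup>2)))"
      using s x a[of j] by (intro has_bochner_integral_mult_right has_bochner_integral_exp_linear) auto
    also have "(\<lambda>w. exp (- s * a j) * (indicator {0..} w *\<^sub>R ((w - (- s)) * exp (- (x + a j) * w)))) = f2 j"
    proof
      fix w
      have "exp (- s * a j) * exp (- (x + a j) * w) = exp (- (s + w) * a j) * exp (- w * x)"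
        by (simp add: algebra_simps flip: exp_add)
      thus "exp (- s * a j) * (indicator {0..} w *\<^sub>R ((w - (- s)) * exp (- (x + a j) * w))) = f2 j w"
      proof (cases "0 \<le> w")
        case True
        hence ab: "\<bar>s + w\<bar> = s + w" using s by simp
        have "f2 j w = (s + w) * (exp (- (s + w) * a j) * exp (- w * x))"
          unfolding f2_def ab using True by (simp add: mult.assoc)
        also have "\<dots> = (s + w) * (exp (- s * a j) * exp (- (x + a j) * w))"
          using \<open>exp (- s * a j) * _ = _\<close> by (simp only:)
        finally show ?thesis using True by (simp add: mult.left_commute add.commute)
      qed (simp add: f2_def)
    qed
    also have "exp (- s * a j) * (exp (- (x + a j) * 0) * ((0 - (- s)) / (x + a j) + 1 / (x + a j)\<^sup>2)) = I2 j"
      by (simp add: I2_def)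
    finally show ?thesis .
  qed
  \<comment> \<open>Multiplied by \<open>K\<close>, the integrals of \<open>f1\<close> give the
    kernels of \<open>K_sum\<close> times \<open>exp (- s * x)\<close> less the positive nodes of
    \<open>L_sum\<close>, and those of \<open>f2\<close> give the negative nodes.\<close>
  have T1: "K * I1 j = exp (- s * x) * (Re (k2 (a j) (of_real x)) + Re (k2 (a j) (- of_real x))) - Re (L_term s (a j) (of_real x))"
    and T2: "K * I2 j = Re (L_term s (a j) (- of_real x))" for j
  proof -
    have r: "K / (x - a j)\<^sup>2 = Re (k2 (a j) (of_real x))" "K / (x + a j)\<^sup>2 = Re (k2 (a j) (- of_real x))"
      using kk[of j] xa[of j] by (simp_all add: divide_eq_eq mult.commute)
    have r': "K / (x - a j) = (x - a j) * Re (k2 (a j) (of_real x))" "K / (x + a j) = (x + a j) * Re (k2 (a j) (- of_real x))"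
      using r[symmetric] xa[of j] by (simp_all add: power2_eq_square)
    have L1: "Re (L_term s (a j) (of_real x)) = exp (- s * a j) * (K / (x - a j)\<^sup>2 - s * (K / (x - a j)))"
      unfolding r r' by (simp add: L_term_def k1_def)
    have re: "Re (of_real r * z) = r * Re z" for r and z :: complex by simp
    have k1': "k1 (a j) (- of_real x) = of_real (- (x + a j)) * k2 (a j) (- of_real x)" by (simp add: k1_def)
    have L2: "Re (L_term s (a j) (- of_real x)) = exp (- s * a j) * (K / (x + a j)\<^sup>2 + s * (K / (x + a j)))"
      unfolding r r' by (simp only: L_term_def re minus_complex.sel k1') (simp only: mult_minus_left mult_minus_right diff_minus_eq_add)
    show "K * I1 j = exp (- s * x) * (Re (k2 (a j) (of_real x)) + Re (k2 (a j) (- of_real x))) - Re (L_term s (a j) (of_real x))"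
      unfolding L1 r[symmetric] I1_def by (simp add: algebra_simps)
    show "K * I2 j = Re (L_term s (a j) (- of_real x))"
      unfolding L2 I2_def by (simp add: algebra_simps)
  qed
  have sT: "summable (\<lambda>j. norm (Re (L_term s (a j) z)))" for z
    by (rule summable_comparison_test'[OF summable_L_term[OF s, of z], of 0]) (auto simp: a_def abs_Re_le_cmod)
  have sk: "summable (\<lambda>j. norm (Re (k2 (a j) z)))" for z
    by (rule summable_comparison_test'[OF summable_k2[of z], of 0]) (auto simp: a_def abs_Re_le_cmod)
  note sT' = summable_norm_cancel[OF sT] and sk' = summable_norm_cancel[OF sk]
  have "summable (\<lambda>j. K * I1 j)" unfolding T1
    by (intro summable_diff summable_mult summable_add sT' sk')
  hence sI1: "summable I1" using K by (simp add: summable_mult_D)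
  have "summable (\<lambda>j. K * I2 j)" unfolding T2 by (rule sT')
  hence sI2: "summable I2" using K by (simp add: summable_mult_D)
  \<comment> \<open>The terms are nonnegative, so the absolute convergence needed for termwise
    integration is just the summability of \<open>I1\<close> and \<open>I2\<close>.\<close>
  have n1: "norm (f1 j w) = f1 j w" and n2: "norm (f2 j w) = f2 j w" for j w
    by (auto simp: f1_def f2_def split: split_indicator)
  have S1: "(\<lambda>j. f1 j w) sums (indicator {0..} w *\<^sub>R (H (s - w) * exp (- w * x)))" for w
    unfolding f1_def a_def by (intro sums_scaleR_right sums_mult2 sums_H)
  have S2: "(\<lambda>j. f2 j w) sums (indicator {0..} w *\<^sub>R (H (s + w) * exp (- w * x)))" for w
    unfolding f2_def a_def by (intro sums_scaleR_right sums_mult2 sums_H)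
  have i1: "integrable lborel (f1 j)" "(\<integral>w. f1 j w \<partial>lborel) = I1 j" for j
    using h1[of j] by (auto simp: has_bochner_integral_iff)
  have i2: "integrable lborel (f2 j)" "(\<integral>w. f2 j w \<partial>lborel) = I2 j" for j
    using h2[of j] by (auto simp: has_bochner_integral_iff)
  have A1: "AE w in lborel. summable (\<lambda>j. norm (f1 j w))" "summable (\<lambda>j. \<integral>w. norm (f1 j w) \<partial>lborel)"
    unfolding n1 i1 using sums_summable[OF S1] sI1 by simp_all
  have A2: "AE w in lborel. summable (\<lambda>j. norm (f2 j w))" "summable (\<lambda>j. \<integral>w. norm (f2 j w) \<partial>lborel)"
    unfolding n2 i2 using sums_summable[OF S2] sI2 by simp_all
  have E1: "integrable lborel (\<lambda>w. indicator {0..} w *\<^sub>R (H (s - w) * exp (- w * x)))"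
    "I1 sums (\<integral>w. indicator {0..} w *\<^sub>R (H (s - w) * exp (- w * x)) \<partial>lborel)"
    using integrable_suminf[OF i1(1) A1] sums_integral[OF i1(1) A1] S1 unfolding i1 by (simp_all add: sums_iff)
  have E2: "integrable lborel (\<lambda>w. indicator {0..} w *\<^sub>R (H (s + w) * exp (- w * x)))"
    "I2 sums (\<integral>w. indicator {0..} w *\<^sub>R (H (s + w) * exp (- w * x)) \<partial>lborel)"
    using integrable_suminf[OF i2(1) A2] sums_integral[OF i2(1) A2] S2 unfolding i2 by (simp_all add: sums_iff)
  have feq: "(\<lambda>w. indicator {0..} w *\<^sub>R ((H (s - w) - H (s + w)) * exp (- w * x))) =
     (\<lambda>w. indicator {0..} w *\<^sub>R (H (s - w) * exp (- w * x)) - indicator {0..} w *\<^sub>R (H (s + w) * exp (- w * x)))"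
    by (simp add: fun_eq_iff algebra_simps)
  show "integrable lborel (\<lambda>w. indicator {0..} w *\<^sub>R ((H (s - w) - H (s + w)) * exp (- w * x)))"
    unfolding feq by (intro Bochner_Integration.integrable_diff E1 E2)
  have "(\<lambda>j. K * (I1 j - I2 j)) sums (K * ((\<integral>w. indicator {0..} w *\<^sub>R (H (s - w) * exp (- w * x)) \<partial>lborel) - (\<integral>w. indicator {0..} w *\<^sub>R (H (s + w) * exp (- w * x)) \<partial>lborel)))"
    by (intro sums_mult sums_diff E1 E2)
  hence "(\<lambda>N. \<Sum>j\<le>N. K * (I1 j - I2 j)) \<longlonglongrightarrow> (K * ((\<integral>w. indicator {0..} w *\<^sub>R (H (s - w) * exp (- w * x)) \<partial>lborel) - (\<integral>w. indicator {0..} w *\<^sub>R (H (s + w) * exp (- w * x)) \<partial>lborel)))"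
    by (simp only: sums_def_le)
  moreover have "(\<Sum>j\<le>N. K * (I1 j - I2 j)) = exp (- s * x) * Re (K_sum N (of_real x)) - Re (L_sum N s (of_real x))" for N
    unfolding K_sum_def L_sum_def Re_sum sum_distrib_left sum_subtractf[symmetric]
    by (intro sum.cong refl) (simp add: right_diff_distrib T1 T2, simp add: a_def algebra_simps)
  moreover have "(\<lambda>N. exp (- s * x) * Re (K_sum N (of_real x)) - Re (L_sum N s (of_real x))) \<longlonglongrightarrow> exp (- s * x) * Re 1 - Re (L s (of_real x))"
    by (intro tendsto_intros K_sum_tendsto L_sum_tendsto s)
  ultimately have "exp (- s * x) * Re 1 - Re (L s (of_real x)) = (K * ((\<integral>w. indicator {0..} w *\<^sub>R (H (s - w) * exp (- w * x)) \<partial>lborel) - (\<integral>w. indicator {0..} w *\<^sub>R (H (s + w) * exp (- w * x)) \<partial>lborel)))"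
    by (simp only: LIMSEQ_unique)
  thus "exp (- s * x) - Re (L s (of_real x)) =
           K * (\<integral>w. indicator {0..} w *\<^sub>R ((H (s - w) - H (s + w)) * exp (- w * x)) \<partial>lborel)"
    unfolding feq Bochner_Integration.integral_diff[OF E1(1) E2(1)] by simp
qed

text \<open>\<open>H_diff_bounds\<close> holds for almost every \<open>w > 0\<close>, and its factor
  \<open>w\<close> has Laplace transform \<open>1 / x\<^sup>2\<close>.\<close>

lemma exp_minus_L_bounds_off_nodes:
  assumes s: "0 < s" and x: "0 < x" and cx: "cos (pi * x) \<noteq> 0"
  shows "0 \<le> exp (- s * x) - Re (L s (of_real x))"
    and "exp (- s * x) - Re (L s (of_real x)) \<le> 100 * (s / (1 + s\<^sup>2)) * ((cos (pi * x) / pi)\<^sup>2 / x\<^sup>2)"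
proof -
  define I where "I = (\<integral>w. indicator {0..} w *\<^sub>R ((H (s - w) - H (s + w)) * exp (- w * x)) \<partial>lborel)"
  note int = exp_minus_L_integral[OF s x cx, folded I_def]
  have ae: "AE w in lborel. w \<noteq> 0 \<and> w \<noteq> s"
    using AE_lborel_singleton[of "0::real"] AE_lborel_singleton[of s] by eventually_elim simp
  have "0 \<le> I" unfolding I_def
  proof (rule integral_nonneg_AE)
    show "AE w in lborel. 0 \<le> indicator {0..} w *\<^sub>R ((H (s - w) - H (s + w)) * exp (- w * x))"
      using ae by eventually_elim (use H_diff_bounds(1)[OF s] in \<open>auto split: split_indicator\<close>)
  qed
  thus "0 \<le> exp (- s * x) - Re (L s (of_real x))" unfolding int by simp
  have lin: "has_bochner_integral lborel (\<lambda>w. 100 * (s / (1 + s\<^sup>2)) * (indicator {0..} w *\<^sub>R ((w - 0) * exp (- x * w))))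
      (100 * (s / (1 + s\<^sup>2)) * (exp (- x * 0) * ((0 - 0) / x + 1 / x\<^sup>2)))"
    by (intro has_bochner_integral_mult_right has_bochner_integral_exp_linear x) auto
  have "I \<le> (\<integral>w. 100 * (s / (1 + s\<^sup>2)) * (indicator {0..} w *\<^sub>R ((w - 0) * exp (- x * w))) \<partial>lborel)"
    unfolding I_def
  proof (rule integral_mono_AE[OF int(1)])
    show "AE w in lborel. indicator {0..} w *\<^sub>R ((H (s - w) - H (s + w)) * exp (- w * x)) \<le>
        100 * (s / (1 + s\<^sup>2)) * (indicator {0..} w *\<^sub>R ((w - 0) * exp (- x * w)))"
      using ae
    proof eventually_elim
      case (elim w)
      show ?case
      proof (cases "0 \<le> w")
        case True
        hence "(H (s - w) - H (s + w)) * exp (- w * x) \<le> (100 * (s / (1 + s\<^sup>2)) * w) * exp (- w * x)"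
          using elim by (intro mult_right_mono H_diff_bounds(2) s) auto
        thus ?thesis using True by (simp add: mult_ac)
      qed simp
    qed
  qed (use lin in \<open>simp add: has_bochner_integral_iff\<close>)
  also have "\<dots> = 100 * (s / (1 + s\<^sup>2)) * (1 / x\<^sup>2)"
    using has_bochner_integral_integral_eq[OF lin] by simp
  finally have "I \<le> 100 * (s / (1 + s\<^sup>2)) * (1 / x\<^sup>2)" .
  hence "(cos (pi * x) / pi)\<^sup>2 * I \<le> (cos (pi * x) / pi)\<^sup>2 * (100 * (s / (1 + s\<^sup>2)) * (1 / x\<^sup>2))"
    by (intro mult_left_mono) auto
  thus "exp (- s * x) - Re (L s (of_real x)) \<le> 100 * (s / (1 + s\<^sup>2)) * ((cos (pi * x) / pi)\<^sup>2 / x\<^sup>2)"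
    unfolding int by (simp add: mult_ac)
qed

lemma L_minus: "0 < s \<Longrightarrow> L s (- z) = L s z"
  by (simp add: L_eq_suminf add.commute)

lemma continuous_Re_L: "0 < s \<Longrightarrow> ((\<lambda>y. Re (L s (of_real y))) \<longlongrightarrow> Re (L s (of_real x))) (at x within A)"
  by (intro tendsto_Re continuous_on_tendsto_compose[OF holomorphic_on_imp_continuous_on[OF holomorphic_L]]
      tendsto_intros) auto

lemma eventually_cos_pi_nonzero_real: "\<forall>\<^sub>F y in at x. cos (pi * y) \<noteq> 0" for x :: real
proof -
  have "filterlim (of_real :: real \<Rightarrow> complex) (at (of_real x)) (at x)"
    unfolding filterlim_at by (auto intro!: tendsto_intros simp: eventually_at_filter)
  from eventually_compose_filterlim[OF eventually_cos_pi_nonzero this]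
  show ?thesis by (simp add: cos_of_real flip: of_real_mult)
qed

text \<open>Continuity from the right carries the inequality over to 0 and to the zeros of the
  cosine, and evenness to negative \<open>x\<close>.\<close>

lemma L_le_exp:
  assumes s: "0 < s"
  shows "Re (L s (of_real x)) \<le> exp (- s * \<bar>x\<bar>)"
proof -
  have pos: "0 \<le> exp (- s * x) - Re (L s (of_real x))" if x: "0 \<le> x" for x
  proof (rule tendsto_lowerbound)
    show "((\<lambda>y. exp (- s * y) - Re (L s (of_real y))) \<longlongrightarrow> exp (- s * x) - Re (L s (of_real x))) (at_right x)"
      by (intro tendsto_intros continuous_Re_L s)
    have "\<forall>\<^sub>F y in at_right x. cos (pi * y) \<noteq> 0"
      using eventually_cos_pi_nonzero_real[of x] by (auto simp: eventually_at_split)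
    moreover have "\<forall>\<^sub>F y in at_right x. x < y" by (rule eventually_at_right_less)
    ultimately show "\<forall>\<^sub>F y in at_right x. 0 \<le> exp (- s * y) - Re (L s (of_real y))"
      by eventually_elim (rule exp_minus_L_bounds_off_nodes, use s x in auto)
  qed simp
  show ?thesis
    using pos[of x] pos[of "-x"] L_minus[OF s, of "of_real x"] by (cases "0 \<le> x") auto
qed

lemma exp_minus_L_le:
  assumes s: "0 < s" and x: "x \<noteq> 0"
  shows "exp (- s * \<bar>x\<bar>) - Re (L s (of_real x)) \<le> 100 * (s / (1 + s\<^sup>2)) * ((cos (pi * x) / pi)\<^sup>2 / x\<^sup>2)"
proof -
  have pos: "exp (- s * x) - Re (L s (of_real x)) \<le> 100 * (s / (1 + s\<^sup>2)) * ((cos (pi * x) / pi)\<^sup>2 / x\<^sup>2)" if x: "0 < x" for x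
  proof (rule tendsto_le)
    show "((\<lambda>y. exp (- s * y) - Re (L s (of_real y))) \<longlongrightarrow> exp (- s * x) - Re (L s (of_real x))) (at_right x)"
      by (intro tendsto_intros continuous_Re_L s)
    show "((\<lambda>y. 100 * (s / (1 + s\<^sup>2)) * ((cos (pi * y) / pi)\<^sup>2 / y\<^sup>2)) \<longlongrightarrow> 100 * (s / (1 + s\<^sup>2)) * ((cos (pi * x) / pi)\<^sup>2 / x\<^sup>2)) (at_right x)"
      using x by (intro tendsto_intros) auto
    have "\<forall>\<^sub>F y in at_right x. cos (pi * y) \<noteq> 0"
      using eventually_cos_pi_nonzero_real[of x] by (auto simp: eventually_at_split)
    moreover have "\<forall>\<^sub>F y in at_right x. x < y" by (rule eventually_at_right_less)
    ultimately show "\<forall>\<^sub>F y in at_right x. exp (- s * y) - Re (L s (of_real y)) \<le> 100 * (s / (1 + s\<^sup>2)) * ((cos (pi * y) / pi)\<^sup>2 / y\<^sup>2)"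
      by eventually_elim (rule exp_minus_L_bounds_off_nodes, use s x in auto)
  qed simp
  show ?thesis
    using pos[of x] pos[of "-x"] L_minus[OF s, of "of_real x"] x by (cases "0 < x") auto
qed

section \<open>Integrals and Fourier transforms\<close>

lemma quadrature_symmetric:
  fixes F :: "complex \<Rightarrow> complex"
  assumes holo: "F holomorphic_on UNIV" and ty: "exp_type_at_most (2 * pi) F"
    and int: "integrable lborel (\<lambda>x. F (of_real x))" and c: "0 < c" "c < 1"
  shows "(\<lambda>N. \<Sum>j\<le>N. of_real c * F (of_real (c * (real j + 1/2))) + of_real c * F (of_real (c * (- (real j + 1/2)))))
           \<longlonglongrightarrow> (\<integral>x. F (of_real x) \<partial>lborel)"
proof -
  have "{- int (Suc N)..<int (Suc N)} = {- int N - 1..int N}" for N by auto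
  hence "(\<Sum>k\<in>{- int (Suc N)..<int (Suc N)}. of_real c * F (of_real (c * (of_int k + 1/2)))) =
    (\<Sum>j\<le>N. of_real c * F (of_real (c * (real j + 1/2))) + of_real c * F (of_real (c * (- (real j + 1/2)))))" for N
    by (simp only: sum_half_integers[of "\<lambda>h. of_real c * F (of_real (c * h))"])
  thus ?thesis using LIMSEQ_Suc[OF quadrature[OF assms]] by (simp only:)
qed

text \<open>The primitive is bounded in strips, so Cauchy's estimate on unit discs bounds
  \<open>F\<close> on the reals; \<open>exp_type_bounded_on_reals\<close> extends this to the
  plane.\<close>

lemma integrable_exp_type_bounded:
  fixes F :: "complex \<Rightarrow> complex"
  assumes holo: "F holomorphic_on UNIV" and ty: "exp_type_at_most \<tau> F" and \<tau>: "0 \<le> \<tau>"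
    and int: "integrable lborel (\<lambda>x. F (of_real x))"
  obtains B where "0 < B" "\<And>z. norm (F z) \<le> B * exp (\<tau> * \<bar>Im z\<bar>)"
proof -
  obtain E B lp lm where E: "\<And>z. (E has_field_derivative F z) (at z)" and B: "0 < B"
    and bE: "\<And>z. norm (E z) \<le> B * exp (\<tau> * \<bar>Im z\<bar>)"
    by (rule exp_type_primitive[OF holo ty \<tau> int]) (rule that)
  have holE: "E holomorphic_on A" for A
    using E by (meson holomorphic_onI field_differentiable_def has_field_derivative_at_within)
  have bx: "norm (F (of_real x)) \<le> B * exp \<tau>" for x
  proof -
    have "norm ((deriv ^^ 1) E (of_real x)) \<le> fact 1 * (B * exp \<tau>) / 1 ^ 1"
    proof (rule Cauchy_inequality)
      fix w :: complex assume "norm (of_real x - w) = 1"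
      hence "\<bar>Im w\<bar> \<le> 1" using abs_Im_le_cmod[of "of_real x - w"] by simp
      hence "\<tau> * \<bar>Im w\<bar> \<le> \<tau> * 1" using \<tau> by (intro mult_left_mono)
      hence "B * exp (\<tau> * \<bar>Im w\<bar>) \<le> B * exp \<tau>" using B by simp
      thus "norm (E w) \<le> B * exp \<tau>" using bE[of w] by linarith
    qed (auto intro: holE holomorphic_on_imp_continuous_on)
    thus ?thesis using DERIV_imp_deriv[OF E] by simp
  qed
  show ?thesis
  proof (rule that)
    show "0 < B * exp \<tau>" using B by simp
    show "norm (F z) \<le> B * exp \<tau> * exp (\<tau> * \<bar>Im z\<bar>)" for z
      by (rule exp_type_bounded_on_reals[OF holo ty _ bx]) (use B in simp)
  qed
qed

text \<open>As \<open>cos (pi * a) = 0\<close>, the cosine at \<open>c * a\<close> is at most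
  \<open>\<bar>sin t\<bar>\<close> with \<open>t = pi * (1 - c) * \<bar>a\<bar>\<close>. Bounding
  its square by 1 would lose the decay in \<open>1 - c\<close>, and bounding it by \<open>t\<close>
  the summability over the nodes. The intermediate bound \<open>sqrt t\<close> keeps both, leaving
  \<open>sqrt (1 - c)\<close> times \<open>\<bar>a\<bar> powr (- 3/2)\<close>.\<close>

lemma dilated_nodes_sum_bound:
  obtains S :: real where "0 < S"
    "\<And>c N. 1/2 < c \<Longrightarrow> c < 1 \<Longrightarrow> (\<Sum>j\<le>N. (cos (pi * (c * (real j + 1/2))) / pi)\<^sup>2 / (c * (real j + 1/2))\<^sup>2
        + (cos (pi * (c * (- (real j + 1/2)))) / pi)\<^sup>2 / (c * (- (real j + 1/2)))\<^sup>2) \<le> S * sqrt (1 - c)"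
proof -
  define g where "g = (\<lambda>j::nat. (real j + 1/2) powr (- 3/2))"
  have sg: "summable g"
  proof (rule summable_comparison_test')
    have "summable (\<lambda>j. real (Suc j) powr (- 3/2))"
      using summable_real_powr_iff[of "-3/2"] by (subst summable_Suc_iff) simp
    thus "summable (\<lambda>j. (1/2) powr (- 3/2) * real (Suc j) powr (- 3/2))" by (rule summable_mult)
    fix j :: nat
    have "(real j + 1/2) powr (- 3/2) \<le> (1/2 * real (Suc j)) powr (- 3/2)"
      by (rule powr_mono2') auto
    also have "\<dots> = (1/2) powr (- 3/2) * real (Suc j) powr (- 3/2)" by (rule powr_mult)
    finally show "norm (g j) \<le> (1/2) powr (- 3/2) * real (Suc j) powr (- 3/2)" by (simp add: g_def)
  qed
  define S where "S = 8 * (\<Sum>j. g j)"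
  have S: "0 < S" unfolding S_def using suminf_pos[OF sg] by (simp add: g_def)
  have node_bound: "(cos (pi * (c * a)) / pi)\<^sup>2 / (c * a)\<^sup>2 \<le> 4 * sqrt (1 - c) * \<bar>a\<bar> powr (- 3/2)"
    if c: "1/2 < c" "c < 1" and a: "\<bar>a\<bar> = real j + 1/2" for c a j
  proof -
    define b where "b = \<bar>a\<bar>"
    have b: "0 < b" "b = real j + 1/2" using a by (auto simp: b_def)
    define t where "t = pi * ((1 - c) * b)"
    have t: "0 \<le> t" using c b by (simp add: t_def)
    have cb: "cos (pi * b) = 0"
    proof -
      have "cos (of_real pi * of_real b :: complex) = 0"
        unfolding cos_pi_eq_0_iff by (intro exI[of _ "int j"]) (simp add: b)
      hence "of_real (cos (pi * b)) = (0 :: complex)" by (simp only: of_real_mult[symmetric] cos_of_real)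
      thus ?thesis by (simp only: of_real_eq_0_iff)
    qed
    have "cos (pi * (c * a)) = cos (pi * (c * b))" by (cases "0 \<le> a") (simp_all add: b_def)
    also have "pi * (c * b) = pi * b - t" by (simp add: t_def algebra_simps)
    also have "cos (pi * b - t) = sin (pi * b) * sin t" by (simp add: cos_diff cb)
    finally have "\<bar>cos (pi * (c * a))\<bar> \<le> 1 * \<bar>sin t\<bar>" by (simp only: abs_mult) (intro mult_right_mono, auto)
    hence "\<bar>cos (pi * (c * a))\<bar>\<^sup>2 \<le> \<bar>sin t\<bar>\<^sup>2" by (intro power_mono) auto
    also have "\<dots> \<le> \<bar>sin t\<bar>" using power_decreasing[of 1 2 "\<bar>sin t\<bar>"] by simp
    also have "\<dots> \<le> sqrt t"
    proof (rule real_le_rsqrt)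
      have "\<bar>sin t\<bar>\<^sup>2 \<le> \<bar>sin t\<bar>" using power_decreasing[of 1 2 "\<bar>sin t\<bar>"] by simp
      also have "\<dots> \<le> t" using abs_sin_x_le_abs_x[of t] t by simp
      finally show "\<bar>sin t\<bar>\<^sup>2 \<le> t" .
    qed
    finally have cs: "(cos (pi * (c * a)))\<^sup>2 \<le> sqrt t" by simp
    have p2: "1 \<le> pi\<^sup>2" "sqrt pi \<le> pi\<^sup>2"
    proof -
      have "1 \<le> pi" using pi_gt3 by simp
      thus "1 \<le> pi\<^sup>2" by (rule one_le_power)
      have "pi \<le> (pi\<^sup>2)\<^sup>2" using \<open>1 \<le> pi\<close> power_increasing[of 1 4 pi] by simp
      thus "sqrt pi \<le> pi\<^sup>2" by (intro real_le_lsqrt) auto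
    qed
    have "(cos (pi * (c * a)) / pi)\<^sup>2 \<le> sqrt t / pi\<^sup>2"
      using cs by (simp add: power_divide divide_right_mono)
    also have "\<dots> = (sqrt pi / pi\<^sup>2) * (sqrt (1 - c) * sqrt b)" by (simp add: t_def real_sqrt_mult)
    also have "\<dots> \<le> 1 * (sqrt (1 - c) * sqrt b)" using p2 c b by (intro mult_right_mono) auto
    finally have "(cos (pi * (c * a)) / pi)\<^sup>2 \<le> sqrt (1 - c) * sqrt b" by simp
    moreover have "b\<^sup>2 / 4 \<le> (c * a)\<^sup>2"
    proof -
      have "(1/2 * b)\<^sup>2 \<le> (c * b)\<^sup>2" using c b by (intro power_mono mult_right_mono) auto
      thus ?thesis by (simp add: power_mult_distrib power_divide b_def)
    qed
    ultimately have "(cos (pi * (c * a)) / pi)\<^sup>2 / (c * a)\<^sup>2 \<le> (sqrt (1 - c) * sqrt b) / (b\<^sup>2 / 4)"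
      using b c by (intro frac_le) auto
    also have "\<dots> = 4 * sqrt (1 - c) * (sqrt b / b\<^sup>2)" by simp
    also have "sqrt b / b\<^sup>2 = b powr (- 3/2)"
    proof -
      have "sqrt b = b powr (1/2)" "b\<^sup>2 = b powr 2" using b by (simp_all add: powr_half_sqrt)
      thus ?thesis by (simp flip: powr_diff)
    qed
    finally show ?thesis by (simp add: b_def)
  qed
  show ?thesis
  proof (rule that[OF S])
    fix c :: real and N assume c: "1/2 < c" "c < 1"
    have "(\<Sum>j\<le>N. (cos (pi * (c * (real j + 1/2))) / pi)\<^sup>2 / (c * (real j + 1/2))\<^sup>2
        + (cos (pi * (c * (- (real j + 1/2)))) / pi)\<^sup>2 / (c * (- (real j + 1/2)))\<^sup>2)
       \<le> (\<Sum>j\<le>N. 8 * sqrt (1 - c) * g j)"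
    proof (rule sum_mono)
      fix j
      have "4 * sqrt (1 - c) * g j + 4 * sqrt (1 - c) * g j = 8 * sqrt (1 - c) * g j" by simp
      thus "(cos (pi * (c * (real j + 1/2))) / pi)\<^sup>2 / (c * (real j + 1/2))\<^sup>2
        + (cos (pi * (c * (- (real j + 1/2)))) / pi)\<^sup>2 / (c * (- (real j + 1/2)))\<^sup>2 \<le> 8 * sqrt (1 - c) * g j"
        using node_bound[OF c, of "real j + 1/2" j] node_bound[OF c, of "- (real j + 1/2)" j] unfolding g_def
        by (simp only: abs_minus_cancel) (simp add: abs_of_nonneg)
    qed
    also have "\<dots> = 8 * sqrt (1 - c) * (\<Sum>j\<le>N. g j)" by (simp add: sum_distrib_left)
    also have "\<dots> \<le> 8 * sqrt (1 - c) * (\<Sum>j. g j)"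
      using c by (intro mult_left_mono sum_le_suminf sg) (auto simp: g_def)
    finally show "(\<Sum>j\<le>N. (cos (pi * (c * (real j + 1/2))) / pi)\<^sup>2 / (c * (real j + 1/2))\<^sup>2
        + (cos (pi * (c * (- (real j + 1/2)))) / pi)\<^sup>2 / (c * (- (real j + 1/2)))\<^sup>2) \<le> S * sqrt (1 - c)"
      by (simp add: S_def mult_ac)
  qed
qed

lemma integrable_inverse_one_plus_sq: "integrable lborel (\<lambda>x::real. 1 / (1 + x\<^sup>2))"
proof -
  have "has_bochner_integral lborel (\<lambda>x::real. indicator {0..} x *\<^sub>R (1 / (1 + x\<^sup>2))) (pi / 2 - arctan 0)"
  proof (rule integral_FTC_atLeast_nonneg)
    show "(arctan has_real_derivative 1 / (1 + x\<^sup>2)) (at x)" for x :: real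
      using DERIV_arctan[of x] by (simp add: inverse_eq_divide)
    show "(arctan \<longlongrightarrow> pi / 2) at_top" by (rule tendsto_arctan_at_top)
  qed auto
  from has_bochner_integral_even_function[OF this] show ?thesis
    by (auto simp: has_bochner_integral_iff)
qed

lemma exp_type_L:
  assumes s: "0 < s"
  shows "exp_type_at_most (2 * pi) (L s)"
  unfolding exp_type_at_most_def
proof (intro allI impI exI)
  fix \<epsilon> :: real and z :: complex assume \<epsilon>: "0 < \<epsilon>"
  define B where "B = 2 * ((1 + s) * (exp (- s / 2) / (1 - exp (- s))))"
  have B: "0 \<le> B" using s by (simp add: B_def)
  have "norm (L s z) \<le> B * exp (2 * pi * \<bar>Im z\<bar>)" unfolding B_def by (rule norm_L_le[OF s])
  also have "\<dots> \<le> B * exp ((2 * pi + \<epsilon>) * norm z)"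
    using \<epsilon> abs_Im_le_cmod[of z] by (intro mult_left_mono B) (auto intro!: mult_mono)
  finally show "norm (L s z) \<le> 2 * ((1 + s) * (exp (- s / 2) / (1 - exp (- s)))) * exp ((2 * pi + \<epsilon>) * norm z)"
    unfolding B_def .
qed

lemma L_eq_of_real_Re: "0 < s \<Longrightarrow> L s (of_real x) = of_real (Re (L s (of_real x)))"
  using L_of_real[of s x] by (simp add: complex_is_Real_iff complex_eq_iff)

lemma integrable_L:
  assumes s: "0 < s"
  shows "integrable lborel (\<lambda>x. L s (of_real x))"
proof -
  define B where "B = 2 * ((1 + s) * (exp (- s / 2) / (1 - exp (- s))))"
  have B: "0 \<le> B" using s by (simp add: B_def)
  \<comment> \<open>The 2 serves twice: \<open>1 + x\<^sup>2 \<le> 2\<close> for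
    \<open>\<bar>x\<bar> \<le> 1\<close>, where \<open>norm (L s x)\<close> is at most
    \<open>B\<close>, and \<open>1 + x\<^sup>2 \<le> 2 * x\<^sup>2\<close> beyond, where the
    distance from the exponential is bounded by a multiple of \<open>1 / x\<^sup>2\<close>.\<close>
  define D where "D = 2 * (B + 100 * (s / (1 + s\<^sup>2)))"
  have fr: "0 \<le> s / (1 + s\<^sup>2)" using s by simp
  show ?thesis
  proof (rule Bochner_Integration.integrable_bound)
    show "integrable lborel (\<lambda>x. exp (- s * \<bar>x\<bar>) + D * (1 / (1 + x\<^sup>2)))"
      using has_bochner_integral_exp_neg_abs[OF s]
      by (intro Bochner_Integration.integrable_add integrable_mult_right integrable_inverse_one_plus_sq)
        (auto simp: has_bochner_integral_iff)
    have "continuous_on UNIV (\<lambda>x. L s (of_real x))"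
      by (intro continuous_on_compose2[OF holomorphic_on_imp_continuous_on[OF holomorphic_L[OF s]]] continuous_intros) auto
    thus "(\<lambda>x. L s (of_real x)) \<in> borel_measurable lborel" by (simp add: borel_measurable_continuous_onI)
    show "AE x in lborel. norm (L s (of_real x)) \<le> norm (exp (- s * \<bar>x\<bar>) + D * (1 / (1 + x\<^sup>2)))"
    proof (rule AE_I2)
      fix x :: real
      have e0: "0 \<le> exp (- s * \<bar>x\<bar>)" by simp
      have "norm (L s (of_real x)) \<le> exp (- s * \<bar>x\<bar>) + D * (1 / (1 + x\<^sup>2))"
      proof (cases "\<bar>x\<bar> \<le> 1")
        case True
        hence "x\<^sup>2 \<le> 1" by (simp add: abs_square_le_1)
        hence "1 / 2 \<le> 1 / (1 + x\<^sup>2)" by (intro divide_left_mono) (auto simp: add_pos_nonneg)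
        hence "D * (1 / 2) \<le> D * (1 / (1 + x\<^sup>2))" using B fr by (intro mult_left_mono) (auto simp: D_def)
        moreover have "norm (L s (of_real x)) \<le> B" using norm_L_le[OF s, of "of_real x"] by (simp add: B_def)
        moreover have "B \<le> D * (1 / 2)" using fr by (simp add: D_def)
        ultimately show ?thesis using e0 by linarith
      next
        case False
        hence x: "x \<noteq> 0" "1 < x\<^sup>2" by (auto simp: abs_square_less_1 not_le) (metis abs_square_le_1 False not_le)
        have pi2: "1 \<le> pi\<^sup>2" using pi_gt3 by (intro one_le_power) simp
        have "(cos (pi * x))\<^sup>2 \<le> 1" using abs_cos_le_one[of "pi * x"] by (simp add: abs_square_le_1)
        also note pi2
        finally have "(cos (pi * x) / pi)\<^sup>2 \<le> 1" by (simp add: power_divide)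
        hence "(cos (pi * x) / pi)\<^sup>2 / x\<^sup>2 \<le> 1 / x\<^sup>2" by (intro divide_right_mono) auto
        also have "1 / x\<^sup>2 \<le> 2 * (1 / (1 + x\<^sup>2))" using x by (simp add: field_simps)
        finally have "100 * (s / (1 + s\<^sup>2)) * ((cos (pi * x) / pi)\<^sup>2 / x\<^sup>2) \<le> 100 * (s / (1 + s\<^sup>2)) * (2 * (1 / (1 + x\<^sup>2)))"
          using fr by (intro mult_left_mono) auto
        also have "\<dots> \<le> D * (1 / (1 + x\<^sup>2))"
        proof -
          have "100 * (s / (1 + s\<^sup>2)) * 2 * (1 / (1 + x\<^sup>2)) \<le> D * (1 / (1 + x\<^sup>2))"
            by (rule mult_right_mono) (use B in \<open>auto simp: D_def\<close>)
          thus ?thesis by (simp only: mult.assoc)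
        qed
        finally have "exp (- s * \<bar>x\<bar>) - Re (L s (of_real x)) \<le> D * (1 / (1 + x\<^sup>2))"
          using exp_minus_L_le[OF s x(1)] by linarith
        moreover have "Re (L s (of_real x)) \<le> exp (- s * \<bar>x\<bar>)" by (rule L_le_exp[OF s])
        moreover have "norm (L s (of_real x)) = \<bar>Re (L s (of_real x))\<bar>"
          by (subst L_eq_of_real_Re[OF s]) (simp only: norm_of_real)
        ultimately show ?thesis using e0 by linarith
      qed
      thus "norm (L s (of_real x)) \<le> norm (exp (- s * \<bar>x\<bar>) + D * (1 / (1 + x\<^sup>2)))" by simp
    qed
  qed
qed

text \<open>At the half-integers \<open>L s\<close> agrees with the exponential, whose values there
  sum to \<open>1 / sinh (s / 2)\<close>. At nodes dilated by \<open>c < 1\<close> the quadrature is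
  exact but the agreement is not; the discrepancy is of order \<open>sqrt (1 - c)\<close> by
  \<open>dilated_nodes_sum_bound\<close>.\<close>

lemma integral_L:
  assumes s: "0 < s"
  shows "(\<integral>x. Re (L s (of_real x)) \<partial>lborel) = 1 / sinh (s / 2)"
proof -
  define I where "I = (\<integral>x. Re (L s (of_real x)) \<partial>lborel)"
  have IL: "(\<integral>x. L s (of_real x) \<partial>lborel) = of_real I"
    unfolding I_def integral_complex_of_real[symmetric]
    by (rule Bochner_Integration.integral_cong[OF refl]) (rule L_eq_of_real_Re[OF s])
  obtain S where S: "0 < S" "\<And>c N. 1/2 < c \<Longrightarrow> c < 1 \<Longrightarrow> (\<Sum>j\<le>N. (cos (pi * (c * (real j + 1/2))) / pi)\<^sup>2 / (c * (real j + 1/2))\<^sup>2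
        + (cos (pi * (c * (- (real j + 1/2)))) / pi)\<^sup>2 / (c * (- (real j + 1/2)))\<^sup>2) \<le> S * sqrt (1 - c)"
    by (rule dilated_nodes_sum_bound) (rule that)
  define C where "C = 100 * (s / (1 + s\<^sup>2))"
  have C: "0 \<le> C" using s by (simp add: C_def)
  \<comment> \<open>The closed form of the quadrature sum of
    \<open>exp (- s * \<bar>x\<bar>)\<close> over the dilated nodes.\<close>
  define h where "h = (\<lambda>c. c * (2 * (exp (- (s * c) / 2) / (1 - exp (- (s * c))))))"
  have bound: "\<bar>h c - I\<bar> \<le> C * (S * sqrt (1 - c))" if c: "1/2 < c" "c < 1" for c
  proof -
    define P where "P = (\<lambda>N. \<Sum>j\<le>N. c * Re (L s (of_real (c * (real j + 1/2)))) + c * Re (L s (of_real (c * (- (real j + 1/2))))))"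
    define Q where "Q = (\<lambda>N. \<Sum>j\<le>N. c * (2 * exp (- (s * c) * (real j + 1/2))))"
    have P: "P \<longlonglongrightarrow> I"
    proof -
      have "(\<lambda>N. \<Sum>j\<le>N. of_real c * L s (of_real (c * (real j + 1/2))) + of_real c * L s (of_real (c * (- (real j + 1/2)))))
           \<longlonglongrightarrow> of_real I"
        unfolding IL[symmetric] using c
        by (intro quadrature_symmetric holomorphic_L exp_type_L integrable_L s) auto
      from tendsto_Re[OF this] show ?thesis by (simp add: P_def)
    qed
    have sc: "0 < s * c" using s c by simp
    have "(\<lambda>j. c * (2 * exp (- (s * c) * (real j + 1/2)))) sums h c"
      unfolding h_def by (intro sums_mult sums_exp_half_integer sc)
    hence Q: "Q \<longlonglongrightarrow> h c" by (simp only: sums_def_le Q_def)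
    have "\<bar>Q N - P N\<bar> \<le> C * (S * sqrt (1 - c))" for N
    proof -
      define k where "k = (\<lambda>x. (cos (pi * x) / pi)\<^sup>2 / x\<^sup>2)"
      have g: "0 \<le> exp (- s * \<bar>x\<bar>) - Re (L s (of_real x))" "exp (- s * \<bar>x\<bar>) - Re (L s (of_real x)) \<le> C * k x" if "x \<noteq> 0" for x
        using L_le_exp[OF s, of x] exp_minus_L_le[OF s that] by (simp_all add: C_def k_def)
      have "Q N - P N = (\<Sum>j\<le>N. c * (2 * exp (- (s * c) * (real j + 1/2))) - (c * Re (L s (of_real (c * (real j + 1/2)))) + c * Re (L s (of_real (c * (- (real j + 1/2)))))))"
        unfolding P_def Q_def by (rule sum_subtractf[symmetric])
      also have "\<dots> = (\<Sum>j\<le>N. c * (exp (- s * \<bar>c * (real j + 1/2)\<bar>) - Re (L s (of_real (c * (real j + 1/2)))))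
          + c * (exp (- s * \<bar>c * (- (real j + 1/2))\<bar>) - Re (L s (of_real (c * (- (real j + 1/2)))))))"
      proof (rule sum.cong[OF refl])
        fix j
        have *: "\<bar>c * (real j + 1/2)\<bar> = c * (real j + 1/2)" "\<bar>c * (- (real j + 1/2))\<bar> = c * (real j + 1/2)"
          using c by (auto simp: abs_mult)
        have **: "- (s * c) * (real j + 1/2) = - s * (c * (real j + 1/2))" by simp
        have "c * (2 * E) - (c * p + c * q) = c * (E - p) + c * (E - q)" for E p q :: real
          by (simp add: algebra_simps)
        thus "c * (2 * exp (- (s * c) * (real j + 1/2))) - (c * Re (L s (of_real (c * (real j + 1/2)))) + c * Re (L s (of_real (c * (- (real j + 1/2)))))) =
          c * (exp (- s * \<bar>c * (real j + 1/2)\<bar>) - Re (L s (of_real (c * (real j + 1/2)))))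
          + c * (exp (- s * \<bar>c * (- (real j + 1/2))\<bar>) - Re (L s (of_real (c * (- (real j + 1/2))))))"
          unfolding * ** .
      qed
      finally have QP: "Q N - P N = \<dots>" .
      have "\<bar>Q N - P N\<bar> \<le> (\<Sum>j\<le>N. C * (k (c * (real j + 1/2)) + k (c * (- (real j + 1/2)))))"
        unfolding QP
      proof (rule order.trans[OF sum_abs sum_mono])
        fix j
        have *: "\<bar>c * y\<bar> \<le> y'" if "0 \<le> y" "y \<le> y'" for y y' using c that mult_right_mono[of c 1 y] by (simp add: abs_mult)
        have nz: "c * (real j + 1/2) \<noteq> 0" "c * (- (real j + 1/2)) \<noteq> 0" using c by auto
        show "\<bar>c * (exp (- s * \<bar>c * (real j + 1/2)\<bar>) - Re (L s (of_real (c * (real j + 1/2)))))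
          + c * (exp (- s * \<bar>c * (- (real j + 1/2))\<bar>) - Re (L s (of_real (c * (- (real j + 1/2))))))\<bar>
          \<le> C * (k (c * (real j + 1/2)) + k (c * (- (real j + 1/2))))"
          unfolding distrib_left[of C]
          by (rule order.trans[OF abs_triangle_ineq add_mono[OF *[OF g[OF nz(1)]] *[OF g[OF nz(2)]]]])
      qed
      also have "\<dots> = C * (\<Sum>j\<le>N. k (c * (real j + 1/2)) + k (c * (- (real j + 1/2))))" by (simp add: sum_distrib_left)
      also have "\<dots> \<le> C * (S * sqrt (1 - c))" unfolding k_def by (intro mult_left_mono S(2) c C)
      finally show ?thesis .
    qed
    moreover have "(\<lambda>N. \<bar>Q N - P N\<bar>) \<longlonglongrightarrow> \<bar>h c - I\<bar>" by (intro tendsto_intros P Q)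
    ultimately show ?thesis by (intro tendsto_upperbound[of "\<lambda>N. \<bar>Q N - P N\<bar>" _ sequentially]) auto
  qed
  have "\<bar>h 1 - I\<bar> \<le> C * (S * sqrt (1 - 1))"
  proof (rule tendsto_le)
    show "((\<lambda>c. \<bar>h c - I\<bar>) \<longlongrightarrow> \<bar>h 1 - I\<bar>) (at_left 1)" unfolding h_def using s by (intro tendsto_intros) auto
    show "((\<lambda>c. C * (S * sqrt (1 - c))) \<longlongrightarrow> C * (S * sqrt (1 - 1))) (at_left 1)" by (intro tendsto_intros)
    have "\<forall>\<^sub>F c in at_left 1. c \<in> {1/2<..<1::real}" by (rule eventually_at_left_real) simp
    thus "\<forall>\<^sub>F c in at_left 1. \<bar>h c - I\<bar> \<le> C * (S * sqrt (1 - c))"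
      by eventually_elim (rule bound, auto)
  qed simp
  hence "I = h 1" by simp
  also have "h 1 = 1 / sinh (s / 2)"
  proof -
    have "1 - exp (- s) = exp (- s / 2) * (exp (s / 2) - exp (- s / 2))"
      by (simp add: algebra_simps flip: exp_add)
    moreover have "exp (s / 2) - exp (- s / 2) = 2 * sinh (s / 2)" by (simp add: sinh_field_def)
    ultimately show ?thesis by (simp add: h_def)
  qed
  finally show ?thesis by (simp add: I_def)
qed

section \<open>Fourier transforms of the exponential and of its distance from
  \<open>L\<close>\<close>

lemma integral_exp_neg_halfline_complex:
  assumes c: "0 < Re c"
  shows "integrable lborel (\<lambda>x. indicator {0..} x *\<^sub>R exp (- c * of_real x))"
    and "(\<integral>x. indicator {0..} x *\<^sub>R exp (- c * of_real x) \<partial>lborel) = 1 / c"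
proof -
  have c0: "c \<noteq> 0" using c by auto
  have maj: "integrable lborel (\<lambda>x::real. indicator {0..} x *\<^sub>R exp (- Re c * x))"
    using has_bochner_integral_exp_neg[OF c] by (simp add: has_bochner_integral_iff)
  show int: "integrable lborel (\<lambda>x. indicator {0..} x *\<^sub>R exp (- c * of_real x))"
    by (rule Bochner_Integration.integrable_bound[OF maj]) (auto split: split_indicator)
  have FTC: "(\<integral>x. indicator {0..b} x *\<^sub>R exp (- c * of_real x) \<partial>lborel) = - exp (- c * of_real b) / c - (- exp (- c * of_real 0) / c)"
    if "0 \<le> b" for b :: real
  proof (rule integral_FTC_Icc[where F = "\<lambda>x. - exp (- c * of_real x) / c", OF that])
    show "((\<lambda>x. - exp (- c * of_real x) / c) has_vector_derivative exp (- c * of_real x)) (at x within {0..b})" for x :: real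
    proof (rule has_vector_derivative_real_field)
      show "((\<lambda>w. - exp (- c * w) / c) has_field_derivative exp (- c * of_real x)) (at (of_real x))"
        using c0 by (auto intro!: derivative_eq_intros)
    qed
  qed (intro continuous_intros)
  have "((\<lambda>b. \<integral>x. indicator {0..b} x *\<^sub>R exp (- c * of_real x) \<partial>lborel) \<longlongrightarrow> (\<integral>x. indicator {0..} x *\<^sub>R exp (- c * of_real x) \<partial>lborel)) at_top"
  proof (rule integral_dominated_convergence_at_top[where w = "\<lambda>x. indicator {0..} x *\<^sub>R exp (- Re c * x)"])
    show "AE x in lborel. ((\<lambda>b. indicator {0..b} x *\<^sub>R exp (- c * of_real x)) \<longlongrightarrow> indicator {0..} x *\<^sub>R exp (- c * of_real x)) at_top"
    proof (intro AE_I2 tendsto_eventually)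
      fix x :: real
      show "\<forall>\<^sub>F b in at_top. indicator {0..b} x *\<^sub>R exp (- c * of_real x) = indicator {0..} x *\<^sub>R exp (- c * of_real x)"
        using eventually_ge_at_top[of x] by eventually_elim (auto split: split_indicator)
    qed
  qed (use maj in \<open>auto split: split_indicator\<close>)
  moreover have "((\<lambda>b. \<integral>x. indicator {0..b} x *\<^sub>R exp (- c * of_real x) \<partial>lborel) \<longlongrightarrow> 1 / c) at_top"
  proof (rule Lim_transform_eventually)
    have "((\<lambda>b. exp (- c * of_real b)) \<longlongrightarrow> 0) at_top"
    proof (rule tendsto_norm_zero_cancel)
      have "((\<lambda>b. exp (- Re c * b)) \<longlongrightarrow> 0) at_top" using c by real_asymp
      thus "((\<lambda>b. norm (exp (- c * of_real b))) \<longlongrightarrow> 0) at_top" by simp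
    qed
    hence "((\<lambda>b. - exp (- c * of_real b) / c - (- exp (- c * of_real 0) / c)) \<longlongrightarrow> - 0 / c - (- exp (- c * of_real 0) / c)) at_top"
      using c0 by (intro tendsto_intros)
    thus "((\<lambda>b. - exp (- c * of_real b) / c - (- exp (- c * of_real 0) / c)) \<longlongrightarrow> 1 / c) at_top" by simp
    show "\<forall>\<^sub>F b in at_top. - exp (- c * of_real b) / c - (- exp (- c * of_real 0) / c) = (\<integral>x. indicator {0..b} x *\<^sub>R exp (- c * of_real x) \<partial>lborel)"
      using eventually_ge_at_top[of 0] by eventually_elim (rule FTC[symmetric])
  qed
  ultimately show "(\<integral>x. indicator {0..} x *\<^sub>R exp (- c * of_real x) \<partial>lborel) = 1 / c"
    using tendsto_unique trivial_limit_at_top_linorder by blast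
qed

lemma norm_e_real [simp]: "norm (e (of_real x)) = 1"
  by (simp add: e_def)

lemma measurable_e [measurable]: "e \<in> borel_measurable borel"
  unfolding e_def[abs_def] by (intro borel_measurable_continuous_onI continuous_intros)

lemma fourier_exp_neg_abs:
  assumes s: "0 < s"
  shows "integrable lborel (\<lambda>x. of_real (exp (- s * \<bar>x\<bar>)) * e (of_real (- t * x)))"
    and "(\<integral>x. of_real (exp (- s * \<bar>x\<bar>)) * e (of_real (- t * x)) \<partial>lborel) = of_real (2 * s / (s\<^sup>2 + 4 * pi\<^sup>2 * t\<^sup>2))"
proof -
  define c where "c = of_real s + 2 * of_real pi * \<i> * of_real t"
  define c' where "c' = of_real s - 2 * of_real pi * \<i> * of_real t"
  have rc: "0 < Re c" "0 < Re c'" using s by (simp_all add: c_def c'_def)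
  have eq1: "(of_real (exp (- s * \<bar>x\<bar>)) * e (of_real (- t * x)) :: complex) = exp (- c * of_real x)" if "0 \<le> x" for x
    using that by (simp add: e_def c_def exp_of_real[symmetric] algebra_simps flip: exp_add)
  have eq2: "(of_real (exp (- s * \<bar>x\<bar>)) * e (of_real (- t * x)) :: complex) = exp (- c' * of_real (- x))" if "x \<le> 0" for x
    using that by (simp add: e_def c'_def exp_of_real[symmetric] algebra_simps flip: exp_add)
  show "integrable lborel (\<lambda>x. of_real (exp (- s * \<bar>x\<bar>)) * e (of_real (- t * x)))"
  proof (rule Bochner_Integration.integrable_bound)
    show "integrable lborel (\<lambda>x. exp (- s * \<bar>x\<bar>))" using has_bochner_integral_exp_neg_abs[OF s] by (simp add: has_bochner_integral_iff)
    show "AE x in lborel. norm (of_real (exp (- s * \<bar>x\<bar>)) * e (of_real (- t * x))) \<le> norm (exp (- s * \<bar>x\<bar>))"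
      by (rule AE_I2) (simp only: norm_mult norm_e_real norm_of_real real_norm_def mult_1_right order.refl)
  qed measurable
  have i2: "integrable lborel (\<lambda>x. indicator {0..} (- x) *\<^sub>R exp (- c' * of_real (- x)))"
    "(\<integral>x. indicator {0..} (- x) *\<^sub>R exp (- c' * of_real (- x)) \<partial>lborel) = 1 / c'"
    using lborel_integrable_real_affine[OF integral_exp_neg_halfline_complex(1)[OF rc(2)], of "-1" 0]
      lborel_integral_real_affine[of "-1" "\<lambda>x. indicator {0..} x *\<^sub>R exp (- c' * of_real x)" 0]
      integral_exp_neg_halfline_complex(2)[OF rc(2)] by simp_all
  have "(\<integral>x. of_real (exp (- s * \<bar>x\<bar>)) * e (of_real (- t * x)) \<partial>lborel) =
     (\<integral>x. indicator {0..} x *\<^sub>R exp (- c * of_real x) + indicator {0..} (- x) *\<^sub>R exp (- c' * of_real (- x)) \<partial>lborel)"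
  proof (rule integral_cong_AE)
    show "AE x in lborel. of_real (exp (- s * \<bar>x\<bar>)) * e (of_real (- t * x)) =
      indicator {0..} x *\<^sub>R exp (- c * of_real x) + indicator {0..} (- x) *\<^sub>R exp (- c' * of_real (- x))"
      using AE_lborel_singleton[of "0::real"]
    proof eventually_elim
      case (elim x)
      thus ?case using eq1[of x] eq2[of x] by (cases "0 < x") (auto simp: not_less)
    qed
  qed measurable
  also have "\<dots> = 1 / c + 1 / c'"
    using integral_exp_neg_halfline_complex[OF rc(1)] i2 by (subst Bochner_Integration.integral_add) auto
  also have "\<dots> = of_real (2 * s / (s\<^sup>2 + 4 * pi\<^sup>2 * t\<^sup>2))"
  proof -
    have "c \<noteq> 0" "c' \<noteq> 0" using rc by auto
    hence "1 / c + 1 / c' = (c + c') / (c * c')" by (simp add: field_simps)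
    also have "c + c' = of_real (2 * s)" by (simp add: c_def c'_def)
    also have "c * c' = of_real (s\<^sup>2 + 4 * pi\<^sup>2 * t\<^sup>2)"
      by (simp add: c_def c'_def power2_eq_square algebra_simps)
    finally show ?thesis by simp
  qed
  finally show "(\<integral>x. of_real (exp (- s * \<bar>x\<bar>)) * e (of_real (- t * x)) \<partial>lborel) = of_real (2 * s / (s\<^sup>2 + 4 * pi\<^sup>2 * t\<^sup>2))" .
qed

lemma ext_integral_eq_integral:
  assumes "integrable M g"
  shows "ext_integral M (\<lambda>s. ereal (g s)) = ereal (\<integral>s. g s \<partial>M)"
proof -
  obtain p where p: "0 \<le> p" "(\<integral>\<^sup>+s. ennreal (g s) \<partial>M) = ennreal p"
    using assms unfolding real_integrable_def by (cases "\<integral>\<^sup>+s. ennreal (g s) \<partial>M") auto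
  obtain n where n: "0 \<le> n" "(\<integral>\<^sup>+s. ennreal (- g s) \<partial>M) = ennreal n"
    using assms unfolding real_integrable_def by (cases "\<integral>\<^sup>+s. ennreal (- g s) \<partial>M") auto
  show ?thesis
    unfolding ext_integral_def real_lebesgue_integral_def[OF assms] using p n by simp
qed

lemma ext_integral_nonneg:
  assumes "\<And>s. s \<in> space M \<Longrightarrow> 0 \<le> g s"
  shows "ext_integral M g = enn2ereal (\<integral>\<^sup>+s. e2ennreal (g s) \<partial>M)"
proof -
  have "(\<integral>\<^sup>+s. e2ennreal (- g s) \<partial>M) = (\<integral>\<^sup>+s. 0 \<partial>M)"
    using assms by (intro nn_integral_cong e2ennreal_neg) simp
  thus ?thesis by (simp add: ext_integral_def zero_ennreal.rep_eq)
qed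

lemma measurable_csinc [measurable]: "csinc \<in> borel_measurable borel"
  by (intro borel_measurable_continuous_onI holomorphic_on_imp_continuous_on holomorphic_csinc)

text \<open>Brings exponential decay in \<open>s\<close> under the weight that the measure
  integrates.\<close>

lemma exp_decay:
  fixes m s :: real
  assumes "0 < m" "0 < s"
  shows "s * exp (- s * m) \<le> (1 + 3 / m) ^ 3 * (s / (1 + s\<^sup>2))"
proof -
  have "1 + s\<^sup>2 \<le> (1 + s) ^ 2" using assms by (simp add: power2_eq_square algebra_simps)
  also have "\<dots> \<le> (1 + s) ^ 3" using assms by (intro power_increasing) auto
  finally have "1 + s\<^sup>2 \<le> (1 + s) ^ 3" .
  also have "\<dots> \<le> (1 + 3 / m) ^ 3 * exp (m * s)" by (rule one_plus_power_le_exp) (use assms in auto)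
  finally have "(1 + s\<^sup>2) * exp (- (m * s)) \<le> (1 + 3 / m) ^ 3 * exp (m * s) * exp (- (m * s))" by (intro mult_right_mono) auto
  also have "\<dots> = (1 + 3 / m) ^ 3" by (simp add: mult.assoc flip: exp_add)
  finally have "exp (- (m * s)) \<le> (1 + 3 / m) ^ 3 / (1 + s\<^sup>2)"
    by (simp add: pos_le_divide_eq add_pos_nonneg mult.commute)
  hence "s * exp (- (m * s)) \<le> s * ((1 + 3 / m) ^ 3 / (1 + s\<^sup>2))" using assms by (intro mult_left_mono) auto
  thus ?thesis by (simp add: mult.commute)
qed

lemma exp_neg_diff_le:
  fixes s :: real
  assumes "0 < s" "m \<le> u" "m \<le> v"
  shows "\<bar>exp (- s * u) - exp (- s * v)\<bar> \<le> s * exp (- s * m) * \<bar>u - v\<bar>"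
proof -
  have "norm (exp (- s * u) - exp (- s * v)) \<le> (s * exp (- s * m)) * norm (u - v)"
  proof (rule field_differentiable_bound[of "{m..}" "\<lambda>x. exp (- s * x)" "\<lambda>x. - s * exp (- s * x)"])
    fix x assume "x \<in> {m..}"
    thus "norm (- s * exp (- s * x)) \<le> s * exp (- s * m)" using assms by (simp add: abs_mult)
  qed (use assms in \<open>auto intro!: derivative_eq_intros\<close>)
  thus ?thesis by simp
qed

definition gap :: "real \<Rightarrow> real \<Rightarrow> real" where
  "gap s x = exp (- s * \<bar>x\<bar>) - Re (L s (of_real x))"

lemma gap_nonneg: "0 < s \<Longrightarrow> 0 \<le> gap s x"
  using L_le_exp[of s x] by (simp add: gap_def)

lemma gap_le: "0 < s \<Longrightarrow> x \<noteq> 0 \<Longrightarrow> gap s x \<le> 100 * (s / (1 + s\<^sup>2)) * ((cos (pi * x) / pi)\<^sup>2 / x\<^sup>2)"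
  using exp_minus_L_le[of s x] by (simp add: gap_def)

lemma integrable_gap: "0 < s \<Longrightarrow> integrable lborel (gap s)"
  and integral_gap: "0 < s \<Longrightarrow> (\<integral>x. gap s x \<partial>lborel) = 2 / s - 1 / sinh (s / 2)"
proof -
  assume s: "0 < s"
  have 1: "integrable lborel (\<lambda>x. exp (- s * \<bar>x\<bar>))" "(\<integral>x. exp (- s * \<bar>x\<bar>) \<partial>lborel) = 2 / s"
    using has_bochner_integral_exp_neg_abs[OF s] by (auto simp: has_bochner_integral_iff)
  have 2: "integrable lborel (\<lambda>x. Re (L s (of_real x)))" using integrable_L[OF s] by (rule integrable_Re)
  have g: "gap s = (\<lambda>x. exp (- s * \<bar>x\<bar>) - Re (L s (of_real x)))" by (simp add: fun_eq_iff gap_def)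
  show "integrable lborel (gap s)" unfolding g by (intro Bochner_Integration.integrable_diff 1 2)
  show "(\<integral>x. gap s x \<partial>lborel) = 2 / s - 1 / sinh (s / 2)"
    unfolding g by (simp only: Bochner_Integration.integral_diff[OF 1(1) 2] 1(2) integral_L[OF s])
qed

lemma fourier_gap:
  assumes s: "0 < s"
  shows "integrable lborel (\<lambda>x. of_real (gap s x) * e (of_real (- t * x)))"
    and "(\<integral>x. of_real (gap s x) * e (of_real (- t * x)) \<partial>lborel) = of_real (2 * s / (s\<^sup>2 + 4 * pi\<^sup>2 * t\<^sup>2)) - L_hat s t"
proof -
  have 1: "integrable lborel (\<lambda>x. L s (of_real x) * e (of_real (- t * x)))"
  proof (rule Bochner_Integration.integrable_bound[OF integrable_L[OF s]])
    have [measurable]: "(\<lambda>x. L s (of_real x)) \<in> borel_measurable borel"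
      using borel_measurable_integrable[OF integrable_L[OF s]] by simp
    show "(\<lambda>x. L s (of_real x) * e (of_real (- t * x))) \<in> borel_measurable lborel" by measurable
    show "AE x in lborel. norm (L s (of_real x) * e (of_real (- t * x))) \<le> norm (L s (of_real x))"
      by (rule AE_I2) (simp only: norm_mult norm_e_real mult_1_right order.refl)
  qed
  have eq: "(\<lambda>x. of_real (gap s x) * e (of_real (- t * x))) =
      (\<lambda>x. of_real (exp (- s * \<bar>x\<bar>)) * e (of_real (- t * x)) - L s (of_real x) * e (of_real (- t * x)))"
  proof
    fix x
    have "of_real (gap s x) = of_real (exp (- s * \<bar>x\<bar>)) - L s (of_real x)"
      unfolding gap_def of_real_diff L_eq_of_real_Re[OF s, of x, symmetric] ..
    thus "of_real (gap s x) * e (of_real (- t * x)) =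
      of_real (exp (- s * \<bar>x\<bar>)) * e (of_real (- t * x)) - L s (of_real x) * e (of_real (- t * x))"
      by (simp only: left_diff_distrib)
  qed
  show "integrable lborel (\<lambda>x. of_real (gap s x) * e (of_real (- t * x)))"
    unfolding eq by (intro Bochner_Integration.integrable_diff fourier_exp_neg_abs s 1)
  show "(\<integral>x. of_real (gap s x) * e (of_real (- t * x)) \<partial>lborel) = of_real (2 * s / (s\<^sup>2 + 4 * pi\<^sup>2 * t\<^sup>2)) - L_hat s t"
    unfolding eq Bochner_Integration.integral_diff[OF fourier_exp_neg_abs(1)[OF s] 1] fourier_exp_neg_abs(2)[OF s] L_hat_def ..
qed

section \<open>Integration over the measure\<close>

locale extremal_measure =
  fixes M :: "real measure"
  assumes sets_M: "sets M = sets (restrict_space borel {0<..})"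
    and fin: "(\<integral>\<^sup>+s. ennreal (s / (s\<^sup>2 + 1)) \<partial>M) < \<infinity>"
begin

lemma space_M: "space M = {0<..}"
  using sets_eq_imp_space_eq[OF sets_M] by (simp add: space_restrict_space)

lemma borel_measurable_M: "f \<in> measurable borel N \<Longrightarrow> f \<in> measurable M N"
  unfolding measurable_cong_sets[OF sets_M refl] by (rule measurable_restrict_space1)

lemma ident_measurable [measurable]: "(\<lambda>s. s) \<in> borel_measurable M"
  by (rule borel_measurable_M) simp

lemma integrable_weight: "integrable M (\<lambda>s. s / (1 + s\<^sup>2))"
proof (rule integrableI_nonneg)
  show "(\<lambda>s. s / (1 + s\<^sup>2)) \<in> borel_measurable M" by measurable
  show "AE s in M. 0 \<le> s / (1 + s\<^sup>2)" by (rule AE_I2) (simp add: space_M)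
  show "(\<integral>\<^sup>+s. ennreal (s / (1 + s\<^sup>2)) \<partial>M) < \<infinity>" using fin by (simp add: add.commute)
qed

lemma integrable_dominated:
  fixes g :: "real \<Rightarrow> 'b::{banach, second_countable_topology}"
  assumes "g \<in> borel_measurable M" "\<And>s. 0 < s \<Longrightarrow> norm (g s) \<le> C * (s / (1 + s\<^sup>2))"
  shows "integrable M g"
proof (rule Bochner_Integration.integrable_bound)
  show "integrable M (\<lambda>s. C * (s / (1 + s\<^sup>2)))" by (intro integrable_mult_right integrable_weight)
  show "AE s in M. norm (g s) \<le> norm (C * (s / (1 + s\<^sup>2)))"
  proof (rule AE_I2)
    fix s assume "s \<in> space M"
    hence "norm (g s) \<le> C * (s / (1 + s\<^sup>2))" using assms(2) by (simp add: space_M)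
    also have "\<dots> \<le> norm (C * (s / (1 + s\<^sup>2)))" by (simp only: real_norm_def abs_ge_self)
    finally show "norm (g s) \<le> norm (C * (s / (1 + s\<^sup>2)))" .
  qed
qed (rule assms(1))

text \<open>The weight is positive and integrable, so the sets where it is at least
  \<open>1 / n\<close> have finite measure, and they exhaust the half-line. Fubini's theorem depends
  on this.\<close>

lemma sigma_finite_M: "sigma_finite_measure M"
proof
  define A where "A = (\<lambda>n::nat. {s \<in> space M. 1 \<le> real n * (s / (1 + s\<^sup>2))})"
  have A: "A n \<in> sets M" for n unfolding A_def by measurable
  have "emeasure M (A n) \<noteq> \<infinity>" for n
  proof -
    have "integrable M (\<lambda>s. real n * (s / (1 + s\<^sup>2)))" by (intro integrable_mult_right integrable_weight)
    hence "(\<integral>\<^sup>+s. ennreal (norm (real n * (s / (1 + s\<^sup>2)))) \<partial>M) < \<infinity>" by (simp only: integrable_iff_bounded)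
    moreover have "(\<integral>\<^sup>+s. indicator (A n) s \<partial>M) \<le> (\<integral>\<^sup>+s. ennreal (norm (real n * (s / (1 + s\<^sup>2)))) \<partial>M)"
    proof (rule nn_integral_mono)
      fix s
      show "indicator (A n) s \<le> ennreal (norm (real n * (s / (1 + s\<^sup>2))))"
      proof (cases "s \<in> A n")
        case True
        hence "1 \<le> norm (real n * (s / (1 + s\<^sup>2)))" unfolding A_def real_norm_def using abs_ge_self order.trans by blast
        thus ?thesis using True by (simp del: real_norm_def)
      qed simp
    qed
    ultimately show ?thesis using A by (simp add: less_top order.strict_trans1 top_unique)
  qed
  moreover have "\<Union> (range A) = space M"
  proof
    show "space M \<subseteq> \<Union> (range A)"
    proof
      fix s assume s: "s \<in> space M"
      hence s0: "0 < s / (1 + s\<^sup>2)" by (simp add: space_M add_pos_nonneg)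
      then obtain n :: nat where "1 < real n * (s / (1 + s\<^sup>2))" using reals_Archimedean3 by blast
      hence "s \<in> A n" unfolding A_def mem_Collect_eq by (intro conjI s less_imp_le)
      thus "s \<in> \<Union> (range A)" by blast
    qed
  qed (auto simp: A_def)
  ultimately show "\<exists>A. countable A \<and> A \<subseteq> sets M \<and> \<Union> A = space M \<and> (\<forall>a\<in>A. emeasure M a \<noteq> \<infinity>)"
    using A by (intro exI[of _ "range A"]) auto
qed

sublocale pair_sigma_finite M lborel
  by (intro pair_sigma_finite.intro sigma_finite_M sigma_finite_lborel)

lemma measurable_fst_borel [measurable]: "fst \<in> borel_measurable (M \<Otimes>\<^sub>M lborel)"
  using measurable_compose[OF measurable_fst ident_measurable] by simp

lemma measurable_snd_borel [measurable]: "snd \<in> borel_measurable (M \<Otimes>\<^sub>M lborel)"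
  using measurable_snd[of M "lborel :: real measure"] by simp

text \<open>Joint measurability is inherited from \<open>L_sum\<close>, which is an explicit
  expression in both variables, whereas \<open>L\<close> is defined through
  \<open>remove_sings\<close>.\<close>

lemma measurable_L_pair [measurable]: "(\<lambda>p. L (fst p) (of_real (snd p))) \<in> borel_measurable (M \<Otimes>\<^sub>M lborel)"
proof (rule borel_measurable_LIMSEQ_metric)
  show "(\<lambda>p. L_sum N (fst p) (of_real (snd p))) \<in> borel_measurable (M \<Otimes>\<^sub>M lborel)" for N
    unfolding L_sum_def L_term_def k1_def k2_def by measurable
  show "(\<lambda>N. L_sum N (fst p) (of_real (snd p))) \<longlonglongrightarrow> L (fst p) (of_real (snd p))" if "p \<in> space (M \<Otimes>\<^sub>M lborel)" for p
    using that by (intro L_sum_tendsto) (auto simp: space_pair_measure space_M)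
qed

lemma measurable_L_sum: "(\<lambda>s. L_sum N s z) \<in> borel_measurable M"
  unfolding L_sum_def L_term_def by measurable

lemma measurable_L: "(\<lambda>s. L s z) \<in> borel_measurable M"
  by (rule borel_measurable_LIMSEQ_metric[OF measurable_L_sum L_sum_tendsto]) (simp add: space_M)

lemma measurable_gap_pair [measurable]: "(\<lambda>p. gap (fst p) (snd p)) \<in> borel_measurable (M \<Otimes>\<^sub>M lborel)"
  unfolding gap_def by measurable

lemma measurable_gap: "(\<lambda>s. gap s x) \<in> borel_measurable M"
proof -
  have [measurable]: "(\<lambda>s. L s (of_real x)) \<in> borel_measurable M" by (rule measurable_L)
  show ?thesis unfolding gap_def by measurable
qed

section \<open>The function \<open>f_mu\<close> away from 0\<close>

text \<open>A real-valued stand-in for \<open>f_mu\<close>. At 0 the integrand may fail to be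
  integrable; then \<open>f 0\<close> is the default 0, while \<open>f_mu M 0\<close> is
  infinite.\<close>

definition f :: "real \<Rightarrow> real" where "f x = (\<integral>s. exp (- s * \<bar>x\<bar>) - exp (- s) \<partial>M)"
definition df :: "real \<Rightarrow> real" where "df x = (\<integral>s. s * exp (- s * \<bar>x\<bar>) \<partial>M)"

text \<open>As \<open>s\<close> tends to 0 both exponentials tend to 1, and only their difference is
  of order \<open>s\<close>, as the weight demands. The positive minimum \<open>m\<close> of the two
  exponents gives the decay at infinity.\<close>

lemma integrable_f_integrand:
  assumes "x \<noteq> 0"
  shows "integrable M (\<lambda>s. exp (- s * \<bar>x\<bar>) - exp (- s))"
proof (rule integrable_dominated)
  define m where "m = min \<bar>x\<bar> 1"
  have m: "0 < m" "m \<le> \<bar>x\<bar>" "m \<le> 1" using assms by (auto simp: m_def)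
  show "norm (exp (- s * \<bar>x\<bar>) - exp (- s)) \<le> ((1 + 3 / m) ^ 3 * \<bar>\<bar>x\<bar> - 1\<bar>) * (s / (1 + s\<^sup>2))" if s: "0 < s" for s
  proof -
    have "\<bar>exp (- s * \<bar>x\<bar>) - exp (- s * 1)\<bar> \<le> s * exp (- s * m) * \<bar>\<bar>x\<bar> - 1\<bar>" by (rule exp_neg_diff_le[OF s m(2,3)])
    also have "\<dots> \<le> ((1 + 3 / m) ^ 3 * (s / (1 + s\<^sup>2))) * \<bar>\<bar>x\<bar> - 1\<bar>" by (intro mult_right_mono exp_decay m s) auto
    finally show ?thesis by (simp add: mult_ac)
  qed
qed measurable

lemma integrable_df_integrand: "x \<noteq> 0 \<Longrightarrow> integrable M (\<lambda>s. s * exp (- s * \<bar>x\<bar>))"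
  by (rule integrable_dominated[where C = "(1 + 3 / \<bar>x\<bar>) ^ 3"]) (use exp_decay[of "\<bar>x\<bar>"] in \<open>auto simp: abs_mult\<close>)

lemma f_mu_eq: "x \<noteq> 0 \<Longrightarrow> f_mu M x = ereal (f x)"
  unfolding f_mu_def f_def by (intro ext_integral_eq_integral integrable_f_integrand)

lemma f_minus_arg: "f (- x) = f x" by (simp add: f_def)

text \<open>Differentiation under the integral sign, along sequences. From some index on
  \<open>X i > a / 2\<close>, which gives all difference quotients a common majorant.\<close>

lemma f_deriv_pos:
  assumes a: "0 < a"
  shows "(f has_real_derivative - df a) (at a)"
  unfolding has_field_derivative_iff tendsto_at_iff_sequentially
proof (intro allI impI)
  fix X assume X: "\<forall>i. X i \<in> UNIV - {a}" "X \<longlonglongrightarrow> a"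
  define m where "m = a / 2"
  have m: "0 < m" "m < a" using a by (simp_all add: m_def)
  define g where "g = (\<lambda>i s. (exp (- s * X i) - exp (- s * a)) / (X i - a))"
  have ev: "\<forall>\<^sub>F i in sequentially. m < X i" using order_tendstoD(1)[OF X(2) m(2)] .
  then obtain N where N: "\<And>i. N \<le> i \<Longrightarrow> m < X i" by (auto simp: eventually_sequentially)
  have "(\<lambda>i. \<integral>s. g (i + N) s \<partial>M) \<longlonglongrightarrow> (\<integral>s. - (s * exp (- s * \<bar>a\<bar>)) \<partial>M)"
  proof (rule integral_dominated_convergence[where w = "\<lambda>s. (1 + 3 / m) ^ 3 * (s / (1 + s\<^sup>2))"])
    show "(\<lambda>s. - (s * exp (- s * \<bar>a\<bar>))) \<in> borel_measurable M" by measurable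
    show "(\<lambda>s. g (i + N) s) \<in> borel_measurable M" for i unfolding g_def by measurable
    show "integrable M (\<lambda>s. (1 + 3 / m) ^ 3 * (s / (1 + s\<^sup>2)))" by (intro integrable_mult_right integrable_weight)
    show "AE s in M. (\<lambda>i. g (i + N) s) \<longlonglongrightarrow> - (s * exp (- s * \<bar>a\<bar>))"
    proof (rule AE_I2)
      fix s :: real
      have "((\<lambda>x. exp (- s * x)) has_real_derivative - (s * exp (- s * \<bar>a\<bar>))) (at a)"
        using a by (auto intro!: derivative_eq_intros)
      hence "((\<lambda>y. (exp (- s * y) - exp (- s * a)) / (y - a)) \<circ> X) \<longlonglongrightarrow> - (s * exp (- s * \<bar>a\<bar>))"
        using X unfolding has_field_derivative_iff tendsto_at_iff_sequentially by blast
      hence "(\<lambda>i. g i s) \<longlonglongrightarrow> - (s * exp (- s * \<bar>a\<bar>))" by (simp add: g_def o_def)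
      thus "(\<lambda>i. g (i + N) s) \<longlonglongrightarrow> - (s * exp (- s * \<bar>a\<bar>))" by (rule LIMSEQ_ignore_initial_segment)
    qed
    show "AE s in M. norm (g (i + N) s) \<le> (1 + 3 / m) ^ 3 * (s / (1 + s\<^sup>2))" for i
    proof (rule AE_I2)
      fix s assume "s \<in> space M"
      hence s: "0 < s" by (simp add: space_M)
      have Xa: "X (i + N) - a \<noteq> 0" using X(1) by simp
      have "\<bar>exp (- s * X (i + N)) - exp (- s * a)\<bar> \<le> s * exp (- s * m) * \<bar>X (i + N) - a\<bar>"
        using N[of "i + N"] m by (intro exp_neg_diff_le s) auto
      hence "norm (g (i + N) s) \<le> s * exp (- s * m)" using Xa by (simp add: g_def divide_le_eq)
      also have "\<dots> \<le> (1 + 3 / m) ^ 3 * (s / (1 + s\<^sup>2))" by (rule exp_decay[OF m(1) s])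
      finally show "norm (g (i + N) s) \<le> (1 + 3 / m) ^ 3 * (s / (1 + s\<^sup>2))" .
    qed
  qed
  moreover have "(\<integral>s. g (i + N) s \<partial>M) = (f (X (i + N)) - f a) / (X (i + N) - a)" for i
  proof -
    have Xp: "0 < X (i + N)" using N[of "i + N"] m by simp
    have "f (X (i + N)) - f a = (\<integral>s. (exp (- s * \<bar>X (i + N)\<bar>) - exp (- s)) - (exp (- s * \<bar>a\<bar>) - exp (- s)) \<partial>M)"
      unfolding f_def using Xp a by (intro Bochner_Integration.integral_diff[symmetric] integrable_f_integrand) auto
    also have "\<dots> = (\<integral>s. exp (- s * X (i + N)) - exp (- s * a) \<partial>M)" using Xp a by simp
    finally show ?thesis by (simp add: g_def)
  qed
  ultimately have "(\<lambda>i. (f (X (i + N)) - f a) / (X (i + N) - a)) \<longlonglongrightarrow> - df a"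
    unfolding df_def by simp
  thus "((\<lambda>y. (f y - f a) / (y - a)) \<circ> X) \<longlonglongrightarrow> - df a"
    unfolding o_def by (rule LIMSEQ_offset)
qed

lemma f_deriv:
  assumes "a \<noteq> 0"
  shows "(f has_real_derivative - sgn a * df a) (at a)"
proof (cases "0 < a")
  case True
  thus ?thesis using f_deriv_pos by simp
next
  case False
  hence a: "0 < - a" using assms by simp
  have "(f has_real_derivative - df (- a)) (at (- a))" by (rule f_deriv_pos[OF a])
  hence "((\<lambda>x. f (- x)) has_real_derivative - df (- a)) (at (- a))" by (simp add: f_minus_arg)
  hence "(f has_real_derivative df (- a)) (at a)" using DERIV_mirror[where f = f and x = "- a" and y = "df (- a)"] by simp
  thus ?thesis using a by (simp add: df_def)
qed

lemma deriv_f_mu: "a \<noteq> 0 \<Longrightarrow> deriv (\<lambda>x. real_of_ereal (f_mu M x)) a = - sgn a * df a"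
  by (rule DERIV_imp_deriv, rule has_field_derivative_transform_within_open[OF f_deriv, of _ "- {0}"])
    (auto simp: f_mu_eq)

section \<open>The interpolating function \<open>G_mu\<close>\<close>

text \<open>With \<open>n\<close> from \<open>- N\<close> to \<open>N + 1\<close> the nodes
  \<open>n - 1/2\<close> are symmetric about 0 and fold into pairs.\<close>

lemma G_partial_eq: "G_partial M N = (\<lambda>z. \<Sum>j\<le>N. (of_real (f (real j + 1/2)) * k2 (real j + 1/2) z - of_real (df (real j + 1/2)) * k1 (real j + 1/2) z)
    + (of_real (f (real j + 1/2)) * k2 (real j + 1/2) (- z) - of_real (df (real j + 1/2)) * k1 (real j + 1/2) (- z)))"
  (is "_ = ?G")
  unfolding G_partial_def
proof (rule remove_sings_half_integers)
  show "?G holomorphic_on UNIV"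
    by (intro holomorphic_intros holomorphic_reflect[of "k2 _"] holomorphic_reflect[of "k1 _"])
  fix z :: complex assume z: "cos (of_real pi * z) \<noteq> 0"
  define K where "K = (cos (of_real pi * z) / of_real pi)\<^sup>2"
  define g where "g = (\<lambda>h. of_real (f h) * k2 h z - of_real (sgn h * df h) * k1 h z)"
  have nz: "of_int n - 1/2 \<noteq> (0::real)" for n :: int
  proof
    assume "of_int n - 1/2 = (0::real)"
    hence "of_int (2 * n) = (of_int 1 :: real)" by simp
    hence "2 * n = 1" by (simp only: of_int_eq_iff)
    thus False by presburger
  qed
  have "K * (of_real (real_of_ereal (f_mu M (of_int n - 1/2))) / (z - of_int n + 1/2)\<^sup>2
       + of_real (deriv (\<lambda>x. real_of_ereal (f_mu M x)) (of_int n - 1/2)) / (z - of_int n + 1/2)) = g (of_int n - 1/2)" for n :: int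
  proof -
    define h where "h = (of_int n - 1/2 :: real)"
    have h: "h = of_int (n - 1) + 1/2" by (simp add: h_def)
    have KK: "K = (z - of_real h)\<^sup>2 * k2 h z" unfolding K_def cos_sq_k2[of z "n - 1"] h by simp
    have zh: "z - of_real h \<noteq> 0" using KK z by (auto simp: K_def)
    have w: "z - of_int n + 1/2 = z - of_real h" by (simp add: h_def)
    have Kw: "K / (z - of_real h)\<^sup>2 = k2 h z" "K / (z - of_real h) = k1 h z"
      using zh unfolding KK k1_def by (simp_all add: power2_eq_square)
    have h0: "h \<noteq> 0" using nz[of n] by (simp add: h_def)
    have "K * (F / w\<^sup>2 + D / w) = F * (K / w\<^sup>2) + D * (K / w)" for F D w :: complex by (simp add: distrib_left mult.commute)
    hence "K * (of_real (f h) / (z - of_real h)\<^sup>2 + of_real (- sgn h * df h) / (z - of_real h)) = g h"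
      unfolding g_def by (simp only: Kw of_real_minus mult_minus_left) simp
    thus ?thesis unfolding h_def[symmetric] w f_mu_eq[OF h0] deriv_f_mu[OF h0] by simp
  qed
  hence "K * ((\<Sum>n = - int N..int N + 1. of_real (real_of_ereal (f_mu M (of_int n - 1/2))) / (z - of_int n + 1/2)\<^sup>2)
      + (\<Sum>n = - int N..int N + 1. of_real (deriv (\<lambda>x. real_of_ereal (f_mu M x)) (of_int n - 1/2)) / (z - of_int n + 1/2)))
     = (\<Sum>n = - int N..int N + 1. g (of_int n - 1/2))"
    by (simp only: sum.distrib[symmetric] sum_distrib_left)
  also have "\<dots> = (\<Sum>k\<in>{- int N - 1..int N}. g (of_int k + 1/2))"
    by (rule sum.reindex_bij_witness[of _ "\<lambda>k. k + 1" "\<lambda>n. n - 1"]) auto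
  also have "\<dots> = (\<Sum>j\<le>N. g (real j + 1/2) + g (- (real j + 1/2)))" by (rule sum_half_integers)
  also have "\<dots> = ?G z"
  proof (rule sum.cong[OF refl])
    fix j :: nat
    define a where "a = real j + 1/2"
    have a: "0 < a" by (simp add: a_def)
    show "g (real j + 1/2) + g (- (real j + 1/2)) =
     (of_real (f (real j + 1/2)) * k2 (real j + 1/2) z - of_real (df (real j + 1/2)) * k1 (real j + 1/2) z)
    + (of_real (f (real j + 1/2)) * k2 (real j + 1/2) (- z) - of_real (df (real j + 1/2)) * k1 (real j + 1/2) (- z))"
      unfolding a_def[symmetric] g_def k2_neg k1_neg f_minus_arg using a by (simp add: df_def)
  qed
  finally show "(cos (of_real pi * z) / of_real pi)\<^sup>2 * ((\<Sum>n = - int N..int N + 1. of_real (real_of_ereal (f_mu M (of_int n - 1/2))) / (z - of_int n + 1/2)\<^sup>2)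
      + (\<Sum>n = - int N..int N + 1. of_real (deriv (\<lambda>x. real_of_ereal (f_mu M x)) (of_int n - 1/2)) / (z - of_int n + 1/2))) = ?G z"
    unfolding K_def .
qed

lemma holomorphic_G_partial: "G_partial M N holomorphic_on UNIV"
  unfolding G_partial_eq by (intro holomorphic_intros holomorphic_reflect[of "k2 _"] holomorphic_reflect[of "k1 _"])

text \<open>Linearity of the integral in finite sums. The \<open>exp (- s)\<close> in the integrand
  of \<open>f_mu\<close> becomes the multiple of \<open>K_sum\<close>.\<close>

lemma G_partial_integral: "G_partial M N z = (\<integral>s. L_sum N s z - of_real (exp (- s)) * K_sum N z \<partial>M)"
proof -
  define A where "A = (\<lambda>a w s. of_real (exp (- s * \<bar>a\<bar>) - exp (- s)) * k2 a w - of_real (s * exp (- s * \<bar>a\<bar>)) * k1 a w)"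
  have A: "integrable M (A a w)" "(\<integral>s. A a w s \<partial>M) = of_real (f a) * k2 a w - of_real (df a) * k1 a w" if "a \<noteq> 0" for a w
  proof -
    have 1: "integrable M (\<lambda>s. of_real (exp (- s * \<bar>a\<bar>) - exp (- s)) * k2 a w)"
      by (intro integrable_mult_left integrable_of_real integrable_f_integrand that)
    have 2: "integrable M (\<lambda>s. of_real (s * exp (- s * \<bar>a\<bar>)) * k1 a w)"
      by (intro integrable_mult_left integrable_of_real integrable_df_integrand that)
    show "integrable M (A a w)" unfolding A_def by (intro Bochner_Integration.integrable_diff 1 2)
    show "(\<integral>s. A a w s \<partial>M) = of_real (f a) * k2 a w - of_real (df a) * k1 a w"
      unfolding A_def Bochner_Integration.integral_diff[OF 1 2] f_def df_def
      by (simp only: integral_mult_left_zero integral_complex_of_real)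
  qed
  have eq: "L_sum N s z - of_real (exp (- s)) * K_sum N z = (\<Sum>j\<le>N. A (real j + 1/2) z s + A (real j + 1/2) (- z) s)" for s
    unfolding L_sum_def K_sum_def sum_distrib_left
    by (subst sum_subtractf[symmetric]) (simp add: A_def L_term_def algebra_simps)
  show ?thesis
    unfolding eq G_partial_eq
    by (subst Bochner_Integration.integral_sum) (auto intro!: Bochner_Integration.integrable_add A simp: A)
qed

text \<open>What the limit of \<open>G_partial\<close> has to be, as \<open>L_sum\<close> tends to
  \<open>L\<close> and \<open>K_sum\<close> to 1.\<close>

definition G :: "complex \<Rightarrow> complex" where "G z = (\<integral>s. L s z - of_real (exp (- s)) \<partial>M)"

definition weight :: real where "weight = (\<integral>s. s / (1 + s\<^sup>2) \<partial>M)"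

lemma weight_nonneg: "0 \<le> weight"
  unfolding weight_def by (rule Bochner_Integration.integral_nonneg) (simp add: space_M)

lemma integrable_G_integrand: "integrable M (\<lambda>s. L s z - of_real (exp (- s)))"
proof -
  obtain C where C: "\<And>s z. 0 < s \<Longrightarrow> norm (L s z - of_real (exp (- s))) \<le> C * (s / (1 + s\<^sup>2)) * exp ((2 * pi + 1) * norm z)"
    by (rule L_minus_exp_le[of 1]) (simp, rule that)
  have [measurable]: "(\<lambda>s. L s z) \<in> borel_measurable M" by (rule measurable_L)
  show ?thesis
  proof (rule integrable_dominated)
    show "norm (L s z - of_real (exp (- s))) \<le> (C * exp ((2 * pi + 1) * norm z)) * (s / (1 + s\<^sup>2))" if "0 < s" for s
      using C[OF that, of z] by (simp add: mult_ac)
  qed measurable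
qed

text \<open>The bound from \<open>L_sum_minus_K_sum_le\<close> is independent of \<open>N\<close>,
  so it is both the majorant for the limit and the local bound that makes the limit
  holomorphic.\<close>

lemma G_partial_tendsto: "(\<lambda>N. G_partial M N z) \<longlonglongrightarrow> G z"
  and G_partial_bounded: "\<exists>B. \<forall>N z. norm z \<le> r \<longrightarrow> norm (G_partial M N z) \<le> B"
proof -
  obtain C where C0: "0 < C" and C: "\<And>N s z. 0 < s \<Longrightarrow>
    norm (L_sum N s z - of_real (exp (- s)) * K_sum N z) \<le> C * (s / (1 + s\<^sup>2)) * exp ((2 * pi + 1) * norm z)"
    by (rule L_sum_minus_K_sum_le[of 1]) (simp, rule that)
  have mL: "(\<lambda>s. L s z) \<in> borel_measurable M" for z by (rule measurable_L)
  have mLs: "(\<lambda>s. L_sum N s z) \<in> borel_measurable M" for N z by (rule measurable_L_sum)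
  have ms: "(\<lambda>s. L_sum N s z - of_real (exp (- s)) * K_sum N z) \<in> borel_measurable M" for N z
    using mLs[of N z] by measurable
  have w: "integrable M (\<lambda>s. C * (s / (1 + s\<^sup>2)) * exp ((2 * pi + 1) * norm z))" for z :: complex
    by (intro integrable_mult_left integrable_mult_right integrable_weight)
  have b: "AE s in M. norm (L_sum N s z - of_real (exp (- s)) * K_sum N z) \<le> C * (s / (1 + s\<^sup>2)) * exp ((2 * pi + 1) * norm z)" for N z
    by (rule AE_I2) (simp only: C space_M greaterThan_iff)
  show "(\<lambda>N. G_partial M N z) \<longlonglongrightarrow> G z"
    unfolding G_partial_integral G_def
  proof (rule integral_dominated_convergence[OF _ ms w _ b])
    show "(\<lambda>s. L s z - of_real (exp (- s))) \<in> borel_measurable M" using mL[of z] by measurable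
    show "AE s in M. (\<lambda>N. L_sum N s z - of_real (exp (- s)) * K_sum N z) \<longlonglongrightarrow> L s z - of_real (exp (- s))"
    proof (rule AE_I2)
      fix s assume "s \<in> space M"
      hence "(\<lambda>N. L_sum N s z - of_real (exp (- s)) * K_sum N z) \<longlonglongrightarrow> L s z - of_real (exp (- s)) * 1"
        by (intro tendsto_intros L_sum_tendsto K_sum_tendsto) (simp add: space_M)
      thus "(\<lambda>N. L_sum N s z - of_real (exp (- s)) * K_sum N z) \<longlonglongrightarrow> L s z - of_real (exp (- s))" by simp
    qed
  qed
  show "\<exists>B. \<forall>N z. norm z \<le> r \<longrightarrow> norm (G_partial M N z) \<le> B"
  proof (intro exI allI impI)
    fix N and z :: complex assume z: "norm z \<le> r"
    have "norm (G_partial M N z) \<le> (\<integral>s. C * (s / (1 + s\<^sup>2)) * exp ((2 * pi + 1) * norm z) \<partial>M)"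
      unfolding G_partial_integral
    proof (rule order.trans[OF integral_norm_bound integral_mono_AE[OF _ w b]])
      show "integrable M (\<lambda>s. norm (L_sum N s z - of_real (exp (- s)) * K_sum N z))"
      proof (intro integrable_norm integrable_dominated[OF ms])
        show "norm (L_sum N s z - of_real (exp (- s)) * K_sum N z) \<le> (C * exp ((2 * pi + 1) * norm z)) * (s / (1 + s\<^sup>2))"
          if "0 < s" for s
          by (rule order.trans[OF C[OF that]]) (simp only: mult_ac order.refl)
      qed
    qed
    also have "\<dots> = C * weight * exp ((2 * pi + 1) * norm z)"
      by (simp only: integral_mult_left_zero integral_mult_right_zero weight_def)
    also have "\<dots> \<le> C * weight * exp ((2 * pi + 1) * r)"
      using z C0 weight_nonneg by (intro mult_left_mono) (auto intro!: mult_left_mono)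
    finally show "norm (G_partial M N z) \<le> C * weight * exp ((2 * pi + 1) * r)" .
  qed
qed

lemma G_mu_eq: "G_mu M = G"
  by (rule ext) (simp add: G_mu_def limI[OF G_partial_tendsto])

lemma holomorphic_G: "G holomorphic_on UNIV"
  by (rule holomorphic_pointwise_limit[OF holomorphic_G_partial G_partial_bounded G_partial_tendsto])

lemma exp_type_G: "exp_type_at_most (2 * pi) G"
  unfolding exp_type_at_most_def
proof (intro allI impI)
  fix \<epsilon> :: real assume \<epsilon>: "0 < \<epsilon>"
  obtain C where C: "\<And>s z. 0 < s \<Longrightarrow> norm (L s z - of_real (exp (- s))) \<le> C * (s / (1 + s\<^sup>2)) * exp ((2 * pi + \<epsilon>) * norm z)"
    by (rule L_minus_exp_le[OF \<epsilon>]) (rule that)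
  have "norm (G z) \<le> (C * weight) * exp ((2 * pi + \<epsilon>) * norm z)" for z
  proof -
    have "norm (G z) \<le> (\<integral>s. C * (s / (1 + s\<^sup>2)) * exp ((2 * pi + \<epsilon>) * norm z) \<partial>M)"
      unfolding G_def
    proof (rule order.trans[OF integral_norm_bound integral_mono])
      show "integrable M (\<lambda>s. norm (L s z - of_real (exp (- s))))" by (intro integrable_norm integrable_G_integrand)
      show "integrable M (\<lambda>s. C * (s / (1 + s\<^sup>2)) * exp ((2 * pi + \<epsilon>) * norm z))"
        by (intro integrable_mult_left integrable_mult_right integrable_weight)
      show "norm (L s z - of_real (exp (- s))) \<le> C * (s / (1 + s\<^sup>2)) * exp ((2 * pi + \<epsilon>) * norm z)" if "s \<in> space M" for s
        using that by (intro C) (simp add: space_M)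
    qed
    also have "\<dots> = (C * weight) * exp ((2 * pi + \<epsilon>) * norm z)"
      by (simp only: integral_mult_left_zero integral_mult_right_zero weight_def)
    finally show ?thesis .
  qed
  thus "\<exists>C. \<forall>z. norm (G z) \<le> C * exp ((2 * pi + \<epsilon>) * norm z)" by blast
qed

lemma Re_G: "Re (G (of_real x)) = (\<integral>s. Re (L s (of_real x)) - exp (- s) \<partial>M)"
  and integrable_Re_G_integrand: "integrable M (\<lambda>s. Re (L s (of_real x)) - exp (- s))"
  and G_of_real: "G (of_real x) \<in> \<real>"
proof -
  note i = integrable_G_integrand[of "of_real x"]
  show "Re (G (of_real x)) = (\<integral>s. Re (L s (of_real x)) - exp (- s) \<partial>M)"
    unfolding G_def integral_Re[OF i, symmetric] by simp
  show "integrable M (\<lambda>s. Re (L s (of_real x)) - exp (- s))" using integrable_Re[OF i] by simp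
  have "Im (G (of_real x)) = (\<integral>s. 0 \<partial>M)"
    unfolding G_def integral_Im[OF i, symmetric]
    by (rule Bochner_Integration.integral_cong[OF refl]) (use L_of_real in \<open>simp add: space_M complex_is_Real_iff\<close>)
  thus "G (of_real x) \<in> \<real>" by (simp add: complex_is_Real_iff)
qed

lemma real_entire_G: "real_entire G"
  unfolding real_entire_def using holomorphic_G G_of_real by blast

section \<open>The difference \<open>f_mu - G_mu\<close> and its integrals\<close>

lemma integrable_gap_M:
  assumes "x \<noteq> 0"
  shows "integrable M (\<lambda>s. gap s x)"
proof (rule integrable_dominated[OF measurable_gap])
  show "norm (gap s x) \<le> (100 * ((cos (pi * x) / pi)\<^sup>2 / x\<^sup>2)) * (s / (1 + s\<^sup>2))" if "0 < s" for s
    using gap_nonneg[OF that, of x] gap_le[OF that assms] by (simp add: mult_ac)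
qed

text \<open>The difference \<open>f_mu - G_mu\<close> as a real function; as with \<open>f\<close>,
  its value at 0 is a default if the integral diverges there.\<close>

definition gam :: "real \<Rightarrow> real" where "gam x = (\<integral>s. gap s x \<partial>M)"

lemma f_minus_G: "x \<noteq> 0 \<Longrightarrow> f x - Re (G (of_real x)) = gam x"
  unfolding f_def Re_G gam_def gap_def
  by (simp only: Bochner_Integration.integral_diff[OF integrable_f_integrand integrable_Re_G_integrand, symmetric] not_False_eq_True)
    simp

lemma gam_nonneg: "0 \<le> gam x"
  unfolding gam_def by (rule Bochner_Integration.integral_nonneg) (simp add: space_M gap_nonneg)

lemma gam_le: "x \<noteq> 0 \<Longrightarrow> gam x \<le> 100 * weight * ((cos (pi * x) / pi)\<^sup>2 / x\<^sup>2)"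
proof -
  assume x: "x \<noteq> 0"
  have "gam x \<le> (\<integral>s. 100 * (s / (1 + s\<^sup>2)) * ((cos (pi * x) / pi)\<^sup>2 / x\<^sup>2) \<partial>M)"
    unfolding gam_def
  proof (rule integral_mono)
    show "integrable M (\<lambda>s. gap s x)" by (rule integrable_gap_M[OF x])
    show "integrable M (\<lambda>s. 100 * (s / (1 + s\<^sup>2)) * ((cos (pi * x) / pi)\<^sup>2 / x\<^sup>2))"
      by (intro integrable_mult_left integrable_mult_right integrable_weight)
    show "gap s x \<le> 100 * (s / (1 + s\<^sup>2)) * ((cos (pi * x) / pi)\<^sup>2 / x\<^sup>2)" if "s \<in> space M" for s
      using that by (intro gap_le x) (simp add: space_M)
  qed
  also have "\<dots> = 100 * weight * ((cos (pi * x) / pi)\<^sup>2 / x\<^sup>2)"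
    by (simp only: integral_mult_left_zero integral_mult_right_zero weight_def)
  finally show ?thesis .
qed

text \<open>If the integrand of \<open>f_mu\<close> is not integrable, which can happen only at
  \<open>x = 0\<close>, then \<open>gap\<close> is not integrable either, since the two differ by
  the integrable integrand of \<open>G\<close>. In that case both sides are infinite.\<close>

lemma f_minus_eq: "f_minus M G x = enn2ereal (\<integral>\<^sup>+s. ennreal (gap s x) \<partial>M)"
proof (cases "integrable M (\<lambda>s. exp (- s * \<bar>x\<bar>) - exp (- s))")
  case True
  have eq: "(\<lambda>s. gap s x) = (\<lambda>s. (exp (- s * \<bar>x\<bar>) - exp (- s)) - (Re (L s (of_real x)) - exp (- s)))"
    by (simp add: fun_eq_iff gap_def)
  have int: "integrable M (\<lambda>s. gap s x)"
    unfolding eq by (intro Bochner_Integration.integrable_diff True integrable_Re_G_integrand)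
  have "gam x = f x - Re (G (of_real x))"
    unfolding gam_def eq Bochner_Integration.integral_diff[OF True integrable_Re_G_integrand] f_def Re_G ..
  moreover have "f_mu M x = ereal (f x)" unfolding f_mu_def f_def by (rule ext_integral_eq_integral[OF True])
  moreover have "(\<integral>\<^sup>+s. ennreal (gap s x) \<partial>M) = ennreal (gam x)"
    unfolding gam_def by (rule nn_integral_eq_integral[OF int]) (auto intro!: AE_I2 simp: space_M gap_nonneg)
  ultimately show ?thesis using gam_nonneg[of x] by (simp add: f_minus_def)
next
  case False
  hence x: "x = 0" using integrable_f_integrand by blast
  have meas: "(\<lambda>s. exp (- s * \<bar>x\<bar>) - exp (- s)) \<in> borel_measurable M" by measurable
  have nn: "0 \<le> exp (- s * \<bar>x\<bar>) - exp (- s)" if "s \<in> space M" for s using that by (simp add: x space_M)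
  have "(\<integral>\<^sup>+s. ennreal (exp (- s * \<bar>x\<bar>) - exp (- s)) \<partial>M) = \<infinity>"
    using False integrableI_nonneg[OF meas] nn by (auto simp: less_top)
  hence "f_mu M x = \<infinity>"
    unfolding f_mu_def by (subst ext_integral_nonneg) (use nn in auto)
  moreover have "(\<integral>\<^sup>+s. ennreal (gap s x) \<partial>M) = \<infinity>"
  proof (rule ccontr)
    assume "\<not> ?thesis"
    hence "integrable M (\<lambda>s. gap s x)"
      by (intro integrableI_nonneg measurable_gap) (auto intro!: AE_I2 simp: space_M gap_nonneg less_top)
    from Bochner_Integration.integrable_add[OF this integrable_Re_G_integrand[of x]]
    show False using False by (simp add: gap_def)
  qed
  ultimately show ?thesis by (simp add: f_minus_def)
qed

lemma ext_integral_gap: "ext_integral M (\<lambda>s. ereal (gap s x)) = enn2ereal (\<integral>\<^sup>+s. ennreal (gap s x) \<partial>M)"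
  by (subst ext_integral_nonneg) (auto simp: space_M gap_nonneg)

lemma nn_integral_gap: "x \<noteq> 0 \<Longrightarrow> (\<integral>\<^sup>+s. ennreal (gap s x) \<partial>M) = ennreal (gam x)"
  unfolding gam_def by (rule nn_integral_eq_integral[OF integrable_gap_M]) (auto intro!: AE_I2 simp: space_M gap_nonneg)

lemma real_f_minus: "x \<noteq> 0 \<Longrightarrow> real_of_ereal (f_minus M G x) = gam x"
  by (simp add: f_minus_eq nn_integral_gap gam_nonneg)

definition gap_total :: "real \<Rightarrow> real" where "gap_total s = 2 / s - 1 / sinh (s / 2)"

lemma gap_total_eq: "0 < s \<Longrightarrow> gap_total s = (\<integral>x. gap s x \<partial>lborel)"
  by (simp add: gap_total_def integral_gap)

lemma gap_total_nonneg: "0 < s \<Longrightarrow> 0 \<le> gap_total s"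
  unfolding gap_total_eq by (intro Bochner_Integration.integral_nonneg gap_nonneg)

text \<open>For small \<open>s\<close> the two terms nearly cancel: with \<open>y = s / 2\<close>,
  the inequality \<open>sinh y - y \<le> y\<^sup>2 * sinh y\<close> leaves at most \<open>y\<close>.
  For large \<open>s\<close> the term \<open>2 / s\<close> alone is of the size of the
  weight.\<close>

lemma gap_total_le:
  assumes s: "0 < s"
  shows "gap_total s \<le> 4 * (s / (1 + s\<^sup>2))"
proof (cases "s \<le> 1")
  case True
  define y where "y = s / 2"
  have y: "0 < y" using s by (simp add: y_def)
  have sy: "0 < sinh y" using y by simp
  have 1: "0 \<le> x * sinh x - (cosh x - 1)" if "0 \<le> x" for x :: real
    by (rule deriv_nonneg_imp_ge_0[where f = "\<lambda>x. x * sinh x - (cosh x - 1)" and g = "\<lambda>x. x * cosh x", OF that])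
      (auto intro!: derivative_eq_intros)
  have "0 \<le> y\<^sup>2 * sinh y - sinh y + y"
  proof (rule deriv_nonneg_imp_ge_0[where f = "\<lambda>x. x\<^sup>2 * sinh x - sinh x + x" and g = "\<lambda>x. 2 * x * sinh x + x\<^sup>2 * cosh x - cosh x + 1"])
    fix x :: real assume x: "0 \<le> x"
    have "0 \<le> x * sinh x" "0 \<le> x\<^sup>2 * cosh x" using x by simp_all
    thus "0 \<le> 2 * x * sinh x + x\<^sup>2 * cosh x - cosh x + 1" using 1[OF x] by linarith
  qed (use y in \<open>auto intro!: derivative_eq_intros\<close>)
  hence le: "sinh y - y \<le> y * (y * sinh y)" by (simp add: power2_eq_square)
  have "gap_total s = (sinh y - y) / (y * sinh y)"
    unfolding gap_total_def y_def[symmetric] using y sy s by (simp add: y_def field_simps)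
  also have "\<dots> \<le> y" using le y sy by (simp add: divide_le_eq)
  also have "\<dots> \<le> 4 * (s / (1 + s\<^sup>2))"
  proof -
    have "s\<^sup>2 \<le> 1" using s True by (simp add: power_le_one)
    hence "s / 2 * (1 + s\<^sup>2) \<le> s / 2 * 8" using s by (intro mult_left_mono) auto
    thus ?thesis by (simp add: y_def field_simps add_pos_nonneg)
  qed
  finally show ?thesis .
next
  case False
  have "gap_total s \<le> 2 / s" using s by (simp add: gap_total_def)
  also have "\<dots> \<le> 4 * (s / (1 + s\<^sup>2))"
  proof -
    have "1 \<le> s\<^sup>2" using False by (intro one_le_power) simp
    hence "2 * (1 + s\<^sup>2) \<le> 4 * s * s" by (simp add: power2_eq_square)
    thus ?thesis using s by (simp add: field_simps add_pos_nonneg)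
  qed
  finally show ?thesis .
qed

lemma nn_integral_gap_real: "0 < s \<Longrightarrow> (\<integral>\<^sup>+x. ennreal (gap s x) \<partial>lborel) = ennreal (gap_total s)"
  unfolding gap_total_eq by (rule nn_integral_eq_integral[OF integrable_gap]) (auto simp: gap_nonneg)

lemma Tonelli_gap:
  "(\<integral>\<^sup>+x. (\<integral>\<^sup>+s. ennreal (gap s x) \<partial>M) \<partial>lborel) = (\<integral>\<^sup>+s. ennreal (gap_total s) \<partial>M)"
proof -
  have "(\<lambda>p. ennreal (gap (fst p) (snd p))) \<in> borel_measurable (M \<Otimes>\<^sub>M lborel)" by measurable
  from Fubini[OF this] have "(\<integral>\<^sup>+x. (\<integral>\<^sup>+s. ennreal (gap s x) \<partial>M) \<partial>lborel) = (\<integral>\<^sup>+s. (\<integral>\<^sup>+x. ennreal (gap s x) \<partial>lborel) \<partial>M)"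
    by simp
  also have "\<dots> = (\<integral>\<^sup>+s. ennreal (gap_total s) \<partial>M)"
    by (intro nn_integral_cong nn_integral_gap_real) (simp add: space_M)
  finally show ?thesis .
qed

lemma nn_integral_gap_total_finite: "(\<integral>\<^sup>+s. ennreal (gap_total s) \<partial>M) < \<infinity>"
proof -
  have "(\<integral>\<^sup>+s. ennreal (gap_total s) \<partial>M) \<le> (\<integral>\<^sup>+s. ennreal (4 * (s / (1 + s\<^sup>2))) \<partial>M)"
    by (intro nn_integral_mono ennreal_leI gap_total_le) (simp add: space_M)
  also have "\<dots> = ennreal (\<integral>s. 4 * (s / (1 + s\<^sup>2)) \<partial>M)"
    by (intro nn_integral_eq_integral integrable_mult_right integrable_weight AE_I2) (simp add: space_M)
  finally show ?thesis by (simp add: order.strict_trans1)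
qed

lemma measurable_nn_gap [measurable]: "(\<lambda>x. \<integral>\<^sup>+s. ennreal (gap s x) \<partial>M) \<in> borel_measurable lborel"
proof -
  have [measurable]: "(\<lambda>p. gap (snd p) (fst p)) \<in> borel_measurable (lborel \<Otimes>\<^sub>M M)"
    using measurable_compose[OF measurable_pair_swap' measurable_gap_pair] by (simp add: split_beta')
  have "(\<lambda>(x, s). ennreal (gap s x)) \<in> borel_measurable (lborel \<Otimes>\<^sub>M M)"
    unfolding split_beta' by measurable
  from sigma_finite_measure.borel_measurable_nn_integral_fst[OF sigma_finite_M this] show ?thesis by simp
qed

lemma measurable_gam [measurable]: "gam \<in> borel_measurable lborel"
proof -
  have [measurable]: "(\<lambda>p. gap (snd p) (fst p)) \<in> borel_measurable (lborel \<Otimes>\<^sub>M M)"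
    using measurable_compose[OF measurable_pair_swap' measurable_gap_pair] by (simp add: split_beta')
  have "(\<lambda>(x, s). gap s x) \<in> borel_measurable (lborel \<Otimes>\<^sub>M M)"
    unfolding split_beta' by measurable
  from sigma_finite_measure.borel_measurable_lebesgue_integral[OF sigma_finite_M this]
  show ?thesis unfolding gam_def .
qed

lemma nn_integral_gam: "(\<integral>\<^sup>+x. ennreal (gam x) \<partial>lborel) = (\<integral>\<^sup>+s. ennreal (gap_total s) \<partial>M)"
proof -
  have "(\<integral>\<^sup>+x. ennreal (gam x) \<partial>lborel) = (\<integral>\<^sup>+x. (\<integral>\<^sup>+s. ennreal (gap s x) \<partial>M) \<partial>lborel)"
  proof (rule nn_integral_cong_AE)
    show "AE x in lborel. ennreal (gam x) = (\<integral>\<^sup>+s. ennreal (gap s x) \<partial>M)"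
      using AE_lborel_singleton[of "0::real"] by eventually_elim (simp add: nn_integral_gap)
  qed
  thus ?thesis by (simp add: Tonelli_gap)
qed

lemma integrable_gam: "integrable lborel gam"
proof (rule integrableI_nonneg)
  show "(\<integral>\<^sup>+x. ennreal (gam x) \<partial>lborel) < \<infinity>"
    unfolding nn_integral_gam by (rule nn_integral_gap_total_finite)
qed (simp_all add: gam_nonneg)

lemma ext_integral_f_minus_G: "ext_integral lborel (f_minus M G) = ereal (\<integral>x. gam x \<partial>lborel)"
proof -
  have "ext_integral lborel (f_minus M G) = enn2ereal (\<integral>\<^sup>+x. (\<integral>\<^sup>+s. ennreal (gap s x) \<partial>M) \<partial>lborel)"
    by (subst ext_integral_nonneg) (simp_all add: f_minus_eq)
  also have "\<dots> = enn2ereal (\<integral>\<^sup>+x. ennreal (gam x) \<partial>lborel)" by (simp only: Tonelli_gap nn_integral_gam)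
  also have "(\<integral>\<^sup>+x. ennreal (gam x) \<partial>lborel) = ennreal (\<integral>x. gam x \<partial>lborel)"
    by (rule nn_integral_eq_integral[OF integrable_gam]) (simp add: gam_nonneg)
  finally show ?thesis by (simp add: Bochner_Integration.integral_nonneg gam_nonneg)
qed

lemma ext_integral_f_minus_G_eq: "ext_integral lborel (f_minus M G) = ext_integral M (\<lambda>s. ereal (2 / s - 1 / sinh (s / 2)))"
proof -
  have "ext_integral lborel (f_minus M G) = enn2ereal (\<integral>\<^sup>+s. ennreal (gap_total s) \<partial>M)"
    by (subst ext_integral_nonneg) (simp_all add: f_minus_eq Tonelli_gap)
  also have "\<dots> = ext_integral M (\<lambda>s. ereal (gap_total s))"
    by (subst ext_integral_nonneg) (auto simp: space_M gap_total_nonneg)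
  finally show ?thesis by (simp only: gap_total_def)
qed

lemma ext_integrable_f_minus_G: "ext_integrable lborel (f_minus M G)"
  unfolding ext_integrable_def
proof
  have eq: "f_minus M G = (\<lambda>x. enn2ereal (\<integral>\<^sup>+s. ennreal (gap s x) \<partial>M))" by (rule ext) (rule f_minus_eq)
  show "f_minus M G \<in> borel_measurable lborel" unfolding eq by measurable
  show "(\<integral>\<^sup>+x. e2ennreal \<bar>f_minus M G x\<bar> \<partial>lborel) < \<infinity>"
    unfolding f_minus_eq using nn_integral_gap_total_finite by (simp add: Tonelli_gap)
qed

text \<open>Multiplication by \<open>e\<close> does not change absolute values, so the finite double
  integral of \<open>gap\<close> justifies Fubini's theorem. Making \<open>f_minus\<close>
  real-valued can affect it only at 0, a null set.\<close>

lemma fourier_f_minus_G: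
  assumes t: "t \<noteq> 0"
  shows "integrable lborel (\<lambda>x. of_real (real_of_ereal (f_minus M G x)) * e (of_real (- t * x)))"
    and "integrable M (\<lambda>s. 2 * s / (s\<^sup>2 + 4 * pi\<^sup>2 * t\<^sup>2))"
    and "integrable M (\<lambda>s. L_hat s t)"
    and "(\<integral>x. of_real (real_of_ereal (f_minus M G x)) * e (of_real (- t * x)) \<partial>lborel) =
         of_real (\<integral>s. 2 * s / (s\<^sup>2 + 4 * pi\<^sup>2 * t\<^sup>2) \<partial>M) - (\<integral>s. L_hat s t \<partial>M)"
proof -
  define \<phi> :: "real \<Rightarrow> real \<Rightarrow> complex" where "\<phi> = (\<lambda>s x. of_real (gap s x) * e (of_real (- t * x)))"
  have n\<phi>: "norm (\<phi> s x) = gap s x" if "0 < s" for s x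
    unfolding \<phi>_def norm_mult norm_e_real norm_of_real using gap_nonneg[OF that, of x] by simp
  have int: "integrable (M \<Otimes>\<^sub>M lborel) (\<lambda>p. \<phi> (fst p) (snd p))"
  proof (rule integrableI_bounded)
    show m: "(\<lambda>p. \<phi> (fst p) (snd p)) \<in> borel_measurable (M \<Otimes>\<^sub>M lborel)" unfolding \<phi>_def by measurable
    have "(\<integral>\<^sup>+p. ennreal (norm (\<phi> (fst p) (snd p))) \<partial>(M \<Otimes>\<^sub>M lborel)) = (\<integral>\<^sup>+s. (\<integral>\<^sup>+x. ennreal (norm (\<phi> s x)) \<partial>lborel) \<partial>M)"
      using m by (subst lborel.nn_integral_fst[symmetric]) auto
    also have "\<dots> = (\<integral>\<^sup>+s. ennreal (gap_total s) \<partial>M)"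
      by (intro nn_integral_cong) (simp add: space_M n\<phi> nn_integral_gap_real)
    finally show "(\<integral>\<^sup>+p. ennreal (norm (\<phi> (fst p) (snd p))) \<partial>(M \<Otimes>\<^sub>M lborel)) < \<infinity>"
      using nn_integral_gap_total_finite by simp
  qed
  hence int': "integrable (M \<Otimes>\<^sub>M lborel) (case_prod \<phi>)" by (simp add: split_beta')
  have g: "of_real (gam x) * e (of_real (- t * x)) = (\<integral>s. \<phi> s x \<partial>M)" for x
    unfolding \<phi>_def gam_def by (simp only: integral_mult_left_zero integral_complex_of_real)
  have ae: "AE x in lborel. of_real (real_of_ereal (f_minus M G x)) * e (of_real (- t * x)) = of_real (gam x) * e (of_real (- t * x))"
    using AE_lborel_singleton[of "0::real"] by eventually_elim (simp add: real_f_minus)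
  have "f_minus M G = (\<lambda>x. enn2ereal (\<integral>\<^sup>+s. ennreal (gap s x) \<partial>M))" by (rule ext) (rule f_minus_eq)
  hence "f_minus M G \<in> borel_measurable lborel" by simp
  hence fr: "(\<lambda>x. real_of_ereal (f_minus M G x)) \<in> borel_measurable lborel" by (rule borel_measurable_real_of_ereal)
  have em: "(\<lambda>x::real. e (of_real (- t * x))) \<in> borel_measurable lborel"
    using borel_measurable_continuous_onI[of "\<lambda>x::real. e (of_real (- t * x))"]
    unfolding e_def by (simp add: continuous_intros)
  have m1: "(\<lambda>x. of_real (real_of_ereal (f_minus M G x)) * e (of_real (- t * x))) \<in> borel_measurable lborel"
    by (rule borel_measurable_times[OF measurable_compose[OF fr borel_measurable_of_real] em])
  have i1: "integrable lborel (\<lambda>x. of_real (gam x) * e (of_real (- t * x)))"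
    unfolding g by (rule integrable_snd[OF int'])
  show "integrable lborel (\<lambda>x. of_real (real_of_ereal (f_minus M G x)) * e (of_real (- t * x)))"
    using i1 by (rule integrable_cong_AE_imp[OF _ m1]) (use ae in \<open>auto elim!: eventually_mono\<close>)
  show i2: "integrable M (\<lambda>s. 2 * s / (s\<^sup>2 + 4 * pi\<^sup>2 * t\<^sup>2))"
  proof (rule integrable_dominated)
    define b where "b = 4 * pi\<^sup>2 * t\<^sup>2"
    have b: "0 < b" using t by (simp add: b_def)
    \<comment> \<open>It makes \<open>s\<^sup>2 + b \<ge> c * (1 + s\<^sup>2)\<close>; positivity of
      \<open>b\<close> is where \<open>t \<noteq> 0\<close> enters.\<close>
    define c where "c = min b 1"
    have c: "0 < c" "c \<le> b" "c \<le> 1" using b by (auto simp: c_def)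
    show "norm (2 * s / (s\<^sup>2 + 4 * pi\<^sup>2 * t\<^sup>2)) \<le> (2 / c) * (s / (1 + s\<^sup>2))" if s: "0 < s" for s
    proof -
      have "c * s\<^sup>2 \<le> 1 * s\<^sup>2" using c by (intro mult_right_mono) auto
      hence "c * (1 + s\<^sup>2) \<le> s\<^sup>2 + b" using c by (simp add: algebra_simps)
      hence "2 * s / (s\<^sup>2 + b) \<le> 2 * s / (c * (1 + s\<^sup>2))"
        using s c b by (intro divide_left_mono mult_pos_pos) (auto simp: add_pos_nonneg add_pos_pos)
      moreover have "0 \<le> 2 * s / (s\<^sup>2 + b)" using s b by simp
      moreover have "2 * s / (c * (1 + s\<^sup>2)) = (2 / c) * (s / (1 + s\<^sup>2))" by simp
      ultimately show ?thesis unfolding b_def by (simp only: real_norm_def abs_of_nonneg)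
    qed
  qed measurable
  have inner: "(\<integral>x. \<phi> s x \<partial>lborel) = of_real (2 * s / (s\<^sup>2 + 4 * pi\<^sup>2 * t\<^sup>2)) - L_hat s t" if "s \<in> space M" for s
    unfolding \<phi>_def using that by (intro fourier_gap) (simp add: space_M)
  have i3: "integrable M (\<lambda>s. \<integral>x. \<phi> s x \<partial>lborel)" by (rule integrable_fst[OF int'])
  have i2c: "integrable M (\<lambda>s. of_real (2 * s / (s\<^sup>2 + 4 * pi\<^sup>2 * t\<^sup>2)) :: complex)" by (rule integrable_of_real[OF i2])
  have Lh: "L_hat s t = of_real (2 * s / (s\<^sup>2 + 4 * pi\<^sup>2 * t\<^sup>2)) - (\<integral>x. \<phi> s x \<partial>lborel)" if "s \<in> space M" for s
    using inner[OF that] by simp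
  show i4: "integrable M (\<lambda>s. L_hat s t)"
    using Bochner_Integration.integrable_diff[OF i2c i3]
    by (rule Bochner_Integration.integrable_cong[THEN iffD1, rotated -1]) (simp_all add: inner)
  have "(\<integral>x. of_real (real_of_ereal (f_minus M G x)) * e (of_real (- t * x)) \<partial>lborel) = (\<integral>x. (\<integral>s. \<phi> s x \<partial>M) \<partial>lborel)"
    unfolding g[symmetric] by (rule integral_cong_AE[OF m1 borel_measurable_integrable[OF i1] ae])
  also have "\<dots> = (\<integral>s. (\<integral>x. \<phi> s x \<partial>lborel) \<partial>M)" by (rule Fubini_integral[OF int'])
  also have "\<dots> = (\<integral>s. of_real (2 * s / (s\<^sup>2 + 4 * pi\<^sup>2 * t\<^sup>2)) - L_hat s t \<partial>M)"
    by (rule Bochner_Integration.integral_cong[OF refl inner])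
  also have "\<dots> = of_real (\<integral>s. 2 * s / (s\<^sup>2 + 4 * pi\<^sup>2 * t\<^sup>2) \<partial>M) - (\<integral>s. L_hat s t \<partial>M)"
    unfolding Bochner_Integration.integral_diff[OF i2c i4] by (simp only: integral_complex_of_real)
  finally show "(\<integral>x. of_real (real_of_ereal (f_minus M G x)) * e (of_real (- t * x)) \<partial>lborel) =
         of_real (\<integral>s. 2 * s / (s\<^sup>2 + 4 * pi\<^sup>2 * t\<^sup>2) \<partial>M) - (\<integral>s. L_hat s t \<partial>M)" .
qed


section \<open>Extremality and uniqueness\<close>

lemma minorant_dominated:
  fixes Gt :: "complex \<Rightarrow> complex"
  assumes re: "real_entire Gt" and ty: "exp_type_at_most (2 * pi) Gt"
    and le: "\<And>x::real. ereal (Re (Gt (of_real x))) \<le> f_mu M x"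
  shows "ext_integral lborel (f_minus M G) \<le> ext_integral lborel (f_minus M Gt)"
    and "ext_integral lborel (f_minus M G) = ext_integral lborel (f_minus M Gt) \<Longrightarrow> Gt = G"
proof -
  have holGt: "Gt holomorphic_on UNIV" and realGt: "\<And>x. Gt (of_real x) \<in> \<real>"
    using re by (auto simp: real_entire_def)
  define D where "D = (\<lambda>z. G z - Gt z)"
  have holD: "D holomorphic_on UNIV" unfolding D_def by (intro holomorphic_intros holomorphic_G holGt)
  have realD: "D (of_real x) \<in> \<real>" for x unfolding D_def by (intro Reals_diff G_of_real realGt)
  have tyD: "exp_type_at_most (2 * pi) D"
    unfolding exp_type_at_most_def
  proof (intro allI impI)
    fix \<epsilon> :: real assume \<epsilon>: "0 < \<epsilon>"
    obtain C1 where C1: "\<And>z. norm (G z) \<le> C1 * exp ((2 * pi + \<epsilon>) * norm z)"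
      using exp_type_G \<epsilon> unfolding exp_type_at_most_def by blast
    obtain C2 where C2: "\<And>z. norm (Gt z) \<le> C2 * exp ((2 * pi + \<epsilon>) * norm z)"
      using ty \<epsilon> unfolding exp_type_at_most_def by blast
    have "norm (D z) \<le> (C1 + C2) * exp ((2 * pi + \<epsilon>) * norm z)" for z
      using order.trans[OF norm_triangle_ineq4 add_mono[OF C1 C2]] unfolding D_def by (simp only: distrib_right)
    thus "\<exists>C. \<forall>z. norm (D z) \<le> C * exp ((2 * pi + \<epsilon>) * norm z)" by blast
  qed
  have contD: "continuous_on UNIV (\<lambda>x. D (of_real x))"
    by (intro continuous_on_compose2[OF holomorphic_on_imp_continuous_on[OF holD]] continuous_intros) auto
  have measD: "(\<lambda>x. D (of_real x)) \<in> borel_measurable lborel"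
    using borel_measurable_continuous_onI[OF contD] by simp
  define \<delta> where "\<delta> = (\<lambda>x. Re (D (of_real x)))"
  have D\<delta>: "D (of_real x) = of_real (\<delta> x)" for x
    using realD[of x] by (simp add: \<delta>_def complex_is_Real_iff complex_eq_iff)
  \<comment> \<open>Off 0 this is \<open>f - Gt\<close>. Written with \<open>gam\<close>, its
    integral splits into that of the gap and that of \<delta>, the restriction of an entire
    function, to which the quadrature applies.\<close>
  define \<phi> where "\<phi> = (\<lambda>x. gam x + \<delta> x)"
  have \<phi>: "\<phi> x = f x - Re (Gt (of_real x))" if "x \<noteq> 0" for x
    using f_minus_G[OF that] by (simp add: \<phi>_def \<delta>_def D_def)
  have f\<phi>: "f_minus M Gt x = ereal (\<phi> x)" if "x \<noteq> 0" for x
    by (simp add: f_minus_def f_mu_eq[OF that] \<phi>[OF that])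
  have \<phi>0: "0 \<le> \<phi> x" if "x \<noteq> 0" for x
    using le[of x] by (simp add: f_mu_eq[OF that] \<phi>[OF that])
  have nonneg: "0 \<le> f_minus M Gt x" for x
    using le[of x] unfolding f_minus_def by (cases "f_mu M x") auto
  have meas\<delta>: "\<delta> \<in> borel_measurable lborel"
    unfolding \<delta>_def by (rule measurable_compose[OF measD borel_measurable_Re])
  have meas\<phi>: "\<phi> \<in> borel_measurable lborel"
    unfolding \<phi>_def using meas\<delta> measurable_gam by (rule borel_measurable_add[rotated])
  have ae0: "AE x in lborel. x \<noteq> (0::real)" by (rule AE_lborel_singleton)
  have ext: "ext_integral lborel (f_minus M Gt) = enn2ereal (\<integral>\<^sup>+x. ennreal (\<phi> x) \<partial>lborel)"
  proof -
    have "ext_integral lborel (f_minus M Gt) = enn2ereal (\<integral>\<^sup>+x. e2ennreal (f_minus M Gt x) \<partial>lborel)"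
      by (rule ext_integral_nonneg) (rule nonneg)
    also have "(\<integral>\<^sup>+x. e2ennreal (f_minus M Gt x) \<partial>lborel) = (\<integral>\<^sup>+x. ennreal (\<phi> x) \<partial>lborel)"
      by (rule nn_integral_cong_AE) (use ae0 in eventually_elim, simp add: f\<phi>)
    finally show ?thesis .
  qed
  obtain S where S: "0 < S" "\<And>c N. 1/2 < c \<Longrightarrow> c < 1 \<Longrightarrow> (\<Sum>j\<le>N. (cos (pi * (c * (real j + 1/2))) / pi)\<^sup>2 / (c * (real j + 1/2))\<^sup>2
        + (cos (pi * (c * (- (real j + 1/2)))) / pi)\<^sup>2 / (c * (- (real j + 1/2)))\<^sup>2) \<le> S * sqrt (1 - c)"
    by (rule dilated_nodes_sum_bound) (rule that)
  define C where "C = 100 * weight"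
  have C: "0 \<le> C" using weight_nonneg by (simp add: C_def)
  {
    \<comment> \<open>In the opposite case the right side is infinite, so that the inequality is
      trivial and equality impossible. Finiteness makes \<phi> integrable, and subtracting
      \<open>gam\<close> makes \<open>D\<close> integrable.\<close>
    assume finite: "(\<integral>\<^sup>+x. ennreal (\<phi> x) \<partial>lborel) < \<infinity>"
    have ae\<phi>: "AE x in lborel. 0 \<le> \<phi> x" using ae0 by eventually_elim (rule \<phi>0)
    have int\<phi>: "integrable lborel \<phi>" by (rule integrableI_nonneg[OF meas\<phi> ae\<phi> finite])
    have int\<delta>: "integrable lborel \<delta>"
      using Bochner_Integration.integrable_diff[OF int\<phi> integrable_gam] by (simp add: \<phi>_def)
    have intD: "integrable lborel (\<lambda>x. D (of_real x))"
      unfolding D\<delta> by (rule integrable_of_real[OF int\<delta>])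
    define I where "I = (\<integral>x. \<delta> x \<partial>lborel)"
    have I\<phi>: "(\<integral>x. \<phi> x \<partial>lborel) = (\<integral>x. gam x \<partial>lborel) + I"
      unfolding \<phi>_def I_def by (rule Bochner_Integration.integral_add[OF integrable_gam int\<delta>])
    define P where "P = (\<lambda>c N. \<Sum>j\<le>N. c * \<delta> (c * (real j + 1/2)) + c * \<delta> (c * (- (real j + 1/2))))"
    have P: "P c \<longlonglongrightarrow> I" if c: "0 < c" "c < 1" for c
    proof -
      have "(\<lambda>N. \<Sum>j\<le>N. of_real c * D (of_real (c * (real j + 1/2))) + of_real c * D (of_real (c * (- (real j + 1/2)))))
           \<longlonglongrightarrow> (\<integral>x. D (of_real x) \<partial>lborel)"
        by (rule quadrature_symmetric[OF holD tyD intD c])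
      also have "(\<integral>x. D (of_real x) \<partial>lborel) = of_real I" unfolding D\<delta> I_def by (rule integral_complex_of_real)
      finally have "(\<lambda>N. of_real (P c N) :: complex) \<longlonglongrightarrow> of_real I"
        unfolding D\<delta> P_def by simp
      thus ?thesis by (simp only: tendsto_of_real_iff)
    qed
    \<comment> \<open>The values of \<phi> at the nodes are nonnegative, so their sum is at least
      the one at \<open>c * h\<close>. Passing from \<phi> to \<delta> costs the values of
      \<open>gam\<close> at the dilated nodes, in total at most
      \<open>C * (S * sqrt (1 - c))\<close>.\<close>
    have low: "c * \<phi> (c * h) - C * (S * sqrt (1 - c)) \<le> I"
      if c: "1/2 < c" "c < 1" and h: "h = real i + 1/2 \<or> h = - (real i + 1/2)" for c h i
    proof -
      define k where "k = (\<lambda>x. (cos (pi * x) / pi)\<^sup>2 / x\<^sup>2)"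
      have c0: "0 < c" using c by simp
      have nz: "c * (real j + 1/2) \<noteq> 0" "c * (- (real j + 1/2)) \<noteq> 0" for j using c0 by auto
      have lo: "c * \<phi> x - C * k x \<le> c * \<delta> x" if "x \<noteq> 0" for x
      proof -
        have "c * gam x \<le> 1 * gam x" using c gam_nonneg by (intro mult_right_mono) auto
        also have "\<dots> \<le> C * k x" using gam_le[OF that] by (simp add: C_def k_def)
        finally show ?thesis by (simp add: \<phi>_def distrib_left)
      qed
      have "c * \<phi> (c * h) - C * (S * sqrt (1 - c)) \<le> P c N" if N: "i \<le> N" for N
      proof -
        have "c * \<phi> (c * h) \<le> (\<Sum>j\<le>N. c * \<phi> (c * (real j + 1/2)) + c * \<phi> (c * (- (real j + 1/2))))"
        proof -
          have "c * \<phi> (c * h) \<le> c * \<phi> (c * (real i + 1/2)) + c * \<phi> (c * (- (real i + 1/2)))"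
            using h mult_nonneg_nonneg[OF less_imp_le[OF c0] \<phi>0[OF nz(1)[of i]]] mult_nonneg_nonneg[OF less_imp_le[OF c0] \<phi>0[OF nz(2)[of i]]] by auto
          also have "\<dots> \<le> (\<Sum>j\<le>N. c * \<phi> (c * (real j + 1/2)) + c * \<phi> (c * (- (real j + 1/2))))"
            using N by (intro member_le_sum[of i "{..N}" "\<lambda>j. c * \<phi> (c * (real j + 1/2)) + c * \<phi> (c * (- (real j + 1/2)))"]
                add_nonneg_nonneg mult_nonneg_nonneg less_imp_le[OF c0] \<phi>0 nz) auto
          finally show ?thesis .
        qed
        moreover have "C * (\<Sum>j\<le>N. k (c * (real j + 1/2)) + k (c * (- (real j + 1/2)))) \<le> C * (S * sqrt (1 - c))"
          unfolding k_def by (intro mult_left_mono S(2) c C)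
        moreover have "(\<Sum>j\<le>N. c * \<phi> (c * (real j + 1/2)) + c * \<phi> (c * (- (real j + 1/2))))
            - C * (\<Sum>j\<le>N. k (c * (real j + 1/2)) + k (c * (- (real j + 1/2)))) \<le> P c N"
        proof -
          have eq: "(\<Sum>j\<le>N. c * \<phi> (c * (real j + 1/2)) + c * \<phi> (c * (- (real j + 1/2))))
            - C * (\<Sum>j\<le>N. k (c * (real j + 1/2)) + k (c * (- (real j + 1/2))))
            = (\<Sum>j\<le>N. (c * \<phi> (c * (real j + 1/2)) + c * \<phi> (c * (- (real j + 1/2)))) - C * (k (c * (real j + 1/2)) + k (c * (- (real j + 1/2)))))"
            unfolding sum_distrib_left by (rule sum_subtractf[symmetric])
          show ?thesis unfolding eq P_def
          proof (rule sum_mono)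
            fix j
            show "(c * \<phi> (c * (real j + 1/2)) + c * \<phi> (c * (- (real j + 1/2)))) - C * (k (c * (real j + 1/2)) + k (c * (- (real j + 1/2))))
              \<le> c * \<delta> (c * (real j + 1/2)) + c * \<delta> (c * (- (real j + 1/2)))"
              using add_mono[OF lo[OF nz(1)[of j]] lo[OF nz(2)[of j]]] unfolding distrib_left[of C] by linarith
          qed
        qed
        ultimately show ?thesis by linarith
      qed
      thus ?thesis by (intro tendsto_lowerbound[OF P[OF c0 c(2)]]) (auto intro!: eventually_sequentiallyI[of i])
    qed
    \<comment> \<open>The continuity of \<phi> at \<open>h\<close> is taken from
      \<open>f - Gt\<close>: \<open>f\<close> is differentiable away from 0.\<close>
    have limit: "\<phi> h \<le> I" if h: "h = real i + 1/2 \<or> h = - (real i + 1/2)" for h i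
    proof -
      have h0: "h \<noteq> 0" using h by auto
      have cf: "isCont f h" using f_deriv[OF h0] by (rule DERIV_isCont)
      have "continuous_on UNIV (\<lambda>x. Re (Gt (of_real x)))"
        by (intro continuous_on_Re continuous_on_compose2[OF holomorphic_on_imp_continuous_on[OF holGt]] continuous_intros) auto
      hence cG: "isCont (\<lambda>x. Re (Gt (of_real x))) h" by (simp add: continuous_on_eq_continuous_at)
      have cfG: "isCont (\<lambda>x. f x - Re (Gt (of_real x))) h" by (intro continuous_intros cf cG)
      have "((\<lambda>c. c * h) \<longlongrightarrow> 1 * h) (at_left 1)" by (intro tendsto_intros)
      hence ch: "((\<lambda>c. c * h) \<longlongrightarrow> h) (at_left 1)" by simp
      have "((\<lambda>c. f (c * h) - Re (Gt (of_real (c * h)))) \<longlongrightarrow> f h - Re (Gt (of_real h))) (at_left 1)"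
        by (rule isCont_tendsto_compose[OF cfG ch])
      moreover have "((\<lambda>c. C * (S * sqrt (1 - c))) \<longlongrightarrow> C * (S * sqrt (1 - 1))) (at_left 1)"
        by (intro tendsto_intros)
      ultimately have "((\<lambda>c. c * (f (c * h) - Re (Gt (of_real (c * h)))) - C * (S * sqrt (1 - c))) \<longlongrightarrow> 1 * (f h - Re (Gt (of_real h))) - C * (S * sqrt (1 - 1))) (at_left 1)"
        by (rule tendsto_diff[OF tendsto_mult[OF tendsto_ident_at]])
      moreover have "\<forall>\<^sub>F c in at_left 1. c * (f (c * h) - Re (Gt (of_real (c * h)))) - C * (S * sqrt (1 - c)) \<le> I"
      proof -
        have "\<forall>\<^sub>F c in at_left 1. c \<in> {1/2<..<1::real}" by (rule eventually_at_left_real) simp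
        thus ?thesis
        proof eventually_elim
          case (elim c)
          hence c: "1/2 < c" "c < 1" by auto
          have "c * h \<noteq> 0" using c h0 by simp
          from \<phi>[OF this] low[OF c h] show ?case by (simp only:)
        qed
      qed
      ultimately have "1 * (f h - Re (Gt (of_real h))) - C * (S * sqrt (1 - 1)) \<le> I"
        by (rule tendsto_upperbound) simp
      thus ?thesis by (simp add: \<phi>[OF h0])
    qed
    have I0: "0 \<le> I" using limit[of "1/2" 0] \<phi>0[of "1/2"] by simp
    have ext\<phi>: "ext_integral lborel (f_minus M Gt) = ereal ((\<integral>x. gam x \<partial>lborel) + I)"
      unfolding ext I\<phi>[symmetric] using nn_integral_eq_integral[OF int\<phi> ae\<phi>] integral_nonneg_AE[OF ae\<phi>] by simp
    have eqG: "Gt = G" if I: "I = 0"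
    proof -
      \<comment> \<open>\<open>limit\<close> and nonnegativity squeeze \<phi> to 0 at the nodes;
        \<open>gam\<close> vanishes there because its bound contains the squared cosine.\<close>
      have zero: "\<phi> h = 0" "gam h = 0" if h: "h = real i + 1/2 \<or> h = - (real i + 1/2)" for h i
      proof -
        have h0: "h \<noteq> 0" using h by auto
        show "\<phi> h = 0" using limit[OF h] \<phi>0[OF h0] I by simp
        have "cos (of_real pi * of_real (real i + 1/2) :: complex) = 0"
          unfolding cos_pi_eq_0_iff by (intro exI[of _ "int i"]) simp
        hence "of_real (cos (pi * (real i + 1/2))) = (0::complex)" by (simp only: of_real_mult[symmetric] cos_of_real)
        hence "cos (pi * (real i + 1/2)) = 0" by (simp only: of_real_eq_0_iff)
        hence "cos (pi * h) = 0" using h by (elim disjE) (simp_all only: mult_minus_right cos_minus)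
        hence "gam h \<le> 0" using gam_le[OF h0] by simp
        thus "gam h = 0" using gam_nonneg[of h] by simp
      qed
      have deriv0: "D (of_real h) = 0 \<and> deriv D (of_real h) = 0" if h: "h = real i + 1/2 \<or> h = - (real i + 1/2)" for h i
      proof
        have h0: "h \<noteq> 0" using h by auto
        show "D (of_real h) = 0" using zero[OF h] unfolding D\<delta> by (simp add: \<phi>_def)
        have nbhd: "x \<noteq> 0" if "\<bar>h - x\<bar> < \<bar>h\<bar>" for x using that by auto
        have derR: "((\<lambda>x. Re (F (of_real x))) has_real_derivative Re (deriv F (of_real h))) (at h)"
          if "F holomorphic_on UNIV" for F :: "complex \<Rightarrow> complex"
        proof -
          have "(F has_field_derivative deriv F (of_real h)) (at (of_real h))"
            by (rule holomorphic_derivI[OF that open_UNIV]) simp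
          hence "((\<lambda>x. F (of_real x)) has_vector_derivative deriv F (of_real h)) (at h)"
            by (rule has_vector_derivative_real_field)
          from bounded_linear.has_vector_derivative[OF bounded_linear_Re this]
          show ?thesis by (simp add: has_real_derivative_iff_has_vector_derivative)
        qed
        \<comment> \<open>A nonnegative function that vanishes at \<open>h\<close> has a minimum
          there. Used for \<open>G\<close> and for \<open>Gt\<close>, this makes the real parts of
          both derivatives at \<open>h\<close> equal to the derivative of \<open>f\<close>.\<close>
        have loc: "- sgn h * df h - Re (deriv F (of_real h)) = 0"
          if hol: "F holomorphic_on UNIV" and nn: "\<And>x. x \<noteq> 0 \<Longrightarrow> 0 \<le> f x - Re (F (of_real x))" and z: "f h - Re (F (of_real h)) = 0" for F
        proof (rule DERIV_local_min[where f = "\<lambda>x. f x - Re (F (of_real x))" and x = h and d = "\<bar>h\<bar>"])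
          show "((\<lambda>x. f x - Re (F (of_real x))) has_real_derivative - sgn h * df h - Re (deriv F (of_real h))) (at h)"
            by (intro DERIV_diff f_deriv h0 derR hol)
          show "\<forall>y. \<bar>h - y\<bar> < \<bar>h\<bar> \<longrightarrow> f h - Re (F (of_real h)) \<le> f y - Re (F (of_real y))"
            unfolding z using nn nbhd by blast
        qed (use h0 in simp)
        have "- sgn h * df h - Re (deriv G (of_real h)) = 0"
        proof (rule loc[OF holomorphic_G])
          show "0 \<le> f x - Re (G (of_real x))" if "x \<noteq> 0" for x using f_minus_G[OF that] gam_nonneg[of x] by simp
          show "f h - Re (G (of_real h)) = 0" using f_minus_G[OF h0] zero(2)[OF h] by simp
        qed
        moreover have "- sgn h * df h - Re (deriv Gt (of_real h)) = 0"
        proof (rule loc[OF holGt])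
          show "0 \<le> f x - Re (Gt (of_real x))" if "x \<noteq> 0" for x using \<phi>[OF that] \<phi>0[OF that] by simp
          show "f h - Re (Gt (of_real h)) = 0" using \<phi>[OF h0] zero(1)[OF h] by simp
        qed
        moreover have "deriv D (of_real h) = deriv G (of_real h) - deriv Gt (of_real h)"
          unfolding D_def using holomorphic_G holGt
          by (intro deriv_diff) (auto simp: holomorphic_on_def)
        ultimately have re0: "Re (deriv D (of_real h)) = 0" by simp
        \<comment> \<open>\<open>D\<close> is real on the real line, so the imaginary part of its
          derivative vanishes there.\<close>
        have "((\<lambda>x. D (of_real x)) has_vector_derivative deriv D (of_real h)) (at h)"
          by (rule has_vector_derivative_real_field) (rule holomorphic_derivI[OF holD open_UNIV], simp)
        from bounded_linear.has_vector_derivative[OF bounded_linear_Im this]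
        have "((\<lambda>x. 0) has_real_derivative Im (deriv D (of_real h))) (at h)"
          unfolding D\<delta> by (simp add: has_real_derivative_iff_has_vector_derivative)
        hence "Im (deriv D (of_real h)) = 0" using DERIV_unique[OF _ DERIV_const] by blast
        with re0 show "deriv D (of_real h) = 0" by (simp add: complex_eq_iff)
      qed
      have node: "D (of_int k + 1/2) = 0 \<and> deriv D (of_int k + 1/2) = 0" for k :: int
      proof -
        define h where "h = (of_int k + 1/2 :: real)"
        have "\<exists>i. h = real i + 1/2 \<or> h = - (real i + 1/2)"
        proof (cases "0 \<le> k")
          case True
          thus ?thesis by (intro exI[of _ "nat k"]) (simp add: h_def)
        next
          case False
          thus ?thesis by (intro exI[of _ "nat (- k - 1)"]) (simp add: h_def)
        qed
        then obtain i where "h = real i + 1/2 \<or> h = - (real i + 1/2)" by blast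
        from deriv0[OF this] show ?thesis by (simp add: h_def)
      qed
      obtain B where B: "0 < B" "\<And>z. norm (D z) \<le> B * exp (2 * pi * \<bar>Im z\<bar>)"
        by (rule integrable_exp_type_bounded[OF holD tyD _ intD]) (simp, rule that)
      obtain A where A: "\<And>z. D z = A * (cos (of_real pi * z))\<^sup>2"
        by (rule exp_type_double_zeros[OF holD B]) (rule node[THEN conjunct1] node[THEN conjunct2] that, assumption?)+
      have \<delta>A: "\<delta> x = Re A * (cos (pi * x))\<^sup>2" for x
        unfolding \<delta>_def A by (simp add: cos_of_real flip: of_real_mult of_real_power)
      have half: "(cos (pi * (1/2 * h)))\<^sup>2 = 1/2" if h: "h = real i + 1/2 \<or> h = - (real i + 1/2)" for h i
      proof -
        have "cos (of_real pi * of_real (real i + 1/2) :: complex) = 0"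
          unfolding cos_pi_eq_0_iff by (intro exI[of _ "int i"]) simp
        hence "of_real (cos (pi * (real i + 1/2))) = (0::complex)" by (simp only: of_real_mult[symmetric] cos_of_real)
        hence "cos (pi * (real i + 1/2)) = 0" by (simp only: of_real_eq_0_iff)
        hence "cos (pi * h) = 0" using h by (elim disjE) (simp_all only: mult_minus_right cos_minus)
        moreover have "2 * (pi * (1/2 * h)) = pi * h" by simp
        ultimately have "cos (2 * (pi * (1/2 * h))) = 0" by (simp only:)
        thus ?thesis using cos_double_cos[of "pi * (1/2 * h)"] by simp
      qed
      \<comment> \<open>With \<open>c = 1/2\<close> all nodes lie where \<open>cos\<^sup>2\<close> is \<open>1/2\<close>, so the sums converge only if \<open>Re A = 0\<close>.\<close>
      have "P (1/2) N = Re A / 2 * real (Suc N)" for N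
      proof -
        have "P (1/2) N = (\<Sum>j\<le>N. Re A / 2)"
          unfolding P_def \<delta>A by (rule sum.cong[OF refl], subst half, rule disjI1, rule refl, subst half, rule disjI2, rule refl) simp
        thus ?thesis by simp
      qed
      hence "P (1/2) = (\<lambda>N. Re A / 2 * real (Suc N))" by (simp only: fun_eq_iff simp_thms)
      moreover have "P (1/2) \<longlonglongrightarrow> I" by (rule P) simp_all
      ultimately have lim: "(\<lambda>N. Re A / 2 * real (Suc N)) \<longlonglongrightarrow> I" by (simp only:)
      have "(\<lambda>N. Re A / 2 * real (Suc (Suc N)) - Re A / 2 * real (Suc N)) \<longlonglongrightarrow> I - I"
        by (rule tendsto_diff[OF LIMSEQ_Suc[OF lim] lim])
      moreover have "(\<lambda>N. Re A / 2 * real (Suc (Suc N)) - Re A / 2 * real (Suc N)) = (\<lambda>N. Re A / 2)"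
        by (simp add: fun_eq_iff field_simps)
      ultimately have "(\<lambda>N::nat. Re A / 2) \<longlonglongrightarrow> I - I" by (simp only:)
      hence "Re A = 0" by (simp add: LIMSEQ_const_iff)
      hence "D (of_real x) = 0" for x unfolding D\<delta> \<delta>A by simp
      \<comment> \<open>At 0 the cosine is 1, so the vanishing of \<open>D\<close> on the reals
        removes the imaginary part of \<open>A\<close> too.\<close>
      hence "A * (cos (of_real pi * of_real 0))\<^sup>2 = 0" using A by metis
      hence "A = 0" by simp
      hence "D z = 0" for z using A by simp
      thus "Gt = G" by (auto simp: D_def fun_eq_iff)
    qed
    note I0 ext\<phi> eqG
  }
  note fin_case = this
  show "ext_integral lborel (f_minus M G) \<le> ext_integral lborel (f_minus M Gt)"
  proof (cases "(\<integral>\<^sup>+x. ennreal (\<phi> x) \<partial>lborel) < \<infinity>")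
    case True
    show ?thesis unfolding ext_integral_f_minus_G fin_case(2)[OF True] using fin_case(1)[OF True] by simp
  next
    case False
    hence "(\<integral>\<^sup>+x. ennreal (\<phi> x) \<partial>lborel) = top" by (simp add: less_top[symmetric])
    thus ?thesis unfolding ext by simp
  qed
  assume eq: "ext_integral lborel (f_minus M G) = ext_integral lborel (f_minus M Gt)"
  show "Gt = G"
  proof (cases "(\<integral>\<^sup>+x. ennreal (\<phi> x) \<partial>lborel) < \<infinity>")
    case True
    have "(\<integral>x. \<delta> x \<partial>lborel) = 0" using eq unfolding ext_integral_f_minus_G fin_case(2)[OF True] by simp
    thus ?thesis by (rule fin_case(3)[OF True])
  next
    case False
    hence "(\<integral>\<^sup>+x. ennreal (\<phi> x) \<partial>lborel) = top" by (simp add: less_top[symmetric])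
    thus ?thesis using eq unfolding ext ext_integral_f_minus_G by simp
  qed
qed

end

theorem theorem1p1:
  fixes M :: "real measure"
  assumes sets_M: "sets M = sets (restrict_space borel {0<..})"
    and pos: "0 < (\<integral>\<^sup>+s. ennreal (s / (s\<^sup>2 + 1)) \<partial>M)"
    and fin: "(\<integral>\<^sup>+s. ennreal (s / (s\<^sup>2 + 1)) \<partial>M) < \<infinity>"
  shows
    "(real_entire (G_mu M) \<and> exp_type_at_most (2 * pi) (G_mu M)) \<and>
     (\<forall>x::real. x \<noteq> 0 \<longrightarrow>
       (\<forall>s>0. 0 \<le> exp (- s * \<bar>x\<bar>) - Re (L s (of_real x))) \<and>
       integrable M (\<lambda>s. exp (- s * \<bar>x\<bar>) - Re (L s (of_real x)))) \<and>
     (\<forall>x::real. 0 \<le> f_minus M (G_mu M) x \<and>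
       f_minus M (G_mu M) x =
         ext_integral M (\<lambda>s. ereal (exp (- s * \<bar>x\<bar>) - Re (L s (of_real x))))) \<and>
     (ext_integrable lborel (f_minus M (G_mu M)) \<and>
       ext_integral lborel (f_minus M (G_mu M)) =
         ext_integral M (\<lambda>s. ereal (2 / s - 1 / sinh (s / 2)))) \<and>
     (\<forall>t::real. t \<noteq> 0 \<longrightarrow>
       integrable lborel (\<lambda>x. of_real (real_of_ereal (f_minus M (G_mu M) x)) * e (of_real (- t * x))) \<and>
       integrable M (\<lambda>s. 2 * s / (s\<^sup>2 + 4 * pi\<^sup>2 * t\<^sup>2)) \<and>
       integrable M (\<lambda>s. L_hat s t) \<and>
       (\<integral>x. of_real (real_of_ereal (f_minus M (G_mu M) x)) * e (of_real (- t * x)) \<partial>lborel) =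
         of_real (\<integral>s. 2 * s / (s\<^sup>2 + 4 * pi\<^sup>2 * t\<^sup>2) \<partial>M) - (\<integral>s. L_hat s t \<partial>M)) \<and>
     (\<forall>Gt. real_entire Gt \<and> exp_type_at_most (2 * pi) Gt \<and>
         (\<forall>x::real. ereal (Re (Gt (of_real x))) \<le> f_mu M x) \<longrightarrow>
       ext_integral lborel (f_minus M (G_mu M)) \<le> ext_integral lborel (f_minus M Gt) \<and>
       (ext_integral lborel (f_minus M (G_mu M)) = ext_integral lborel (f_minus M Gt) \<longleftrightarrow> Gt = G_mu M))"
proof -
  interpret extremal_measure M by (unfold_locales) (fact sets_M fin)+
  show ?thesis
    unfolding G_mu_eq
  proof (intro conjI allI impI)
    show "real_entire G" "exp_type_at_most (2 * pi) G" by (rule real_entire_G exp_type_G)+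
    show "0 \<le> exp (- s * \<bar>x\<bar>) - Re (L s (of_real x))" if "0 < s" for s x
      using gap_nonneg[OF that] by (simp only: gap_def)
    show "integrable M (\<lambda>s. exp (- s * \<bar>x\<bar>) - Re (L s (of_real x)))" if "x \<noteq> 0" for x
      using integrable_gap_M[OF that] by (simp only: gap_def)
    show "0 \<le> f_minus M G x" for x by (simp add: f_minus_eq)
    show "f_minus M G x = ext_integral M (\<lambda>s. ereal (exp (- s * \<bar>x\<bar>) - Re (L s (of_real x))))" for x
      using ext_integral_gap[of x] unfolding f_minus_eq gap_def by (rule sym)
    show "ext_integrable lborel (f_minus M G)" by (rule ext_integrable_f_minus_G)
    show "ext_integral lborel (f_minus M G) = ext_integral M (\<lambda>s. ereal (2 / s - 1 / sinh (s / 2)))"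
      by (rule ext_integral_f_minus_G_eq)
  next
    fix t :: real assume t: "t \<noteq> 0"
    show "integrable lborel (\<lambda>x. of_real (real_of_ereal (f_minus M G x)) * e (of_real (- t * x)))"
      "integrable M (\<lambda>s. 2 * s / (s\<^sup>2 + 4 * pi\<^sup>2 * t\<^sup>2))" "integrable M (\<lambda>s. L_hat s t)"
      "(\<integral>x. of_real (real_of_ereal (f_minus M G x)) * e (of_real (- t * x)) \<partial>lborel) =
         of_real (\<integral>s. 2 * s / (s\<^sup>2 + 4 * pi\<^sup>2 * t\<^sup>2) \<partial>M) - (\<integral>s. L_hat s t \<partial>M)"
      by (rule fourier_f_minus_G[OF t])+
  next
    fix Gt assume Gt: "real_entire Gt \<and> exp_type_at_most (2 * pi) Gt \<and> (\<forall>x::real. ereal (Re (Gt (of_real x))) \<le> f_mu M x)"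
    show "ext_integral lborel (f_minus M G) \<le> ext_integral lborel (f_minus M Gt)"
      using Gt by (intro minorant_dominated) auto
    show "ext_integral lborel (f_minus M G) = ext_integral lborel (f_minus M Gt) \<longleftrightarrow> Gt = G"
      using Gt minorant_dominated(2)[of Gt] by auto
  qed
qed

end
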